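(* For every $R \geq 0$ there exists $N \geq 0$ such that both of the following hold. (1) $\Sigma^{\mathsf{Br}}_{i_1} \cdots \Sigma^{\mathsf{Br}}_{i_n}(U)$ contains a translate of a pattern $P$ with $\mathrm{rad}(P) \geq R$, for every finite sequence $(i_1, \ldots, i_n) \in \{1,2,3\}^n$ that contains more than $N$ occurrences of $3$. (2) $\Sigma^{\mathsf{JP}}_{a_1,b_1} \cdots \Sigma^{\mathsf{JP}}_{a_n,b_n}(U)$ contains a translate of a pattern $P$ with $\mathrm{rad}(P) \geq R$, for every admissible Jacobi-Perron expansion $(a_1,b_1), \ldots, (a_n,b_n)$ with $n \geq N$.
   Context: Let $(\mathbf e_1,\mathbf e_2,\mathbf e_3)$ be the canonical basis of $\mathbb R^3$. For $\mathbf x\in\mathbb Z^3$ and $i\in\{1,2,3\}$, the face $[\mathbf x,i]^\star$ is the unit square $\{\mathbf x+\lambda\mathbf e_j+\mu\mathbf e_k:\lambda,\mu\in[0,1]\}$ where $\{i,j,k\}=\{1,2,3\}$. A pattern is a finite union of faces; translates are by vectors of $\mathbb Z^3$. Let $U=[\mathbf 0,1]^\star\cup[\mathbf 0,2]^\star\cup[\mathbf 0,3]^\star$. The boundary of a pattern $P$ is the union of the edges of faces of $P$ contained in exactly one face of $P$. For a pattern $P\supseteq U$, the minimal combinatorial radius $\mathrm{rad}(P)$ is the length $m$ of a shortest sequence of faces $f_1,\dots,f_m$ of $P$ such that $f_1\in U$, $f_k$ and $f_{k+1}$ share an edge for each $k$, and $f_m$ shares an edge with the boundary of $P$. (Writing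 $\mathrm{rad}(P)$ presupposes $P\supseteq U$.) Dual substitutions. For a substitution $\sigma$ on $\{1,2,3\}$, let $\mathbf P(w)=(|w|_1,|w|_2,|w|_3)$ be the abelianization of a word $w$, and $\mathbf M_\sigma$ the matrix whose $i$th column is $\mathbf P(\sigma(i))$. If $\det\mathbf M_\sigma=\pm1$, then $$\mathbf E_1^\star(\sigma)([\mathbf x,i]^\star)=\bigcup_{(p,j,s):\ \sigma(j)=pis}[\mathbf M_\sigma^{-1}(\mathbf x+\mathbf P(s)),j]^\star,$$ extended to unions of faces by taking unions. Products of dual substitutions denote compositions of maps. Brun substitutions: $\sigma^{\mathsf{Br}}_1:1\mapsto1,2\mapsto2,3\mapsto32$; $\sigma^{\mathsf{Br}}_2:1\mapsto1,2\mapsto3,3\mapsto23$; $\sigma^{\mathsf{Br}}_3:1\mapsto2,2\mapsto3,3\mapsto13$; $\Sigma^{\mathsf{Br}}_i=\mathbf E_1^\star(\sigma^{\mathsf{Br}}_i)$. Jacobi-Perron substitutions: $\sigma^{\mathsf{JP}}_{a,b}:1\mapsto3,2\mapsto13^a,3\mapsto23^b$ for integers $a,b\ge0$; $\Sigma^{\mathsf{JP}}_{a,b}=\mathbf E_1^\star(\sigma^{\mathsf{JP}}_{a,b})$. A finite sequence $(a_1,b_1),\dots,(a_n,b_n)$ of pairs of integers is an admissible Jacobi-Perron expansion if $0\le a_k\le b_k$ and $b_k\ne0$ for all $k\in\{1,\dots,n\}$, and $a_k=b_k$ implies $a_{k+1}\neq0$ for all $k\in\{1,\dots,n-1\}$.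 *)

theory Defs
  imports "HOL-Analysis.Analysis"
begin

section \<open>Faces, patterns and combinatorial radius\<close>

text \<open>
  The index set and alphabet \<open>{1,2,3}\<close> is the numeral type \<open>3\<close>, whose three elements are
  \<open>1\<close>, \<open>2\<close> and \<open>3\<close> (arithmetic on it is modulo 3 and is never used; in particular \<open>3 = 0\<close>).
\<close>

definition emb :: "int^3 \<Rightarrow> real^3"
  where "emb x = (\<chi> i. of_int (x $ i))"

definition face :: "int^3 \<Rightarrow> 3 \<Rightarrow> (real^3) set"
  where "face x i =
    {emb x + l *\<^sub>R axis j 1 + m *\<^sub>R axis k 1 | l m j k.
       l \<in> {0..1} \<and> m \<in> {0..1} \<and> {i, j, k} = {1, 2, 3}}"

text \<open>
  Unit segments with integer endpoints. Those contained in a given face are exactly its four sides.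
\<close>

definition edge :: "int^3 \<Rightarrow> 3 \<Rightarrow> (real^3) set"
  where "edge x j = {emb x + l *\<^sub>R axis j 1 | l. l \<in> {0..1}}"

definition is_pattern :: "(real^3) set \<Rightarrow> bool"
  where "is_pattern P \<longleftrightarrow> (\<exists>F. finite F \<and> P = (\<Union>(x, i)\<in>F. face x i))"

definition translate :: "int^3 \<Rightarrow> (real^3) set \<Rightarrow> (real^3) set"
  where "translate t P = (+) (emb t) ` P"

text \<open>
  A face contained in a union of faces is one of them (look at its centre), so for a union \<open>P\<close> of
  faces the faces of \<open>P\<close> can be recovered from the point set \<open>P\<close>.
\<close>

definition faces :: "(real^3) set \<Rightarrow> (real^3) set set"
  where "faces P = {face x i | x i. face x i \<subseteq> P}"

definition U :: "(real^3) set"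
  where "U = face 0 1 \<union> face 0 2 \<union> face 0 3"

definition boundary :: "(real^3) set \<Rightarrow> (real^3) set"
  where "boundary P = \<Union>{edge x j | x j. \<exists>!f. f \<in> faces P \<and> edge x j \<subseteq> f}"

definition share_edge :: "(real^3) set \<Rightarrow> (real^3) set \<Rightarrow> bool"
  where "share_edge A B \<longleftrightarrow> (\<exists>x j. edge x j \<subseteq> A \<and> edge x j \<subseteq> B)"

definition radial_path :: "(real^3) set \<Rightarrow> (real^3) set list \<Rightarrow> bool"
  where "radial_path P fs \<longleftrightarrow>
    fs \<noteq> [] \<and> set fs \<subseteq> faces P \<and> hd fs \<in> faces U \<and>
    successively share_edge fs \<and> share_edge (last fs) (boundary P)"

text \<open>
  Meaningful for patterns containing \<open>U\<close>. If there is no path from \<open>U\<close> to the boundary (as for the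
  six faces of a cube, whose boundary is empty) the value is \<open>Inf {} = 0\<close>, so a positive lower
  bound on \<open>rad P\<close> always includes the existence of such a path.
\<close>

definition rad :: "(real^3) set \<Rightarrow> nat"
  where "rad P = Inf {length fs | fs. radial_path P fs}"

section \<open>Dual substitutions\<close>

text \<open>A substitution is given by the images of the letters.\<close>

type_synonym substitution = "3 \<Rightarrow> 3 list"

definition abelianization :: "3 list \<Rightarrow> int^3"
  where "abelianization w = (\<chi> i. int (count_list w i))"

definition incidence :: "substitution \<Rightarrow> int^3^3"
  where "incidence \<sigma> = (\<chi> i j. abelianization (\<sigma> j) $ i)"

text \<open>
  \<open>matrix_inv\<close> is the inverse over the integers; it is meaningful exactly when the incidence matrix
  has determinant \<open>1\<close> or \<open>-1\<close>.
\<close>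

definition dual_face :: "substitution \<Rightarrow> int^3 \<Rightarrow> 3 \<Rightarrow> (real^3) set"
  where "dual_face \<sigma> x i =
    \<Union>{face (matrix_inv (incidence \<sigma>) *v (x + abelianization s)) j | p j s. \<sigma> j = p @ [i] @ s}"

definition dual_subst :: "substitution \<Rightarrow> (real^3) set \<Rightarrow> (real^3) set"
  where "dual_subst \<sigma> P = \<Union>{dual_face \<sigma> x i | x i. face x i \<subseteq> P}"

section \<open>Brun and Jacobi-Perron substitutions\<close>

definition mk_subst :: "3 list \<Rightarrow> 3 list \<Rightarrow> 3 list \<Rightarrow> substitution"
  where "mk_subst u v w = (\<lambda>i. if i = 1 then u else if i = 2 then v else w)"

definition brun :: "3 \<Rightarrow> substitution"
  where "brun i =
    (if i = 1 then mk_subst [1] [2] [3, 2]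
     else if i = 2 then mk_subst [1] [3] [2, 3]
     else mk_subst [2] [3] [1, 3])"

definition jacobi_perron :: "nat \<times> nat \<Rightarrow> substitution"
  where "jacobi_perron = (\<lambda>(a, b). mk_subst [3] (1 # replicate a 3) (2 # replicate b 3))"

lemma brun_unimodular: "\<bar>det (incidence (brun i))\<bar> = 1"
  by (simp add: det_3 incidence_def abelianization_def brun_def mk_subst_def)

lemma jacobi_perron_unimodular: "\<bar>det (incidence (jacobi_perron ab))\<bar> = 1"
  by (cases ab) (simp add: det_3 incidence_def abelianization_def jacobi_perron_def mk_subst_def)

abbreviation Sigma_Br :: "3 \<Rightarrow> (real^3) set \<Rightarrow> (real^3) set"
  where "Sigma_Br i \<equiv> dual_subst (brun i)"

abbreviation Sigma_JP :: "nat \<times> nat \<Rightarrow> (real^3) set \<Rightarrow> (real^3) set"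
  where "Sigma_JP ab \<equiv> dual_subst (jacobi_perron ab)"

definition admissible_JP :: "(nat \<times> nat) list \<Rightarrow> bool"
  where "admissible_JP ps \<longleftrightarrow>
    (\<forall>(a, b)\<in>set ps. a \<le> b \<and> b \<noteq> 0) \<and>
    successively (\<lambda>(a, b) (a', b'). a = b \<longrightarrow> a' \<noteq> 0) ps"

end

theory Submission
  imports Defs
begin

text \<open>
  All patterns involved are finite pieces of discrete planes: the faces \<open>[x, i]\<close> with
  \<open>0 \<le> c + \<langle>v, x\<rangle> < v\<^sub>i\<close>. A dual substitution maps the plane of \<open>v\<close> onto the plane of the
  transposed incidence matrix applied to \<open>v\<close>, each new face coming from a face of the old plane.
  For both families there is a finite set of relative positions of two faces (``near'') which
  contains the edge-adjacent pairs and is stable under passing to these ancestors. Hence the depth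
  of a face inside a pattern, counted in near-steps, does not decrease under dual substitutions.

  It increases along every long product: starting from one face \<open>f\<close> with all its near neighbours
  considered bad, one follows a well chosen descendant of \<open>f\<close> together with the bad faces that stay
  near it, and after boundedly many steps no bad face is left. So some descendant has all its near
  neighbours among the descendants of \<open>f\<close>. The choices form a finite automaton, given by explicit
  tables. Iterating, some face becomes arbitrarily deep; a few more steps produce a translate of
  \<open>U\<close> among its descendants, and the ball around that translate is the required pattern.
\<close>

section \<open>Faces, edges and unions of faces\<close>

text \<open>Edge-adjacency alone cannot measure depth. For the Brun letter 3, the edge-adjacent
  faces \<open>[0, 1]\<close> and \<open>[(-1, 0, 1), 3]\<close> have ancestors placed like
  \<open>[0, 2]\<close> and \<open>[(1, -1, 1), 3]\<close>, which meet only in a vertex, so a path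
  in the image need not project to a path. The enlarged relation fits into finite tables because the
  normal vectors stay in a cone: increasing positive vectors for Brun, positive vectors with maximal
  third entry for Jacobi-Perron. Positions outside the tables then contradict the height
  inequalities of the plane. Admissibility enters only through the cone: it supplies
  \<open>v $ 1 \<le> v $ 2\<close> whenever \<open>a = b\<close>. For Brun, progress is counted in
  letters 3, since under the letters 1 and 2 a face of type 1 has a single descendant, again of type
  1. For Jacobi-Perron every letter counts, but \<open>a\<close> and \<open>b\<close> are unbounded,
  so the checks are done by linear arithmetic in \<open>a\<close> and \<open>b\<close> and not by
  evaluation. In a product the rightmost factor acts first; hence following a face means induction
  from the right end of the word.\<close>

type_synonym cell = "(int^3) \<times> 3"

definition body :: "cell set \<Rightarrow> (real^3) set"
  where "body F = (\<Union>(x, i)\<in>F. face x i)"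

lemma face_iff:
  "p \<in> face x i \<longleftrightarrow>
    p $ i = of_int (x $ i) \<and> (\<forall>j. of_int (x $ j) \<le> p $ j \<and> p $ j \<le> of_int (x $ j) + 1)"
    (is "_ \<longleftrightarrow> ?R")
proof
  assume "p \<in> face x i"
  then obtain l m j k where *: "p = emb x + l *\<^sub>R axis j 1 + m *\<^sub>R axis k 1"
      "0 \<le> l" "l \<le> 1" "0 \<le> m" "m \<le> 1" "{i, j, k} = {1, 2, 3}"
    unfolding face_def by auto
  have neq: "j \<noteq> i \<and> k \<noteq> i \<and> j \<noteq> k"
  proof -
    have "card {i, j, k} = 3" unfolding *(6) by simp
    then show ?thesis by (cases "j = i"; cases "k = i"; cases "j = k"; simp add: card_insert_if)
  qed
  have "p $ n = of_int (x $ n) + (if n = j then l else if n = k then m else 0)" for n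
    using neq unfolding *(1) by (simp add: emb_def axis_def)
  then show ?R
    using *(2-5) neq by auto
next
  assume R: ?R
  obtain j k where jk: "j \<noteq> k" "j \<noteq> i" "k \<noteq> i" "{i, j, k} = {1, 2, 3 :: 3}"
  proof -
    consider "i = 1" | "i = 2" | "i = 3" using exhaust_3 by blast
    then show thesis
    proof cases
      case 1
      then show thesis using that[of 2 3] by simp
    next
      case 2
      then show thesis using that[of 1 3] by (simp add: insert_commute)
    next
      case 3
      then show thesis using that[of 1 2] by (simp add: insert_commute)
    qed
  qed
  have all: "n = i \<or> n = j \<or> n = k" for n
  proof -
    have "n \<in> {i, j, k}" unfolding jk(4) using exhaust_3[of n] by simp
    then show ?thesis by simp
  qed
  have "p $ n = (emb x + (p $ j - of_int (x $ j)) *\<^sub>R axis j 1 + (p $ k - of_int (x $ k)) *\<^sub>R axis k 1) $ n" for n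
    using R jk(1-3) all[of n] by (elim disjE) (simp_all add: emb_def axis_def)
  then have "p = emb x + (p $ j - of_int (x $ j)) *\<^sub>R axis j 1 + (p $ k - of_int (x $ k)) *\<^sub>R axis k 1"
    unfolding vec_eq_iff by blast
  moreover have "p $ j - of_int (x $ j) \<in> {0..1}" "p $ k - of_int (x $ k) \<in> {0..1}"
    using R by (auto simp: algebra_simps)
  ultimately show "p \<in> face x i"
    unfolding face_def using jk(4) by blast
qed

lemma edge_iff:
  "p \<in> edge z m \<longleftrightarrow>
    of_int (z $ m) \<le> p $ m \<and> p $ m \<le> of_int (z $ m) + 1 \<and> (\<forall>j. j \<noteq> m \<longrightarrow> p $ j = of_int (z $ j))"
    (is "_ \<longleftrightarrow> ?R")
proof
  assume "p \<in> edge z m"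
  then show ?R by (auto simp: edge_def emb_def axis_def)
next
  assume R: ?R
  then have "p = emb z + (p $ m - of_int (z $ m)) *\<^sub>R axis m 1"
    by (auto simp: vec_eq_iff emb_def axis_def)
  moreover have "p $ m - of_int (z $ m) \<in> {0..1}"
    using R by (auto simp: algebra_simps)
  ultimately show "p \<in> edge z m"
    unfolding edge_def by blast
qed

lemma emb_nth [simp]: "emb x $ i = of_int (x $ i)"
  by (simp add: emb_def)

text \<open>The centre of a face has exactly one integral coordinate, which reveals the type; the
  half-integers then fix the position.\<close>

lemma face_centre_unique:
  assumes "(\<chi> j. of_int (x $ j) + (if j = i then 0 else 1 / 2)) \<in> face y k"
  shows "y = x \<and> k = i"
proof -
  let ?p = "(\<chi> j. of_int (x $ j) + (if j = i then 0 else 1 / 2)) :: real^3"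
  have *: "?p $ k = of_int (y $ k)" "\<And>j. of_int (y $ j) \<le> ?p $ j \<and> ?p $ j \<le> of_int (y $ j) + 1"
    using assms unfolding face_iff by auto
  have ki: "k = i"
  proof (rule ccontr)
    assume "k \<noteq> i"
    then have "(of_int (2 * (y $ k)) :: real) = of_int (2 * (x $ k) + 1)"
      using *(1) by simp
    then have "2 * (y $ k) = 2 * (x $ k) + 1" by (simp only: of_int_eq_iff)
    then show False by presburger
  qed
  moreover have "y $ j = x $ j" for j
  proof (cases "j = i")
    case True
    then show ?thesis using *(1) ki by simp
  next
    case False
    then have "of_int (y $ j) \<le> of_int (x $ j) + (1 / 2 :: real)"
      "of_int (x $ j) + (1 / 2 :: real) \<le> of_int (y $ j) + 1"
      using *(2)[of j] by auto
    then show ?thesis by linarith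
  qed
  ultimately show ?thesis by (simp add: vec_eq_iff)
qed

text \<open>This makes a set of cells recoverable from its point set, so that the rest of the
  argument can deal with cells only.\<close>

lemma face_subset_body_iff: "face x i \<subseteq> body F \<longleftrightarrow> (x, i) \<in> F"
proof
  let ?p = "(\<chi> j. of_int (x $ j) + (if j = i then 0 else 1 / 2)) :: real^3"
  assume "face x i \<subseteq> body F"
  moreover have "?p \<in> face x i" by (auto simp: face_iff)
  ultimately obtain y k where "(y, k) \<in> F" "?p \<in> face y k"
    unfolding body_def by blast
  then show "(x, i) \<in> F" using face_centre_unique by blast
qed (auto simp: body_def)

lemma face_inject: "face x i = face y k \<longleftrightarrow> x = y \<and> i = k"
  using face_subset_body_iff[of x i "{(y, k)}"] by (auto simp: body_def)

lemma faces_body: "faces (body F) = {face x i | x i. (x, i) \<in> F}"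
  by (simp add: faces_def face_subset_body_iff)

lemma body_mono: "F \<subseteq> G \<Longrightarrow> body F \<subseteq> body G"
  by (auto simp: body_def)

lemma edge_subset_face_iff:
  "edge z m \<subseteq> face x i \<longleftrightarrow>
    m \<noteq> i \<and> z $ i = x $ i \<and> z $ m = x $ m \<and> (\<forall>j. z $ j = x $ j \<or> z $ j = x $ j + 1)"
    (is "?L \<longleftrightarrow> ?R")
proof
  assume L: ?L
  have "emb z \<in> edge z m" "emb z + axis m 1 \<in> edge z m"
    by (auto simp: edge_iff axis_def)
  then have "emb z \<in> face x i" "emb z + axis m 1 \<in> face x i"
    using L by auto
  then have *: "(of_int (z $ i) :: real) = of_int (x $ i)"
      "\<And>j. (of_int (x $ j) :: real) \<le> of_int (z $ j) \<and> (of_int (z $ j) :: real) \<le> of_int (x $ j) + 1"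
      "of_int (z $ i) + axis m (1::real) $ i = of_int (x $ i)"
      "of_int (z $ m) + axis m (1::real) $ m \<le> of_int (x $ m) + 1"
    unfolding face_iff by (simp, metis emb_nth, metis emb_nth vector_add_component, metis emb_nth vector_add_component)
  have "m \<noteq> i" using *(1,3) by (auto simp: axis_def)
  moreover have "z $ j = x $ j \<or> z $ j = x $ j + 1" for j
    using *(2)[of j] by linarith
  moreover have "z $ m = x $ m"
    using *(2)[of m] *(4) by simp
  ultimately show ?R using *(1) by simp
next
  assume R: ?R
  have "p \<in> face x i" if "p \<in> edge z m" for p
  proof -
    have "of_int (x $ j) \<le> p $ j \<and> p $ j \<le> of_int (x $ j) + 1" for j
    proof (cases "j = m")
      case True
      then show ?thesis using R that unfolding edge_iff by simp
    next
      case False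
      then have "p $ j = of_int (z $ j)" using that unfolding edge_iff by blast
      moreover have "z $ j = x $ j \<or> z $ j = x $ j + 1" using R by blast
      ultimately show ?thesis by auto
    qed
    moreover have "p $ i = of_int (x $ i)"
      using R that unfolding edge_iff by metis
    ultimately show ?thesis unfolding face_iff by blast
  qed
  then show ?L by blast
qed

text \<open>The midpoint of an edge has a single non-integral coordinate and lies on no other
  edge.\<close>

lemma edge_subset_edges:
  assumes "edge z m \<subseteq> \<Union>{edge x j | x j. Q x j}"
  shows "Q z m"
proof -
  let ?p = "(\<chi> j. of_int (z $ j) + (if j = m then 1 / 2 else 0)) :: real^3"
  have "?p \<in> edge z m" by (auto simp: edge_iff)
  then obtain x j where xj: "?p \<in> edge x j" "Q x j" using assms by blast
  then have *: "of_int (x $ j) \<le> ?p $ j" "?p $ j \<le> of_int (x $ j) + 1"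
    "\<And>k. k \<noteq> j \<Longrightarrow> ?p $ k = of_int (x $ k)"
    unfolding edge_iff by auto
  have "m = j"
  proof (rule ccontr)
    assume "m \<noteq> j"
    from *(3)[OF this] have "(of_int (2 * (z $ m) + 1) :: real) = of_int (2 * (x $ m))"
      by simp
    then have "2 * (z $ m) + 1 = 2 * (x $ m)" by (simp only: of_int_eq_iff)
    then show False by presburger
  qed
  moreover have "z $ k = x $ k" for k
  proof (cases "k = j")
    case True
    then show ?thesis using *(1,2) \<open>m = j\<close> by simp
  next
    case False
    then show ?thesis using *(3)[of k] \<open>m = j\<close> by simp
  qed
  then have "z = x" by (simp add: vec_eq_iff)
  ultimately show ?thesis using xj by simp
qed

section \<open>Discrete planes and dual substitutions\<close>

definition dot :: "int^3 \<Rightarrow> int^3 \<Rightarrow> int"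
  where "dot v x = v $ 1 * x $ 1 + v $ 2 * x $ 2 + v $ 3 * x $ 3"

text \<open>The offset \<open>c\<close> absorbs translations: it is unchanged by dual substitutions
  and becomes \<open>c + dot v t\<close> when the origin moves to \<open>t\<close>.\<close>

definition plane :: "int^3 \<Rightarrow> int \<Rightarrow> cell set"
  where "plane v c = {(x, i). 0 \<le> c + dot v x \<and> c + dot v x < v $ i}"

text \<open>
  The incidence matrix is applied to the new position, which avoids inverting it.
\<close>

definition lift :: "substitution \<Rightarrow> cell set \<Rightarrow> cell set"
  where "lift \<sigma> F =
    {(y, j). \<exists>p i s. \<sigma> j = p @ [i] @ s \<and> (incidence \<sigma> *v y - abelianization s, i) \<in> F}"

definition push :: "substitution \<Rightarrow> int^3 \<Rightarrow> int^3"
  where "push \<sigma> v = (\<chi> j. dot v (abelianization (\<sigma> j)))"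

lemma dual_subst_body:
  assumes "invertible (incidence \<sigma>)"
  shows "dual_subst \<sigma> (body F) = body (lift \<sigma> F)"
proof -
  let ?M = "incidence \<sigma>"
  have inv: "?M ** matrix_inv ?M = mat 1" "matrix_inv ?M ** ?M = mat 1"
    using assms unfolding invertible_def matrix_inv_def by (auto intro: someI2_ex)
  have *: "matrix_inv ?M *v (x + u) = y \<longleftrightarrow> x = ?M *v y - u" for x y u :: "int^3"
  proof
    assume "matrix_inv ?M *v (x + u) = y"
    then have "?M *v y = x + u"
      using inv by (metis matrix_vector_mul_assoc matrix_vector_mul_lid)
    then show "x = ?M *v y - u" by simp
  next
    assume "x = ?M *v y - u"
    then have "x + u = ?M *v y" by simp
    then show "matrix_inv ?M *v (x + u) = y"
      using inv by (metis matrix_vector_mul_assoc matrix_vector_mul_lid)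
  qed
  have "p \<in> dual_subst \<sigma> (body F) \<longleftrightarrow> p \<in> body (lift \<sigma> F)" for p
  proof
    assume "p \<in> dual_subst \<sigma> (body F)"
    then obtain x i q j s where "(x, i) \<in> F" "\<sigma> j = q @ [i] @ s"
      "p \<in> face (matrix_inv ?M *v (x + abelianization s)) j"
      unfolding dual_subst_def dual_face_def face_subset_body_iff by blast
    define y where "y = matrix_inv ?M *v (x + abelianization s)"
    then have "x = ?M *v y - abelianization s" using * by blast
    then have "(?M *v y - abelianization s, i) \<in> F" using \<open>(x, i) \<in> F\<close> by simp
    then have "(y, j) \<in> lift \<sigma> F"
      unfolding lift_def using \<open>\<sigma> j = q @ [i] @ s\<close> by blast
    moreover have "p \<in> face y j"
      using \<open>p \<in> face _ j\<close> by (simp add: y_def)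
    ultimately show "p \<in> body (lift \<sigma> F)"
      unfolding body_def by blast
  next
    assume "p \<in> body (lift \<sigma> F)"
    then obtain y j q i s where "p \<in> face y j" "\<sigma> j = q @ [i] @ s"
      "(?M *v y - abelianization s, i) \<in> F"
      unfolding body_def lift_def by auto
    let ?x = "?M *v y - abelianization s"
    have y: "matrix_inv ?M *v (?x + abelianization s) = y"
      using * by blast
    have "face y j \<in> {face (matrix_inv ?M *v (?x + abelianization s)) j | p j s. \<sigma> j = p @ [i] @ s}"
      by (intro CollectI exI[of _ q] exI[of _ j] exI[of _ s] conjI) (simp_all only: y \<open>\<sigma> j = q @ [i] @ s\<close>)
    then have "p \<in> dual_face \<sigma> ?x i"
      unfolding dual_face_def using \<open>p \<in> face y j\<close> by (rule UnionI)
    then show "p \<in> dual_subst \<sigma> (body F)"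
      unfolding dual_subst_def face_subset_body_iff
      using \<open>(?M *v y - abelianization s, i) \<in> F\<close> by blast
  qed
  then show ?thesis by blast
qed

lemma lift_mono: "F \<subseteq> G \<Longrightarrow> lift \<sigma> F \<subseteq> lift \<sigma> G"
  unfolding lift_def by blast

lemma lift_singletonD: "f' \<in> lift \<sigma> F \<Longrightarrow> \<exists>f\<in>F. f' \<in> lift \<sigma> {f}"
  unfolding lift_def by blast

lemma dot_diff: "dot v (x - y) = dot v x - dot v y"
  by (simp add: dot_def algebra_simps)

lemma dot_add: "dot v (x + y) = dot v x + dot v y"
  by (simp add: dot_def algebra_simps)

lemma abelianization_append: "abelianization (u @ w) = abelianization u + abelianization w"
  by (simp add: abelianization_def vec_eq_iff)

lemma dot_letter: "dot v (abelianization [i]) = v $ i"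
  using exhaust_3[of i] by (auto simp: dot_def abelianization_def)

lemma dot_incidence: "dot v (incidence \<sigma> *v y) = dot (push \<sigma> v) y"
  by (simp add: dot_def push_def incidence_def matrix_vector_mult_def sum_3 algebra_simps)

text \<open>The height of the new base point is the old height plus
  \<open>dot v (abelianization s)\<close>. Adding the nonnegative contribution of \<open>p\<close>
  keeps it below the height of the whole word \<open>\<sigma> j\<close>.\<close>

lemma lift_plane:
  assumes "f \<in> plane v c" "f' \<in> lift \<sigma> {f}" "\<And>i. 0 \<le> v $ i"
  shows "f' \<in> plane (push \<sigma> v) c"
proof -
  obtain y j p i s where f': "f' = (y, j)" "\<sigma> j = p @ [i] @ s"
      "f = (incidence \<sigma> *v y - abelianization s, i)"
    using assms(2) unfolding lift_def by auto
  have "0 \<le> dot v (abelianization w)" for w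
    using assms(3) by (simp add: dot_def abelianization_def)
  from this[of p] this[of s]
  have "0 \<le> c + dot (push \<sigma> v) y" "c + dot (push \<sigma> v) y < push \<sigma> v $ j"
    using assms(1) unfolding f' plane_def
    by (auto simp: dot_diff dot_incidence push_def f'(2) abelianization_append dot_add dot_letter
        simp del: append.simps)
  then show ?thesis by (simp add: f'(1) plane_def)
qed

text \<open>Reading the word from the right, the successive intervals from the height of
  \<open>s\<close> to the height of \<open>i # s\<close> cover everything from 0 to the height of
  \<open>w\<close>. This is why every face of the new plane has an ancestor.\<close>

lemma suffix_at_height:
  assumes "0 \<le> h" "h < dot v (abelianization w)"
  shows "\<exists>p i s. w = p @ [i] @ s \<and> dot v (abelianization s) \<le> h
    \<and> h < dot v (abelianization s) + v $ i"
  using assms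
proof (induction w)
  case Nil
  then show ?case by (simp add: dot_def abelianization_def)
next
  case (Cons i w)
  show ?case
  proof (cases "h < dot v (abelianization w)")
    case True
    then obtain p k s where "w = p @ [k] @ s" "dot v (abelianization s) \<le> h"
      "h < dot v (abelianization s) + v $ k"
      using Cons by blast
    then have "i # w = (i # p) @ [k] @ s" by simp
    with \<open>dot v (abelianization s) \<le> h\<close> \<open>h < dot v (abelianization s) + v $ k\<close> show ?thesis
      by blast
  next
    case False
    have "dot v (abelianization (i # w)) = v $ i + dot v (abelianization w)"
      using abelianization_append[of "[i]" w] by (simp add: dot_add dot_letter)
    with False Cons.prems have "dot v (abelianization w) \<le> h" "h < dot v (abelianization w) + v $ i"
      by auto
    moreover have "i # w = [] @ [i] @ w" by simp
    ultimately show ?thesis by blast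
  qed
qed

lemma plane_lift_exists:
  assumes "f' \<in> plane (push \<sigma> v) c"
  obtains f where "f \<in> plane v c" "f' \<in> lift \<sigma> {f}"
proof -
  obtain y j where f': "f' = (y, j)" by (cases f')
  then have "0 \<le> c + dot (push \<sigma> v) y" "c + dot (push \<sigma> v) y < dot v (abelianization (\<sigma> j))"
    using assms by (auto simp: plane_def push_def)
  then obtain p i s where s: "\<sigma> j = p @ [i] @ s" "dot v (abelianization s) \<le> c + dot (push \<sigma> v) y"
    "c + dot (push \<sigma> v) y < dot v (abelianization s) + v $ i"
    using suffix_at_height by blast
  show thesis
  proof
    show "(incidence \<sigma> *v y - abelianization s, i) \<in> plane v c"
      using s by (auto simp: plane_def dot_diff dot_incidence)
    show "f' \<in> lift \<sigma> {(incidence \<sigma> *v y - abelianization s, i)}"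
      using s(1) by (auto simp: lift_def f')
  qed
qed

section \<open>Depth of a face and its growth along products\<close>

definition near_in :: "(cell \<Rightarrow> cell \<Rightarrow> bool) \<Rightarrow> cell set \<Rightarrow> cell rel"
  where "near_in N S = {(f, g). f \<in> S \<and> g \<in> S \<and> N f g}"

text \<open>Exactly \<open>n\<close> steps are taken; for a reflexive \<open>N\<close>, as in both
  applications, this is the same as at most \<open>n\<close> steps.\<close>

definition deep :: "(cell \<Rightarrow> cell \<Rightarrow> bool) \<Rightarrow> nat \<Rightarrow> cell set \<Rightarrow> cell set \<Rightarrow> cell \<Rightarrow> bool"
  where "deep N n S Q f \<longleftrightarrow> f \<in> S \<and> (\<forall>g. (f, g) \<in> near_in N S ^^ n \<longrightarrow> g \<in> Q)"

text \<open>Here \<open>ok v k\<close> licenses the letter \<open>k\<close> on planes with normal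
  vector \<open>v\<close>, and \<open>heavy\<close> marks the letters that count as
  progress.\<close>

locale dual_system =
  fixes s :: "'k \<Rightarrow> substitution"
    and ok :: "int^3 \<Rightarrow> 'k \<Rightarrow> bool"
    and near :: "cell \<Rightarrow> cell \<Rightarrow> bool"
    and heavy :: "'k \<Rightarrow> bool"
  assumes ok_nonneg: "ok v k \<Longrightarrow> 0 \<le> v $ i"
    and near_lift: "\<lbrakk>ok v k; f \<in> plane v c; g \<in> plane v c; f' \<in> lift (s k) {f}; g' \<in> lift (s k) {g};
      near f' g'\<rbrakk> \<Longrightarrow> near f g"
begin

definition lifts :: "'k list \<Rightarrow> cell set \<Rightarrow> cell set"
  where "lifts ks = foldr (\<lambda>k. lift (s k)) ks"

definition pushes :: "'k list \<Rightarrow> int^3 \<Rightarrow> int^3"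
  where "pushes ks = foldr (\<lambda>k. push (s k)) ks"

primrec run :: "int^3 \<Rightarrow> 'k list \<Rightarrow> bool"
  where "run v [] \<longleftrightarrow> True"
  | "run v (k # ks) \<longleftrightarrow> run v ks \<and> ok (pushes ks v) k"

definition weight :: "'k list \<Rightarrow> nat"
  where "weight ks = length (filter heavy ks)"

lemma pushes_append: "pushes (as @ bs) v = pushes as (pushes bs v)"
  by (simp add: pushes_def)

lemma lifts_append: "lifts (as @ bs) F = lifts as (lifts bs F)"
  by (simp add: lifts_def)

lemma run_append: "run v (as @ bs) \<longleftrightarrow> run v bs \<and> run (pushes bs v) as"
  by (induction as) (auto simp: pushes_append)

lemma lifts_mono: "F \<subseteq> G \<Longrightarrow> lifts ks F \<subseteq> lifts ks G"
  by (induction ks) (simp_all add: lifts_def lift_mono)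

lemma lifts_plane:
  assumes "run v ks" "f \<in> plane v c" "f' \<in> lifts ks {f}"
  shows "f' \<in> plane (pushes ks v) c"
  using assms
proof (induction ks arbitrary: f')
  case Nil
  then show ?case by (simp add: lifts_def pushes_def)
next
  case (Cons k ks)
  then obtain f1 where "f1 \<in> lifts ks {f}" "f' \<in> lift (s k) {f1}"
    using lift_singletonD by (metis (no_types) lifts_def foldr.simps(2) comp_apply)
  then show ?case
    using Cons lift_plane ok_nonneg by (simp add: pushes_def) blast
qed

lemma plane_lifts_exists:
  assumes "f' \<in> plane (pushes ks v) c"
  obtains f where "f \<in> plane v c" "f' \<in> lifts ks {f}"
  using assms
proof (induction ks arbitrary: f' thesis)
  case Nil
  then show ?case by (simp add: lifts_def pushes_def)
next
  case (Cons k ks)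
  have "f' \<in> plane (push (s k) (pushes ks v)) c"
    using Cons.prems(2) by (simp add: pushes_def)
  then obtain f1 where f1: "f1 \<in> plane (pushes ks v) c" "f' \<in> lift (s k) {f1}"
    by (rule plane_lift_exists)
  obtain f where f: "f \<in> plane v c" "f1 \<in> lifts ks {f}"
    using Cons.IH f1(1) by blast
  then have "f' \<in> lifts (k # ks) {f}"
    using f1(2) lift_mono[of "{f1}" "lifts ks {f}"] by (auto simp: lifts_def)
  then show ?case using Cons.prems(1) f(1) by blast
qed

lemma near_lifts:
  assumes "run v ks" "f \<in> plane v c" "g \<in> plane v c" "f' \<in> lifts ks {f}" "g' \<in> lifts ks {g}" "near f' g'"
  shows "near f g"
  using assms
proof (induction ks arbitrary: f' g')
  case Nil
  then show ?case by (simp add: lifts_def)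
next
  case (Cons k ks)
  obtain f1 g1 where 1: "f1 \<in> lifts ks {f}" "f' \<in> lift (s k) {f1}" "g1 \<in> lifts ks {g}" "g' \<in> lift (s k) {g1}"
    using lift_singletonD Cons.prems(4,5) by (metis (no_types) lifts_def foldr.simps(2) comp_apply)
  then have "f1 \<in> plane (pushes ks v) c" "g1 \<in> plane (pushes ks v) c"
    using lifts_plane Cons.prems(1-3) by auto
  then have "near f1 g1"
    using near_lift[of "pushes ks v" k f1 c g1 f' g'] 1 Cons.prems(1,6) by simp
  then show ?case using Cons.IH Cons.prems(1-3) 1 by simp
qed

text \<open>A chain of near-steps starting at \<open>f'\<close> projects, face by face, to a chain
  of the same length starting at \<open>f\<close>; the end of the projected chain lies in
  \<open>Q\<close>, so its descendant lies in \<open>lifts ks Q\<close>.\<close>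

lemma deep_lifts:
  assumes "run v ks" "deep near n (plane v c) Q f" "f' \<in> lifts ks {f}"
  shows "deep near n (plane (pushes ks v) c) (lifts ks Q) f'"
proof -
  let ?S = "plane v c" and ?S' = "plane (pushes ks v) c"
  have f: "f \<in> ?S" using assms(2) by (simp add: deep_def)
  then have f': "f' \<in> ?S'" using lifts_plane assms by blast
  have "\<exists>g\<in>?S. g' \<in> lifts ks {g} \<and> (f, g) \<in> near_in near ?S ^^ n"
    if "(f', g') \<in> near_in near ?S' ^^ n" for g'
    using that
  proof (induction n arbitrary: g')
    case 0
    then show ?case using f assms(3) by auto
  next
    case (Suc n)
    then obtain h' where h': "(f', h') \<in> near_in near ?S' ^^ n" "(h', g') \<in> near_in near ?S'"
      by auto
    then obtain h where h: "h \<in> ?S" "h' \<in> lifts ks {h}" "(f, h) \<in> near_in near ?S ^^ n"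
      using Suc.IH by blast
    obtain g where g: "g \<in> ?S" "g' \<in> lifts ks {g}"
      using plane_lifts_exists h'(2) unfolding near_in_def by blast
    have "near h g"
      using near_lifts assms(1) h g h'(2) unfolding near_in_def by blast
    then have "(h, g) \<in> near_in near ?S"
      using h g by (simp add: near_in_def)
    then show ?case using g h by auto
  qed
  then show ?thesis
    using assms(2) f' lifts_mono[of "{_}" Q ks] unfolding deep_def by blast
qed

text \<open>The first near-step from \<open>f'\<close> still ends at a descendant of
  \<open>f\<close>, which inherits depth \<open>n\<close> from \<open>f\<close>; so one step is
  gained.\<close>

lemma deep_Suc:
  assumes "run v ks" "deep near n (plane v c) Q f" "f' \<in> lifts ks {f}"
    and "\<And>g'. \<lbrakk>g' \<in> plane (pushes ks v) c; near f' g'\<rbrakk> \<Longrightarrow> g' \<in> lifts ks {f}"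
  shows "deep near (Suc n) (plane (pushes ks v) c) (lifts ks Q) f'"
  unfolding deep_def
proof (intro conjI allI impI)
  let ?S' = "plane (pushes ks v) c"
  show "f' \<in> ?S'" using deep_lifts[OF assms(1-3)] by (simp add: deep_def)
  fix g' assume "(f', g') \<in> near_in near ?S' ^^ Suc n"
  then obtain h' where h': "(f', h') \<in> near_in near ?S'" "(h', g') \<in> near_in near ?S' ^^ n"
    by (meson relpow_Suc_D2)
  then have "h' \<in> lifts ks {f}" using assms(4) by (auto simp: near_in_def)
  from deep_lifts[OF assms(1,2) this] h'(2) show "g' \<in> lifts ks Q"
    unfolding deep_def by blast
qed

lemma weight_split:
  assumes "m + n \<le> weight ks"
  obtains as bs where "ks = as @ bs" "m \<le> weight as" "n \<le> weight bs"
  using assms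
proof (induction ks arbitrary: m thesis)
  case Nil
  then show ?case by (simp add: weight_def)
next
  case (Cons k ks)
  show ?case
  proof (cases "m = 0")
    case True
    then show ?thesis using Cons.prems by (metis append_Nil add_0 le0)
  next
    case False
    then have "(if heavy k then m - 1 else m) + n \<le> weight ks"
      using Cons.prems(2) by (simp add: weight_def split: if_splits)
    then obtain as bs where "ks = as @ bs" "(if heavy k then m - 1 else m) \<le> weight as" "n \<le> weight bs"
      using Cons.IH by blast
    then have "k # ks = (k # as) @ bs" "m \<le> weight (k # as)"
      by (auto simp: weight_def split: if_splits)
    then show ?thesis using Cons.prems(1) \<open>n \<le> weight bs\<close> by blast
  qed
qed

text \<open>Each block of weight \<open>N1\<close> yields one unit of depth. The additional block is
  the base case: depth 0 asks only for some descendant, and \<open>gain\<close> provides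
  one.\<close>

lemma deep_iterate:
  assumes gain: "\<And>v ks c f. \<lbrakk>run v ks; N1 \<le> weight ks; f \<in> plane v c\<rbrakk> \<Longrightarrow>
      \<exists>f'\<in>lifts ks {f}. \<forall>g'\<in>plane (pushes ks v) c. near f' g' \<longrightarrow> g' \<in> lifts ks {f}"
    and "run v ks" "Suc n * N1 \<le> weight ks" "f \<in> plane v c"
  shows "\<exists>f'. deep near n (plane (pushes ks v) c) (lifts ks {f}) f'"
  using assms(2,3)
proof (induction n arbitrary: ks)
  case 0
  then obtain f' where "f' \<in> lifts ks {f}"
    using gain[OF 0(1) _ assms(4)] 0(2) by (metis mult_1 One_nat_def)
  then show ?case
    using lifts_plane[OF 0(1) assms(4)] by (intro exI[of _ f']) (simp add: deep_def)
next
  case (Suc n)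
  then obtain as bs where ks: "ks = as @ bs" "N1 \<le> weight as" "Suc n * N1 \<le> weight bs"
    using weight_split[of N1 "Suc n * N1" ks] by auto
  then have run: "run v bs" "run (pushes bs v) as"
    using Suc.prems by (auto simp: run_append)
  obtain h where h: "deep near n (plane (pushes bs v) c) (lifts bs {f}) h"
    using Suc.IH run ks by blast
  then have "h \<in> plane (pushes bs v) c" by (simp add: deep_def)
  then obtain f' where "f' \<in> lifts as {h}"
      "\<forall>g'\<in>plane (pushes as (pushes bs v)) c. near f' g' \<longrightarrow> g' \<in> lifts as {h}"
    using gain[OF run(2) ks(2)] by blast
  then have "deep near (Suc n) (plane (pushes as (pushes bs v)) c) (lifts as (lifts bs {f})) f'"
    using deep_Suc[OF run(2) h] by blast
  then show ?case by (intro exI[of _ f']) (simp add: ks pushes_append lifts_append)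
qed

end

section \<open>The radius of balls in a discrete plane\<close>

abbreviation cell_face :: "cell \<Rightarrow> (real^3) set"
  where "cell_face f \<equiv> face (fst f) (snd f)"

lemma faces_body_cells: "faces (body F) = cell_face ` F"
proof (intro equalityI subsetI)
  fix a assume "a \<in> faces (body F)"
  then obtain x i where "a = face x i" "(x, i) \<in> F" unfolding faces_body by blast
  then show "a \<in> cell_face ` F" by (intro image_eqI[of _ _ "(x, i)"]) simp_all
next
  fix a assume "a \<in> cell_face ` F"
  then obtain f where "a = cell_face f" "f \<in> F" by blast
  then show "a \<in> faces (body F)"
    unfolding faces_body by (intro CollectI exI[of _ "fst f"] exI[of _ "snd f"]) simp
qed

lemma cell_face_inject: "cell_face f = cell_face g \<longleftrightarrow> f = g"
  by (simp add: face_inject prod_eq_iff)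

definition adj :: "cell set \<Rightarrow> cell rel"
  where "adj S = {(f, g). f \<in> S \<and> g \<in> S \<and>
    (\<exists>z m. edge z m \<subseteq> face (fst f) (snd f) \<and> edge z m \<subseteq> face (fst g) (snd g))}"

lemma finite_adj_image: "finite (adj S `` {f})"
proof -
  obtain x i where f: "f = (x, i)" by (cases f)
  let ?D = "{-1..1::int}"
  let ?h = "\<lambda>(d, k). (vector [x $ 1 + fst d, x $ 2 + fst (snd d), x $ 3 + snd (snd d)] :: int^3, k :: 3)"
  have "adj S `` {f} \<subseteq> ?h ` ((?D \<times> ?D \<times> ?D) \<times> UNIV)"
  proof
    fix g assume "g \<in> adj S `` {f}"
    then obtain z m y k where g: "g = (y, k)" "edge z m \<subseteq> face x i" "edge z m \<subseteq> face y k"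
      by (cases g) (auto simp: adj_def f)
    have "y $ j - x $ j \<in> ?D" for j
    proof -
      have "z $ j = x $ j \<or> z $ j = x $ j + 1" "z $ j = y $ j \<or> z $ j = y $ j + 1"
        using g(2,3) unfolding edge_subset_face_iff by auto
      then show ?thesis by auto
    qed
    moreover have "y = vector [x $ 1 + (y $ 1 - x $ 1), x $ 2 + (y $ 2 - x $ 2), x $ 3 + (y $ 3 - x $ 3)]"
      by (simp add: vec_eq_iff forall_3)
    then have "g = ?h ((y $ 1 - x $ 1, y $ 2 - x $ 2, y $ 3 - x $ 3), k)"
      by (simp add: g(1))
    ultimately show "g \<in> ?h ` ((?D \<times> ?D \<times> ?D) \<times> UNIV)"
      by blast
  qed
  then show ?thesis by (rule finite_subset) simp
qed

lemma dot_axis: "dot v (x - axis j 1) = dot v x - v $ j" "dot v (x + axis j 1) = dot v x + v $ j"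
  using exhaust_3[of j] by (auto simp: dot_def axis_def algebra_simps)

text \<open>
  Through an edge in direction \<open>m\<close> with lower end \<open>z\<close> at height \<open>h\<close> pass, among the two faces
  \<open>[z, k]\<close> and \<open>[z - e\<^sub>k, l]\<close>, exactly the one dictated by \<open>h < v\<^sub>k\<close> or \<open>h \<ge> v\<^sub>k\<close>, and likewise
  with \<open>k\<close> and \<open>l\<close> exchanged.
\<close>

lemma two_faces:
  assumes "k \<noteq> l" "k \<noteq> m" "l \<noteq> m" "0 \<le> c + dot v z" "c + dot v z < v $ k + v $ l"
  shows "\<exists>f\<in>plane v c. edge z m \<subseteq> face (fst f) (snd f) \<and> (f = (z, k) \<or> f = (z - axis k 1, l))"
proof (cases "c + dot v z < v $ k")
  case True
  then have "(z, k) \<in> plane v c" "edge z m \<subseteq> face z k"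
    using assms by (auto simp: plane_def edge_subset_face_iff)
  then show ?thesis by (intro bexI[of _ "(z, k)"]) auto
next
  case False
  then have "(z - axis k 1, l) \<in> plane v c" "edge z m \<subseteq> face (z - axis k 1) l"
    using assms by (auto simp: plane_def edge_subset_face_iff dot_axis) (auto simp: axis_def)
  then show ?thesis by (intro bexI[of _ "(z - axis k 1, l)"]) auto
qed

lemma face_through_edge:
  assumes "edge z m \<subseteq> face x i"
  obtains l where "l \<noteq> i" "l \<noteq> m" "m \<noteq> i" "x = z \<or> x = z - axis l 1"
proof -
  have e: "m \<noteq> i" "z $ i = x $ i" "z $ m = x $ m" "\<And>j. z $ j = x $ j \<or> z $ j = x $ j + 1"
    using assms unfolding edge_subset_face_iff by auto
  obtain l where l: "l \<noteq> i" "l \<noteq> m" "\<And>j. j = i \<or> j = m \<or> j = l"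
  proof -
    have "card (UNIV - {i, m}) = 1"
      using e(1) by (simp add: card_Diff_subset)
    then obtain l where "UNIV - {i, m} = {l}" by (auto simp: card_1_singleton_iff)
    then show thesis using that[of l] by blast
  qed
  have "x = z \<or> x = z - axis l 1"
  proof (cases "z $ l = x $ l")
    case True
    then have "x $ j = z $ j" for j using l(3)[of j] e by auto
    then show ?thesis by (simp add: vec_eq_iff)
  next
    case False
    then have "x $ j = (z - axis l 1) $ j" for j
      using l(1,2) l(3)[of j] e(2,3) e(4)[of l] by (auto simp: axis_def)
    then show ?thesis by (simp add: vec_eq_iff)
  qed
  then show thesis using that l e(1) by blast
qed

text \<open>The four faces that could contain the edge form two pairs as in
  \<open>two_faces\<close>. The face \<open>f\<close> is in one pair and bounds the height of
  \<open>z\<close>; the other pair supplies a second face of the plane.\<close>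

lemma other_face:
  assumes f: "f \<in> plane v c" "edge z m \<subseteq> face (fst f) (snd f)" and pos: "\<And>i. 0 < v $ i"
  shows "\<exists>g\<in>plane v c. g \<noteq> f \<and> edge z m \<subseteq> face (fst g) (snd g)"
proof -
  obtain x i where xi: "f = (x, i)" by (cases f)
  have "edge z m \<subseteq> face x i" using f(2) by (simp add: xi)
  then obtain l where l: "l \<noteq> i" "l \<noteq> m" "m \<noteq> i" "x = z \<or> x = z - axis l 1"
    by (rule face_through_edge)
  have ne: "z - axis j 1 \<noteq> z" for j :: 3 and z :: "int^3"
    by (auto simp: vec_eq_iff axis_def)
  have h: "0 \<le> c + dot v z" "c + dot v z < v $ i + v $ l"
    using f(1) pos[of i] pos[of l] l(4) by (auto simp: xi plane_def dot_axis)
  from l(4) show ?thesis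
  proof
    assume "x = z"
    from two_faces[of l i m c v z] l h obtain g where
      "g \<in> plane v c" "edge z m \<subseteq> face (fst g) (snd g)" "g = (z, l) \<or> g = (z - axis l 1, i)"
      by (auto simp: add.commute)
    then show ?thesis using \<open>x = z\<close> xi l(1) ne[of z l] by (intro bexI[of _ g]) auto
  next
    assume "x = z - axis l 1"
    from two_faces[of i l m c v z] l h obtain g where
      "g \<in> plane v c" "edge z m \<subseteq> face (fst g) (snd g)" "g = (z, i) \<or> g = (z - axis i 1, l)"
      by auto
    then show ?thesis using \<open>x = z - axis l 1\<close> xi l(1) ne[of z l] by (intro bexI[of _ g]) auto
  qed
qed

text \<open>Crossing edges parallel to the first axis, one never turns back.\<close>

lemma adj_escape:
  assumes f: "f \<in> plane v c" "snd f \<noteq> 1" and pos: "\<And>i. 0 < v $ i"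
  defines "\<phi> \<equiv> \<lambda>g :: cell. 2 * (fst g $ 3 - fst g $ 2) + (if snd g = 2 then 1 else -1)"
  shows "\<exists>g. (f, g) \<in> adj (plane v c) \<and> snd g \<noteq> 1 \<and> \<phi> f < \<phi> g"
proof -
  obtain x i where xi: "f = (x, i)" by (cases f)
  then consider "i = 2" | "i = 3" using f(2) exhaust_3[of i] by auto
  then show ?thesis
  proof cases
    case 1
    let ?z = "x + axis 3 1"
    have h: "0 \<le> c + dot v ?z" "c + dot v ?z < v $ 2 + v $ 3"
      using f(1) pos[of 3] 1 by (auto simp: xi plane_def dot_axis)
    have e: "edge ?z 1 \<subseteq> face x i"
      using 1 by (auto simp: edge_subset_face_iff axis_def)
    obtain g where g: "g \<in> plane v c" "edge ?z 1 \<subseteq> face (fst g) (snd g)" "g = (?z, 2) \<or> g = (?z - axis 2 1, 3)"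
      using two_faces[of 2 3 1 c v ?z] h by auto
    then have "(f, g) \<in> adj (plane v c)" "snd g \<noteq> 1" "\<phi> f < \<phi> g"
      using f e 1 by (auto simp: adj_def xi \<phi>_def axis_def)
    then show ?thesis by blast
  next
    case 2
    have h: "0 \<le> c + dot v x" "c + dot v x < v $ 2 + v $ 3"
      using f(1) pos[of 2] 2 by (auto simp: xi plane_def)
    have e: "edge x 1 \<subseteq> face x i"
      using 2 by (auto simp: edge_subset_face_iff)
    obtain g where g: "g \<in> plane v c" "edge x 1 \<subseteq> face (fst g) (snd g)" "g = (x, 2) \<or> g = (x - axis 2 1, 3)"
      using two_faces[of 2 3 1 c v x] h by auto
    then have "(f, g) \<in> adj (plane v c)" "snd g \<noteq> 1" "\<phi> f < \<phi> g"
      using f e 2 by (auto simp: adj_def xi \<phi>_def axis_def)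
    then show ?thesis by blast
  qed
qed

definition adj_ball :: "cell set \<Rightarrow> cell set \<Rightarrow> nat \<Rightarrow> cell set"
  where "adj_ball S C n = {g. \<exists>f\<in>C. \<exists>m\<le>n. (f, g) \<in> adj S ^^ m}"

lemma finite_adj_ball:
  assumes "finite C"
  shows "finite (adj_ball S C n)"
proof -
  have "finite ((adj S ^^ m) `` {f})" for f m
  proof (induction m)
    case (Suc m)
    have "(adj S ^^ Suc m) `` {f} = (\<Union>g\<in>(adj S ^^ m) `` {f}. adj S `` {g})" by auto
    then show ?case using Suc finite_adj_image by simp
  qed simp
  moreover have "adj_ball S C n = (\<Union>f\<in>C. \<Union>m\<in>{..n}. (adj S ^^ m) `` {f})"
    by (auto simp: adj_ball_def)
  ultimately show ?thesis using assms by simp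
qed

lemma relpow_adj_subset: "(f, g) \<in> adj S ^^ m \<Longrightarrow> f \<in> S \<Longrightarrow> g \<in> S"
proof (induction m arbitrary: g)
  case (Suc m)
  then obtain h where "(h, g) \<in> adj S" by (auto elim: relpow_Suc_E)
  then show ?case by (simp add: adj_def)
qed simp

lemma share_edge_adj: "(f, g) \<in> adj S \<longleftrightarrow> f \<in> S \<and> g \<in> S \<and> share_edge (cell_face f) (cell_face g)"
  by (simp add: adj_def share_edge_def)

lemma ball_path:
  assumes "(f, g) \<in> adj S ^^ m" "m \<le> n" "f \<in> C"
  shows "\<exists>fs. fs \<noteq> [] \<and> set fs \<subseteq> faces (body (adj_ball S C n)) \<and> hd fs = cell_face f \<and> last fs = cell_face g
    \<and> successively share_edge fs"
  using assms(1,2)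
proof (induction m arbitrary: g)
  case 0
  then have "g \<in> adj_ball S C n" using assms(3) by (auto simp: adj_ball_def intro!: bexI exI[of _ 0])
  then show ?case using 0 by (intro exI[of _ "[cell_face g]"]) (auto simp: faces_body_cells)
next
  case (Suc m)
  then obtain h where h: "(f, h) \<in> adj S ^^ m" "(h, g) \<in> adj S" by auto
  have "m \<le> n" using Suc.prems(2) by simp
  from Suc.IH[OF h(1) this] obtain fs where fs: "fs \<noteq> []" "set fs \<subseteq> faces (body (adj_ball S C n))" "hd fs = cell_face f"
    "last fs = cell_face h" "successively share_edge fs" by blast
  have "g \<in> adj_ball S C n"
    using Suc.prems assms(3) unfolding adj_ball_def by blast
  then have "cell_face g \<in> faces (body (adj_ball S C n))"
    by (auto simp: faces_body_cells)
  then show ?case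
    using fs h(2) by (intro exI[of _ "fs @ [cell_face g]"])
      (auto simp: successively_append_iff share_edge_adj)
qed

text \<open>The second face of the plane through a boundary edge cannot be in the ball, for then the
  edge would lie in two faces of the pattern.\<close>

lemma boundary_face:
  assumes S: "S = plane v c" and pos: "\<And>i. 0 < v $ i"
    and f: "f \<in> adj_ball S C n" "f \<in> S" "share_edge (cell_face f) (boundary (body (adj_ball S C n)))"
    and C: "C \<subseteq> S"
  shows "\<exists>g\<in>S. (f, g) \<in> adj S \<and> g \<notin> adj_ball S C n"
proof -
  let ?P = "body (adj_ball S C n)"
  obtain z m where zm: "edge z m \<subseteq> cell_face f" "edge z m \<subseteq> boundary ?P"
    using f(3) unfolding share_edge_def by blast
  then have ex1: "\<exists>!a. a \<in> faces ?P \<and> edge z m \<subseteq> a"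
    using edge_subset_edges[of z m "\<lambda>x j. \<exists>!f. f \<in> faces ?P \<and> edge x j \<subseteq> f"] unfolding boundary_def by blast
  obtain g where g: "g \<in> S" "g \<noteq> f" "edge z m \<subseteq> cell_face g"
    using other_face f(2) zm(1) pos unfolding S by blast
  have "g \<notin> adj_ball S C n"
  proof
    assume "g \<in> adj_ball S C n"
    then have "cell_face g \<in> faces ?P" "cell_face f \<in> faces ?P"
      using f(1) by (auto simp: faces_body_cells)
    then have "cell_face g = cell_face f" using ex1 g(3) zm(1) by blast
    then show False using g(2) by (simp add: cell_face_inject)
  qed
  moreover have "(f, g) \<in> adj S" using g f(2) zm(1) by (auto simp: adj_def)
  ultimately show ?thesis using g(1) by blast
qed

text \<open>Converse of \<open>boundary_face\<close>: if \<open>f\<close> and \<open>g\<close> are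
  the only faces of the plane on their common edge and \<open>g\<close> is missing, the edge lies in
  exactly one face of the pattern.\<close>

lemma boundary_edge:
  assumes S: "S = plane v c" and pos: "\<And>i. 0 < v $ i"
    and f: "f \<in> B" "(f, g) \<in> adj S" "g \<notin> B" and B: "B \<subseteq> S"
    and unique: "\<And>h z m. \<lbrakk>h \<in> S; edge z m \<subseteq> cell_face h; edge z m \<subseteq> cell_face f; edge z m \<subseteq> cell_face g\<rbrakk> \<Longrightarrow> h = f \<or> h = g"
  shows "share_edge (cell_face f) (boundary (body B))"
proof -
  obtain z m where zm: "edge z m \<subseteq> cell_face f" "edge z m \<subseteq> cell_face g"
    using f(2) unfolding adj_def by blast
  have "\<exists>!a. a \<in> faces (body B) \<and> edge z m \<subseteq> a"
  proof
    show "cell_face f \<in> faces (body B) \<and> edge z m \<subseteq> cell_face f"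
      using zm(1) f(1) by (auto simp: faces_body_cells)
    fix a assume a: "a \<in> faces (body B) \<and> edge z m \<subseteq> a"
    then obtain h where h: "a = cell_face h" "h \<in> B" unfolding faces_body_cells by auto
    then have "h = f \<or> h = g" using unique[of h z m] a zm B by blast
    then show "a = cell_face f" using h f(3) by auto
  qed
  then have "edge z m \<subseteq> boundary (body B)" unfolding boundary_def by blast
  then show ?thesis using zm(1) unfolding share_edge_def by blast
qed

lemma edge_two_faces_only:
  assumes "edge z m \<subseteq> cell_face h" "edge z m \<subseteq> cell_face f" "edge z m \<subseteq> cell_face g"
    and "h \<in> plane v c" "f \<in> plane v c" "g \<in> plane v c" "f \<noteq> g"
    and pos: "\<And>i. 0 < v $ i"
  shows "h = f \<or> h = g"
proof -
  obtain k l where kl: "k \<noteq> l" "k \<noteq> m" "l \<noteq> m" "\<And>j. j = k \<or> j = l \<or> j = m"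
  proof -
    have "card (UNIV - {m}) = 2" by (simp add: card_Diff_subset)
    then obtain k l where "UNIV - {m} = {k, l}" "k \<noteq> l" unfolding card_2_iff by auto
    then show thesis using that[of k l] by blast
  qed
  \<comment> \<open>Each of the two pairs of candidates contributes the one face that the height of
    \<open>z\<close> selects, so at most two faces of the plane remain.\<close>
  have "a \<in> {if c + dot v z < v $ k then (z, k) else (z - axis k 1, l),
             if c + dot v z < v $ l then (z, l) else (z - axis l 1, k)}"
    if a: "a \<in> plane v c" "edge z m \<subseteq> cell_face a" for a
  proof -
    obtain x i where xi: "a = (x, i)" by (cases a)
    then obtain l' where l': "l' \<noteq> i" "l' \<noteq> m" "m \<noteq> i" "x = z \<or> x = z - axis l' 1"
      using face_through_edge[of z m x i] a(2) by auto
    then have "i = k \<and> l' = l \<or> i = l \<and> l' = k" using kl by metis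
    then show ?thesis
      using l'(4) a(1) by (auto simp: xi plane_def dot_axis)
  qed
  from this[of f] this[of g] this[of h] show ?thesis using assms by (auto split: if_splits)
qed

lemma U_eq_body: "U = body (range (Pair 0))"
proof -
  have "range (Pair 0) = {(0 :: int^3, 1), (0, 2), (0, 3 :: 3)}"
    using exhaust_3 by auto
  then show ?thesis by (auto simp: U_def body_def)
qed

text \<open>A path of \<open>m\<close> faces from \<open>U\<close> ends within \<open>m - 1\<close>
  adjacency steps, whereas a face at the boundary has a neighbour outside the ball. Since
  \<open>Inf {} = 0\<close>, the existence of some path to the boundary has to be proved as
  well.\<close>

lemma rad_ball:
  assumes S: "S = plane v c" and pos: "\<And>i. 0 < v $ i" and U0: "\<And>i. (0, i) \<in> S"
  shows "n \<le> rad (body (adj_ball S (range (Pair 0)) n))"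
proof -
  let ?C = "range (Pair 0) :: cell set" and ?B = "adj_ball S (range (Pair 0)) n"
  let ?P = "body ?B"
  have CS: "?C \<subseteq> S" using U0 by auto
  have BS: "?B \<subseteq> S"
    unfolding adj_ball_def using relpow_adj_subset CS by blast
  have dist: "\<exists>f g. hd fs = cell_face f \<and> f \<in> ?C \<and> last fs = cell_face g \<and> g \<in> ?B \<and> (f, g) \<in> adj S ^^ (length fs - 1)"
    if "fs \<noteq> []" "set fs \<subseteq> faces ?P" "hd fs \<in> faces U" "successively share_edge fs" for fs
    using that
  proof (induction fs rule: rev_induct)
    case Nil
    then show ?case by simp
  next
    case (snoc a fs)
    then obtain g where g: "a = cell_face g" "g \<in> ?B" unfolding faces_body_cells by auto
    show ?case
    proof (cases "fs = []")
      case True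
      then obtain f where f: "a = cell_face f" "f \<in> ?C"
        using snoc.prems(3) unfolding U_eq_body faces_body_cells by auto
      then have "f = g" using g by (simp add: cell_face_inject)
      then show ?thesis using True f g by (intro exI[of _ f] exI[of _ g]) simp
    next
      case False
      then obtain f h where fh: "hd fs = cell_face f" "f \<in> ?C" "last fs = cell_face h" "h \<in> ?B"
        "(f, h) \<in> adj S ^^ (length fs - 1)"
        using snoc by (auto simp: successively_append_iff)
      have "(h, g) \<in> adj S"
        using False snoc.prems(4) fh g BS by (auto simp: successively_append_iff share_edge_adj)
      then have "(f, g) \<in> adj S ^^ Suc (length fs - 1)" using fh(5) by auto
      then have "(f, g) \<in> adj S ^^ length fs" using False by simp
      then show ?thesis using False fh g by (intro exI[of _ f] exI[of _ g]) (simp add: hd_append)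
    qed
  qed
  have lower: "n \<le> length fs" if "radial_path ?P fs" for fs
  proof (rule ccontr)
    assume short: "\<not> n \<le> length fs"
    have fs: "fs \<noteq> []" "set fs \<subseteq> faces ?P" "hd fs \<in> faces U" "successively share_edge fs"
      "share_edge (last fs) (boundary ?P)"
      using that unfolding radial_path_def by auto
    obtain f g where fg: "f \<in> ?C" "last fs = cell_face g" "g \<in> ?B" "(f, g) \<in> adj S ^^ (length fs - 1)"
      using dist[OF fs(1-4)] by blast
    obtain h where h: "(g, h) \<in> adj S" "h \<notin> ?B"
      using boundary_face[OF S pos fg(3) _ _ CS] fs(5)[unfolded fg(2)] fg(3) BS by blast
    have "(f, h) \<in> adj S ^^ Suc (length fs - 1)" using fg(4) h(1) by auto
    moreover have "Suc (length fs - 1) \<le> n" using short fs(1) by (cases fs) auto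
    ultimately have "h \<in> ?B" using fg(1) unfolding adj_ball_def by blast
    then show False using h(2) by simp
  qed
  have "\<exists>fs. radial_path ?P fs"
  proof -
    \<comment> \<open>\<open>\<phi>\<close> is the potential of \<open>adj_escape\<close>,
      increasing along strips of faces of types 2 and 3. At its maximum over the finite ball, the
      next face of the strip lies outside, so a boundary edge is reached.\<close>
    define \<phi> where "\<phi> = (\<lambda>g :: cell. 2 * (fst g $ 3 - fst g $ 2) + (if snd g = 2 then 1 else -1))"
    let ?T = "{f \<in> ?B. snd f \<noteq> 1}"
    have "finite ?T" using finite_adj_ball[of ?C S n] by simp
    moreover have "(0, 2) \<in> ?B"
      unfolding adj_ball_def by (intro CollectI bexI[of _ "(0, 2)"] exI[of _ 0]) simp_all
    then have "(0, 2) \<in> ?T" by simp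
    ultimately have "Max (\<phi> ` ?T) \<in> \<phi> ` ?T" and max: "\<And>g. g \<in> ?T \<Longrightarrow> \<phi> g \<le> Max (\<phi> ` ?T)"
      by (blast intro: Max_in, blast intro: Max_ge)
    then obtain f where f: "f \<in> ?T" "\<phi> f = Max (\<phi> ` ?T)" by auto
    have fS: "f \<in> plane v c" "snd f \<noteq> 1" using f(1) BS S by auto
    obtain g where g: "(f, g) \<in> adj S" "snd g \<noteq> 1" "\<phi> f < \<phi> g"
      using adj_escape[OF fS pos] unfolding S \<phi>_def by blast
    then have "g \<notin> ?B" using max[of g] f(2) by auto
    have gS: "g \<in> plane v c" using g(1) unfolding adj_def S by blast
    have "f \<noteq> g" using g(3) by auto
    have bd: "share_edge (cell_face f) (boundary ?P)"
    proof (rule boundary_edge[OF S pos _ g(1) \<open>g \<notin> ?B\<close> BS])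
      show "f \<in> ?B" using f(1) by simp
      fix h z m
      assume "h \<in> S" "edge z m \<subseteq> cell_face h" "edge z m \<subseteq> cell_face f" "edge z m \<subseteq> cell_face g"
      then show "h = f \<or> h = g"
        using edge_two_faces_only[of z m h f g v c] fS(1) gS \<open>f \<noteq> g\<close> pos S by blast
    qed
    obtain f0 m where f0: "f0 \<in> ?C" "m \<le> n" "(f0, f) \<in> adj S ^^ m"
      using f(1) unfolding adj_ball_def by blast
    from ball_path[OF f0(3,2,1)] obtain fs where "fs \<noteq> []" "set fs \<subseteq> faces ?P" "hd fs = cell_face f0"
      "last fs = cell_face f" "successively share_edge fs"
      by blast
    moreover have "cell_face f0 \<in> faces U"
      using \<open>f0 \<in> ?C\<close> unfolding U_eq_body faces_body_cells by blast
    ultimately have "radial_path ?P fs" using bd unfolding radial_path_def by simp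
    then show ?thesis by blast
  qed
  then have "{length fs | fs. radial_path ?P fs} \<noteq> {}" by blast
  from Inf_nat_def1[OF this] show ?thesis
    unfolding rad_def using lower by auto
qed

section \<open>Translation of balls, and radius from depth\<close>

definition shift :: "int^3 \<Rightarrow> cell \<Rightarrow> cell"
  where "shift t f = (fst f + t, snd f)"

lemma translate_body: "translate t (body F) = body (shift t ` F)"
proof -
  have "(+) (emb t) ` face x i = face (x + t) i" for x i
  proof -
    have "p \<in> (+) (emb t) ` face x i \<longleftrightarrow> p \<in> face (x + t) i" for p
    proof -
      have "p \<in> (+) (emb t) ` face x i \<longleftrightarrow> p - emb t \<in> face x i"
        by (auto simp: image_iff intro: bexI[of _ "p - emb t"])
      also have "\<dots> \<longleftrightarrow> p \<in> face (x + t) i"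
        by (auto simp: face_iff algebra_simps)
      finally show ?thesis .
    qed
    then show ?thesis by blast
  qed
  then show ?thesis
    by (auto simp: translate_def body_def shift_def image_UN case_prod_beta)
qed

lemma adj_shift:
  assumes "(f, g) \<in> adj (plane v (c + dot v t))"
  shows "(shift t f, shift t g) \<in> adj (plane v c)"
proof -
  obtain z m where "edge z m \<subseteq> cell_face f" "edge z m \<subseteq> cell_face g"
    using assms unfolding adj_def by blast
  then have "edge (z + t) m \<subseteq> cell_face (shift t f)" "edge (z + t) m \<subseteq> cell_face (shift t g)"
    by (simp_all add: shift_def edge_subset_face_iff)
  moreover have "shift t f \<in> plane v c" "shift t g \<in> plane v c"
    using assms by (auto simp: adj_def plane_def shift_def dot_add algebra_simps)
  ultimately show ?thesis unfolding adj_def by blast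
qed

lemma relpow_adj_shift:
  "(f, g) \<in> adj (plane v (c + dot v t)) ^^ m \<Longrightarrow> (shift t f, shift t g) \<in> adj (plane v c) ^^ m"
proof (induction m arbitrary: g)
  case (Suc m)
  then obtain h where "(f, h) \<in> adj (plane v (c + dot v t)) ^^ m" "(h, g) \<in> adj (plane v (c + dot v t))"
    by (auto elim: relpow_Suc_E)
  then show ?case using Suc.IH adj_shift by (meson relpow_Suc_I)
qed simp

lemma relpow_mono: "R \<subseteq> S \<Longrightarrow> R ^^ n \<subseteq> S ^^ n" for R S :: "'a rel"
  by (induction n) (simp_all add: relcomp_mono)

text \<open>Recentring at \<open>z\<close> turns the three deep faces into those of \<open>U\<close>
  and the offset into \<open>c + dot v z\<close>. The adjacency ball about \<open>U\<close> in that
  plane is then carried into \<open>Q\<close> by \<open>shift z\<close>.\<close>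

lemma rad_deep:
  assumes near: "\<And>f g. (f, g) \<in> adj (plane v c) \<Longrightarrow> N f g" and N_refl: "\<And>f. N f f"
    and pos: "\<And>i. 0 < v $ i"
    and deep: "\<And>i. deep N n (plane v c) Q (z, i)"
  shows "\<exists>P t. is_pattern P \<and> U \<subseteq> P \<and> translate t P \<subseteq> body Q \<and> n \<le> rad P"
proof -
  let ?S = "plane v (c + dot v z)"
  let ?B = "adj_ball ?S (range (Pair 0)) n"
  have U0: "(0, i) \<in> ?S" for i
    using deep[of i] by (simp add: deep_def plane_def dot_def)
  have "shift z g \<in> Q" if "g \<in> ?B" for g
  proof -
    have "\<exists>f\<in>range (Pair 0). \<exists>m\<le>n. (f, g) \<in> adj ?S ^^ m"
      using that unfolding adj_ball_def by (rule CollectD)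
    then obtain f0 m where f0: "f0 \<in> range (Pair 0)" "m \<le> n" "(f0, g) \<in> adj ?S ^^ m"
      by (elim bexE exE conjE)
    from f0(1) obtain i where "f0 = (0, i)" by (rule rangeE)
    with f0 have im: "m \<le> n" "((0, i), g) \<in> adj ?S ^^ m" by simp_all
    then have chain: "((z, i), shift z g) \<in> adj (plane v c) ^^ m"
      using relpow_adj_shift[OF im(2)] by (simp add: shift_def)
    let ?R = "near_in N (plane v c)"
    have "adj (plane v c) \<subseteq> ?R"
      using near unfolding near_in_def adj_def by blast
    then have 1: "((z, i), shift z g) \<in> ?R ^^ m"
      using chain by (rule subsetD[OF relpow_mono])
    have zi: "(z, i) \<in> plane v c" using deep[of i] by (simp add: deep_def)
    have gS: "shift z g \<in> plane v c" using relpow_adj_subset[OF chain zi] .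
    \<comment> \<open>Standing still is a near-step, so a chain of \<open>m\<close> steps is padded
      to exactly \<open>n\<close>, as \<open>deep\<close> demands.\<close>
    have "(shift z g, shift z g) \<in> ?R ^^ k" for k
    proof (induction k)
      case (Suc k)
      moreover have "(shift z g, shift z g) \<in> ?R" using gS N_refl by (simp add: near_in_def)
      ultimately show ?case by (rule relpow_Suc_I)
    qed simp
    then have "((z, i), shift z g) \<in> ?R ^^ (m + (n - m))"
      unfolding relpow_add using 1 by (rule relcompI[rotated])
    then have "((z, i), shift z g) \<in> ?R ^^ n" using im(1) by simp
    then show ?thesis using deep[of i] unfolding deep_def by blast
  qed
  then have "shift z ` ?B \<subseteq> Q" by (rule image_subsetI)
  then have "translate z (body ?B) \<subseteq> body Q"
    unfolding translate_body by (rule body_mono)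
  moreover have "is_pattern (body ?B)"
    unfolding is_pattern_def body_def
    by (intro exI[of _ ?B] conjI finite_adj_ball refl) simp
  moreover have "f \<in> ?B" if "f \<in> range (Pair 0)" for f
    unfolding adj_ball_def using that by (intro CollectI bexI[of _ f] exI[of _ 0]) simp_all
  then have "range (Pair 0) \<subseteq> ?B" by (rule subsetI)
  then have "U \<subseteq> body ?B"
    unfolding U_eq_body by (rule body_mono)
  moreover have "n \<le> rad (body ?B)"
    by (rule rad_ball[OF _ pos U0]) simp
  ultimately show ?thesis by blast
qed

section \<open>Bad faces\<close>

text \<open>
  The finite checks are done by evaluation in the simplifier, hence with integers instead of the
  numeral type \<open>3\<close>.
\<close>

definition code :: "3 \<Rightarrow> int"
  where "code i = (if i = 1 then 1 else if i = 2 then 2 else 3)"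

lemma code_simps [simp]: "code 1 = 1" "code 2 = 2" "code 3 = 3"
  by (simp_all add: code_def)

lemma code_inject [simp]: "code i = code j \<longleftrightarrow> i = j"
  using exhaust_3[of i] exhaust_3[of j] by auto

lemma code_in: "code i \<in> set [1, 2, 3]"
  by (auto simp: code_def)

lemma code_eq_iff: "code i = 1 \<longleftrightarrow> i = 1" "code i = 2 \<longleftrightarrow> i = 2" "code i = 3 \<longleftrightarrow> i = 3"
  using exhaust_3[of i] by auto

lemma ex_3: "(\<exists>i :: 3. P i) \<longleftrightarrow> P 1 \<or> P 2 \<or> P 3"
  using exhaust_3 by metis

lemma append_Cons_eq:
  "[a] = p @ i # s \<longleftrightarrow> p = [] \<and> i = a \<and> s = []"
  "[a, b] = p @ i # s \<longleftrightarrow> p = [] \<and> i = a \<and> s = [b] \<or> p = [a] \<and> i = b \<and> s = []"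
  by (auto simp: Cons_eq_append_conv)

lemma lift_iff:
  "(y, j) \<in> lift \<sigma> F \<longleftrightarrow>
    (\<exists>x i p s. \<sigma> j = p @ i # s \<and> (x, i) \<in> F \<and>
      (\<forall>r. int (count_list (\<sigma> 1) r) * y $ 1 + int (count_list (\<sigma> 2) r) * y $ 2
        + int (count_list (\<sigma> 3) r) * y $ 3 = x $ r + int (count_list s r)))"
proof -
  have "incidence \<sigma> *v y - abelianization s = x \<longleftrightarrow>
    (\<forall>r. int (count_list (\<sigma> 1) r) * y $ 1 + int (count_list (\<sigma> 2) r) * y $ 2
        + int (count_list (\<sigma> 3) r) * y $ 3 = x $ r + int (count_list s r))" for x s
    by (auto simp: vec_eq_iff matrix_vector_mult_def sum_3 incidence_def abelianization_def algebra_simps)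
  moreover have "(y, j) \<in> lift \<sigma> F \<longleftrightarrow>
    (\<exists>x i p s. \<sigma> j = p @ i # s \<and> (x, i) \<in> F \<and> incidence \<sigma> *v y - abelianization s = x)"
    unfolding lift_def by simp blast
  ultimately show ?thesis by presburger
qed

definition offset :: "cell \<Rightarrow> cell \<Rightarrow> int \<times> int \<times> int \<times> int"
  where "offset f g = (fst g $ 1 - fst f $ 1, fst g $ 2 - fst f $ 2, fst g $ 3 - fst f $ 3, code (snd g))"

definition list_near :: "(int \<Rightarrow> int \<Rightarrow> (int \<times> int \<times> int) list) \<Rightarrow> cell \<Rightarrow> cell \<Rightarrow> bool"
  where "list_near L f g \<longleftrightarrow> f = g \<or>
    (fst g $ 1 - fst f $ 1, fst g $ 2 - fst f $ 2, fst g $ 3 - fst f $ 3) \<in> set (L (code (snd f)) (code (snd g)))"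

context dual_system
begin

text \<open>The list \<open>B\<close> may overestimate the near neighbours of \<open>f\<close>
  missing from \<open>Q\<close>. It records only relative positions and types, which is what allows
  a finite automaton.\<close>

definition bad_in :: "int^3 \<Rightarrow> int \<Rightarrow> cell \<Rightarrow> cell set \<Rightarrow> (int \<times> int \<times> int \<times> int) list \<Rightarrow> bool"
  where "bad_in v c f Q B \<longleftrightarrow> f \<in> plane v c \<and> f \<in> Q \<and>
    (\<forall>g\<in>plane v c. near f g \<longrightarrow> g \<notin> Q \<longrightarrow> offset f g \<in> set B)"

text \<open>A near neighbour of \<open>f'\<close> that is missing has an ancestor that is near
  \<open>f\<close> and missing too. Hence new bad faces arise only as descendants of old ones, which
  \<open>step\<close> inspects.\<close>

lemma bad_in_lift:
  assumes ok: "ok v k" and bad: "bad_in v c f Q B" and f': "f' \<in> lift (s k) {f}"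
    and step: "\<And>g g'. \<lbrakk>offset f g \<in> set B; g' \<in> lift (s k) {g}; near f' g'; g' \<noteq> f'\<rbrakk> \<Longrightarrow> offset f' g' \<in> set B'"
  shows "bad_in (push (s k) v) c f' (lift (s k) Q) B'"
  unfolding bad_in_def
proof (intro conjI ballI impI)
  have f: "f \<in> plane v c" "f \<in> Q" using bad by (auto simp: bad_in_def)
  show "f' \<in> plane (push (s k) v) c" using lift_plane f(1) f' ok_nonneg[OF ok] by blast
  show f'Q: "f' \<in> lift (s k) Q" using f' f(2) lift_mono[of "{f}" Q] by blast
  fix g' assume g': "g' \<in> plane (push (s k) v) c" "near f' g'" "g' \<notin> lift (s k) Q"
  obtain g where g: "g \<in> plane v c" "g' \<in> lift (s k) {g}"
    using plane_lift_exists[OF g'(1)] by blast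
  have "near f g" using near_lift[OF ok f(1) g(1) f' g(2) g'(2)] .
  moreover have "g \<notin> Q" using g(2) g'(3) lift_mono[of "{g}" Q] by blast
  ultimately have "offset f g \<in> set B" using bad g(1) unfolding bad_in_def by blast
  moreover have "g' \<noteq> f'" using g'(3) f'Q by blast
  ultimately show "offset f' g' \<in> set B'" using step g(2) g'(2) by blast
qed

text \<open>Once no bad face is left none can reappear, so any descendant may be followed.\<close>

lemma bad_in_lifts_Nil:
  assumes ex: "\<And>k f. \<exists>f'. f' \<in> lift (s k) {f}"
    and "bad_in v c f Q []" "run v ks"
  shows "\<exists>f'\<in>lifts ks {f}. bad_in (pushes ks v) c f' (lifts ks Q) []"
  using assms(3)
proof (induction ks)
  case Nil
  then show ?case using assms(2) by (auto simp: lifts_def pushes_def)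
next
  case (Cons k ks)
  then obtain h where h: "h \<in> lifts ks {f}" "bad_in (pushes ks v) c h (lifts ks Q) []" by auto
  obtain f' where f': "f' \<in> lift (s k) {h}" using ex by blast
  have "bad_in (push (s k) (pushes ks v)) c f' (lift (s k) (lifts ks Q)) []"
    using bad_in_lift[OF _ h(2) f', of "[]"] Cons.prems by simp
  moreover have "f' \<in> lift (s k) (lifts ks {f})"
    using f' h(1) lift_mono[of "{h}" "lifts ks {f}"] by blast
  ultimately show ?case by (auto simp: lifts_def pushes_def)
qed

definition wins :: "int^3 \<Rightarrow> int \<Rightarrow> 'k list \<Rightarrow> cell \<Rightarrow> bool"
  where "wins v c ks f \<longleftrightarrow> (\<exists>f'\<in>lifts ks {f}. \<forall>g'\<in>plane (pushes ks v) c. near f' g' \<longrightarrow> g' \<in> lifts ks {f})"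

lemma snoc_simps:
  "lifts (ks @ [k]) F = lifts ks (lift (s k) F)"
  "pushes (ks @ [k]) v = pushes ks (push (s k) v)"
  "run v (ks @ [k]) \<longleftrightarrow> ok v k \<and> run (push (s k) v) ks"
  "weight (ks @ [k]) = weight ks + (if heavy k then 1 else 0)"
  by (auto simp: lifts_def pushes_def run_append weight_def)

lemma wins_snoc:
  assumes "f1 \<in> lift (s k) {f}" "wins (push (s k) v) c ks f1"
  shows "wins v c (ks @ [k]) f"
proof -
  have "lifts ks {f1} \<subseteq> lifts (ks @ [k]) {f}"
    unfolding snoc_simps using assms(1) by (intro lifts_mono) simp
  then show ?thesis using assms(2) unfolding wins_def snoc_simps by blast
qed

lemma wins_bad_in:
  assumes "f' \<in> lifts ks {f}" "bad_in (pushes ks v) c f' (lifts ks {f}) []"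
  shows "wins v c ks f"
  using assms unfolding wins_def bad_in_def by auto

end

text \<open>The word is cut as \<open>as @ bs\<close>: the right part \<open>bs\<close>, acting
  first, makes one face deep, and \<open>as\<close> produces three faces at a common vertex among
  its descendants, which inherit that depth.\<close>

lemma (in dual_system) rad_unbounded:
  assumes wins: "\<And>v ks c f. \<lbrakk>run v ks; N1 \<le> weight ks; f \<in> plane v c\<rbrakk> \<Longrightarrow> wins v c ks f"
    and vertex: "\<And>v ks f. \<lbrakk>run v ks; N2 \<le> weight ks\<rbrakk> \<Longrightarrow> \<exists>z. \<forall>i. (z, i) \<in> lifts ks {f}"
    and refl: "\<And>f. near f f"
    and "run v ks" "Suc n * N1 + N2 \<le> weight ks" "f \<in> plane v c"
    and pos: "\<And>i. 0 < pushes ks v $ i"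
    and adj: "\<And>f g. (f, g) \<in> adj (plane (pushes ks v) c) \<Longrightarrow> near f g"
  shows "\<exists>P t. is_pattern P \<and> U \<subseteq> P \<and> translate t P \<subseteq> body (lifts ks {f}) \<and> n \<le> rad P"
proof -
  obtain as bs where ks: "ks = as @ bs" "N2 \<le> weight as" "Suc n * N1 \<le> weight bs"
    using weight_split[of N2 "Suc n * N1" ks] assms(5) by (metis add.commute)
  have run: "run v bs" "run (pushes bs v) as"
    using assms(4) unfolding ks run_append by blast+
  have gain: "\<exists>f'\<in>lifts ks {f}. \<forall>g'\<in>plane (pushes ks v) c. near f' g' \<longrightarrow> g' \<in> lifts ks {f}"
    if "run v ks" "N1 \<le> weight ks" "f \<in> plane v c" for v ks c f
    using wins[OF that] unfolding wins_def .
  from deep_iterate[OF gain run(1) ks(3) assms(6)]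
  obtain h where h: "deep near n (plane (pushes bs v) c) (lifts bs {f}) h" by blast
  obtain z where "\<forall>i. (z, i) \<in> lifts as {h}" using vertex[OF run(2) ks(2)] by blast
  then have "deep near n (plane (pushes ks v) c) (lifts ks {f}) (z, i)" for i
    using deep_lifts[OF run(2) h] unfolding ks pushes_append lifts_append by blast
  from rad_deep[OF adj refl pos this] show ?thesis by blast
qed

lemma foldr_dual_subst:
  assumes "\<And>k. invertible (incidence (\<sigma> k))"
  shows "foldr (\<lambda>k. dual_subst (\<sigma> k)) ks (body F) = body (foldr (\<lambda>k. lift (\<sigma> k)) ks F)"
  by (induction ks) (simp_all add: dual_subst_body assms)

section \<open>Brun substitutions\<close>

text \<open>
  Relative positions of near faces of types \<open>i\<close> and \<open>k\<close>: the closure of edge-adjacency under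
  ancestors, computed by machine.
\<close>

definition brun_near :: "int \<Rightarrow> int \<Rightarrow> (int \<times> int \<times> int) list"
  where "brun_near i k =
   (if i = 1 then
     (if k = 1 then [(0, -1, 1), (0, 1, -1)]
      else if k = 2 then [(-1, 0, 1), (-1, 1, 0), (0, 0, 0), (0, 1, -1)]
      else [(-1, -1, 1), (-1, 0, 1), (-1, 1, 0), (0, -1, 1), (0, 0, 0), (0, 1, 0)])
    else if i = 2 then
     (if k = 1 then [(0, -1, 1), (0, 0, 0), (1, -1, 0), (1, 0, -1)]
      else if k = 2 then [(-1, 0, 0), (-1, 0, 1), (-1, 1, 0), (1, -1, 0), (1, 0, -1), (1, 0, 0)]
      else [(-1, -1, 1), (-1, 0, 0), (-1, 0, 1), (0, -1, 1), (0, 0, 0), (1, -1, 0), (1, -1, 1),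
         (1, 0, 0)])
    else
     (if k = 1 then [(0, -1, 0), (0, 0, 0), (0, 1, -1), (1, -1, 0), (1, 0, -1), (1, 1, -1)]
      else if k = 2 then [(-1, 0, 0), (-1, 1, -1), (-1, 1, 0), (0, 0, 0), (0, 1, -1), (1, 0, -1), (1, 0, 0),
         (1, 1, -1)]
      else [(-1, -1, 0), (-1, 0, 0), (-1, 0, 1), (-1, 1, -1), (-1, 1, 0), (0, -1, 0), (0, -1, 1),
         (0, 1, -1), (0, 1, 0), (1, -1, 0), (1, -1, 1), (1, 0, -1), (1, 0, 0), (1, 1, 0)]))"

text \<open>
  Lists of relative positions and types of bad faces. The first list contains everything near a
  face of type 3.
\<close>

definition brun_bad :: "(int \<times> int \<times> int \<times> int) list list"
  where "brun_bad = [
    [(-1, -1, 0, 3), (-1, 0, 0, 2), (-1, 0, 0, 3), (-1, 0, 1, 3), (-1, 1, -1, 2), (-1, 1, -1, 3),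
     (-1, 1, 0, 2), (-1, 1, 0, 3), (0, -1, 0, 1), (0, -1, 0, 3), (0, -1, 1, 3), (0, 0, 0, 1),
     (0, 0, 0, 2), (0, 1, -1, 1), (0, 1, -1, 2), (0, 1, -1, 3), (0, 1, 0, 3), (1, -1, 0, 1),
     (1, -1, 0, 3), (1, -1, 1, 3), (1, 0, -1, 1), (1, 0, -1, 2), (1, 0, -1, 3), (1, 0, 0, 2),
     (1, 0, 0, 3), (1, 1, -1, 1), (1, 1, -1, 2), (1, 1, 0, 3)],
    [(-1, 0, 0, 2), (-1, 0, 0, 3), (-1, 0, 1, 3), (-1, 1, -1, 2), (-1, 1, -1, 3), (-1, 1, 0, 2),
     (-1, 1, 0, 3), (0, -1, 1, 3), (0, 0, 0, 1), (0, 1, -1, 1), (0, 1, -1, 2), (0, 1, -1, 3),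
     (0, 1, 0, 3), (1, -1, 0, 1), (1, -1, 0, 3), (1, -1, 1, 3), (1, 0, -1, 1), (1, 0, -1, 2),
     (1, 0, -1, 3), (1, 0, 0, 2), (1, 0, 0, 3), (1, 1, -1, 1), (1, 1, -1, 2)],
    [(-1, 0, 0, 2), (-1, 0, 0, 3), (-1, 0, 1, 3), (-1, 1, -1, 2), (-1, 1, -1, 3), (-1, 1, 0, 2),
     (-1, 1, 0, 3), (0, -1, 1, 3), (0, 0, 0, 1), (0, 1, -1, 1), (0, 1, -1, 2), (0, 1, -1, 3),
     (0, 1, 0, 3), (1, -1, 0, 1), (1, -1, 0, 3), (1, -1, 1, 3), (1, 0, 0, 2), (1, 0, 0, 3),
     (1, 1, -1, 1), (1, 1, -1, 2), (1, 1, 0, 3)],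
    [(-1, 0, 1, 3), (-1, 1, 0, 2), (-1, 1, 0, 3), (0, -1, 1, 3), (0, 1, -1, 1), (0, 1, -1, 2),
     (0, 1, -1, 3), (0, 1, 0, 3), (1, -1, 0, 1), (1, -1, 0, 3), (1, -1, 1, 3), (1, 0, -1, 1),
     (1, 0, -1, 2), (1, 0, -1, 3), (1, 0, 0, 2), (1, 0, 0, 3), (1, 1, -1, 1), (1, 1, -1, 2)],
    [(-1, -1, 1, 3), (-1, 0, 0, 2), (-1, 0, 0, 3), (-1, 0, 1, 2), (-1, 0, 1, 3), (-1, 1, 0, 2),
     (0, -1, 1, 1), (0, -1, 1, 3), (0, 0, 0, 1), (1, -1, 0, 1), (1, -1, 0, 2), (1, -1, 0, 3),
     (1, -1, 1, 3), (1, 0, -1, 1), (1, 0, -1, 2), (1, 0, 0, 2), (1, 0, 0, 3)],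
    [(-1, 0, 0, 2), (-1, 0, 0, 3), (-1, 0, 1, 3), (-1, 1, 0, 2), (-1, 1, 0, 3), (0, -1, 1, 3),
     (0, 0, 0, 1), (1, -1, 0, 1), (1, -1, 0, 3), (1, -1, 1, 3), (1, 0, 0, 2), (1, 0, 0, 3),
     (1, 1, -1, 1), (1, 1, -1, 2), (1, 1, 0, 3)],
    [(-1, 0, 1, 3), (-1, 1, 0, 2), (-1, 1, 0, 3), (0, -1, 1, 3), (1, -1, 0, 1), (1, -1, 0, 3),
     (1, -1, 1, 3), (1, 0, 0, 2), (1, 0, 0, 3), (1, 1, -1, 1), (1, 1, -1, 2)],
    [(-1, -1, 1, 3), (-1, 0, 1, 2), (-1, 0, 1, 3), (-1, 1, 0, 2), (0, -1, 1, 1), (0, -1, 1, 3),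
     (1, -1, 1, 3)],
    [(-1, 0, 1, 3), (-1, 1, 0, 2), (-1, 1, 0, 3), (0, -1, 1, 3), (0, 1, -1, 1), (0, 1, -1, 2),
     (0, 1, -1, 3), (0, 1, 0, 3), (1, -1, 1, 3), (1, 1, -1, 1), (1, 1, -1, 2)],
    [(-1, -1, 1, 3), (-1, 0, 1, 3), (-1, 1, 0, 2), (-1, 1, 0, 3)],
    [(-1, 0, 1, 2), (-1, 0, 1, 3), (-1, 1, 0, 2), (-1, 1, 0, 3)],
    [(-1, 1, -1, 2), (-1, 1, -1, 3), (0, 1, -1, 2), (0, 1, -1, 3), (1, 0, -1, 1), (1, 0, -1, 2),
     (1, 0, -1, 3)],
    [(0, 1, -1, 1), (0, 1, -1, 2), (0, 1, -1, 3), (1, 0, -1, 1), (1, 0, -1, 2), (1, 0, -1, 3)],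
    [(1, -1, 1, 3), (1, 0, 0, 2), (1, 0, 0, 3)],
    [(0, -1, 1, 3), (1, -1, 0, 1), (1, -1, 0, 3), (1, 0, -1, 1), (1, 0, -1, 2), (1, 0, -1, 3)],
    [(0, -1, 1, 3), (1, -1, 0, 1), (1, -1, 0, 3), (1, 0, 0, 3)],
    [(1, -1, 0, 1), (1, -1, 0, 3), (1, 0, 0, 3), (1, 1, -1, 1), (1, 1, -1, 2)],
    [(1, -1, 1, 3), (1, 0, 0, 2), (1, 0, 0, 3), (1, 1, -1, 1), (1, 1, -1, 2)],
    [(-1, -1, 1, 3), (-1, 0, 1, 3), (-1, 1, 0, 2), (0, -1, 1, 3)],
    [(-1, 0, 1, 3), (-1, 1, 0, 2), (-1, 1, 0, 3), (0, -1, 1, 3)],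
    [(-1, 0, 1, 3), (0, -1, 1, 3), (1, -1, 1, 3)],
    [(-1, -1, 1, 3), (-1, 0, 1, 3), (-1, 1, 0, 2)],
    [(-1, 0, 1, 2), (-1, 0, 1, 3), (-1, 1, 0, 2)],
    [(-1, 1, 0, 2)],
    [],
    []]"

text \<open>
  A row \<open>(i, c, r, b, ts)\<close> describes a situation: the followed face has type \<open>i\<close>, the letter \<open>c\<close> is
  applied next, at most the faces in list \<open>b\<close> are bad, and \<open>r\<close> bounds the number of further letters
  3 until no face is bad. The descendant is chosen with knowledge of the letter after \<open>c\<close>; the list
  \<open>ts\<close> gives the row reached when that letter is 1, 2 or 3.
\<close>

definition brun_table :: "(int \<times> int \<times> nat \<times> nat \<times> nat list) list"
  where "brun_table = [
    (3, 1, 10, 0, [0, 2, 1]), (3, 3, 10, 0, [6, 2, 3]), (3, 2, 9, 0, [6, 2, 4]),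
    (3, 3, 9, 1, [6, 8, 5]), (3, 3, 9, 2, [6, 8, 5]), (3, 3, 8, 3, [6, 8, 10]),
    (2, 1, 7, 4, [6, 7, 9]), (3, 2, 7, 5, [6, 7, 9]), (3, 2, 7, 3, [6, 7, 9]),
    (3, 3, 7, 5, [11, 13, 12]), (3, 3, 7, 6, [11, 13, 12]), (2, 1, 6, 7, [11, 13, 12]),
    (2, 3, 6, 7, [15, 17, 19]), (3, 2, 6, 8, [11, 13, 12]), (1, 1, 5, 9, [14, 16, 18]),
    (1, 1, 5, 10, [14, 16, 18]), (1, 2, 5, 9, [14, 16, 18]), (1, 2, 5, 10, [14, 16, 18]),
    (1, 3, 5, 9, [20, 29, 22]), (1, 3, 5, 10, [21, 32, 23]), (3, 1, 4, 11, [20, 29, 22]),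
    (3, 1, 4, 12, [21, 32, 23]), (3, 3, 4, 11, [25, 30, 34]), (3, 3, 4, 12, [26, 31, 35]),
    (2, 2, 3, 13, [27, 33, 36]), (3, 1, 3, 14, [25, 30, 34]), (3, 1, 3, 15, [27, 33, 35]),
    (3, 1, 3, 16, [27, 33, 36]), (3, 1, 3, 17, [27, 33, 36]), (3, 2, 3, 11, [26, 31, 35]),
    (3, 2, 3, 14, [27, 33, 36]), (3, 2, 3, 15, [28, 24, 37]), (3, 2, 3, 12, [26, 31, 35]),
    (3, 2, 3, 16, [28, 24, 37]), (3, 3, 3, 14, [38, 47, 39]), (3, 3, 3, 15, [38, 47, 39]),
    (3, 3, 3, 16, [46, 48, 40]), (3, 3, 3, 17, [46, 48, 40]), (2, 1, 2, 18, [38, 47, 39]),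
    (3, 3, 2, 19, [42, 43, 45]), (3, 3, 2, 20, [42, 47, 45]), (2, 1, 1, 21, [41, 47, 44]),
    (2, 1, 1, 22, [41, 47, 44]), (2, 2, 1, 23, [46, 47, 52]), (2, 3, 1, 21, [49, 50, 51]),
    (2, 3, 1, 22, [49, 50, 51]), (3, 1, 1, 20, [46, 47, 52]), (3, 2, 1, 19, [41, 47, 44]),
    (3, 2, 1, 20, [41, 47, 45]), (1, 1, 0, 24, []), (1, 2, 0, 24, []), (1, 3, 0, 24, []),
    (3, 3, 0, 25, [])]"

text \<open>
  Pairs of the abelianization of \<open>s\<close> and the letter \<open>j\<close> such that \<open>i s\<close> is a suffix of the image
  of \<open>j\<close> under the Brun substitution \<open>c\<close>.
\<close>

definition brun_lifts :: "int \<Rightarrow> int \<Rightarrow> ((int \<times> int \<times> int) \<times> int) list"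
  where "brun_lifts c i =
   (if c = 1 then
     (if i = 1 then [((0, 0, 0), 1)]
      else if i = 2 then [((0, 0, 0), 2), ((0, 0, 0), 3)]
      else [((0, 1, 0), 3)])
    else if c = 2 then
     (if i = 1 then [((0, 0, 0), 1)]
      else if i = 2 then [((0, 0, 1), 3)]
      else [((0, 0, 0), 2), ((0, 0, 0), 3)])
    else
     (if i = 1 then [((0, 0, 1), 3)]
      else if i = 2 then [((0, 0, 0), 1)]
      else [((0, 0, 0), 2), ((0, 0, 0), 3)]))"

fun brun_mat :: "int \<Rightarrow> int \<times> int \<times> int \<Rightarrow> int \<times> int \<times> int"
  where "brun_mat c (a1, a2, a3) =
    (if c = 1 then (a1, a2 + a3, a3) else if c = 2 then (a1, a3, a2 + a3) else (a3, a1, a2 + a3))"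

fun brun_inv :: "int \<Rightarrow> int \<times> int \<times> int \<Rightarrow> int \<times> int \<times> int"
  where "brun_inv c (a1, a2, a3) =
    (if c = 1 then (a1, a2 - a3, a3) else if c = 2 then (a1, a3 - a2, a2) else (a2, a3 - a1, a1))"

text \<open>
  Heights of two faces of a common plane force two linear forms in \<open>v\<close> to be positive; this is
  impossible if one of them is nonpositive on the generators \<open>(1, 1, 1)\<close>, \<open>(0, 1, 1)\<close>, \<open>(0, 0, 1)\<close>
  of the cone of increasing vectors.
\<close>

fun brun_infeasible :: "int \<Rightarrow> int \<Rightarrow> int \<times> int \<times> int \<Rightarrow> bool"
  where "brun_infeasible i l (d1, d2, d3) \<longleftrightarrow>
    (let a = (\<lambda>m. if i = m then 1 else 0); b = (\<lambda>m. if l = m then 1 else (0::int)) in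
      d3 + a 3 \<le> 0 \<and> d2 + a 2 + d3 + a 3 \<le> 0 \<and> d1 + a 1 + d2 + a 2 + d3 + a 3 \<le> 0 \<or>
      b 3 - d3 \<le> 0 \<and> b 2 - d2 + b 3 - d3 \<le> 0 \<and> b 1 - d1 + b 2 - d2 + b 3 - d3 \<le> 0)"

text \<open>If \<open>e\<close> is the offset between descendants with suffix vectors
  \<open>q\<close> and \<open>p\<close>, then \<open>d\<close>, the image of \<open>e\<close> under
  the incidence matrix minus \<open>p\<close> plus \<open>q\<close>, is the offset between their
  ancestors.\<close>

fun brun_pre_ok :: "int \<Rightarrow> int \<Rightarrow> (int \<times> int \<times> int) \<times> int \<Rightarrow> int \<Rightarrow> (int \<times> int \<times> int) \<times> int \<Rightarrow> int \<times> int \<times> int \<Rightarrow> bool"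
  where "brun_pre_ok c i ((q1, q2, q3), j) l ((p1, p2, p3), m) e \<longleftrightarrow>
    (case brun_mat c e of (m1, m2, m3) \<Rightarrow>
      let d = (m1 - p1 + q1, m2 - p2 + q2, m3 - p3 + q3) in
      d \<in> set (brun_near i l) \<or> d = (0, 0, 0) \<and> i = l \<or> brun_infeasible i l d)"

text \<open>The zero offset is included because \<open>list_near\<close> relates every face to
  itself.\<close>

lemma brun_near_closed:
  "\<forall>c\<in>set [1, 2, 3]. \<forall>i\<in>set [1, 2, 3]. \<forall>l\<in>set [1, 2, 3].
    \<forall>(q, j)\<in>set (brun_lifts c i). \<forall>(p, m)\<in>set (brun_lifts c l).
    \<forall>e\<in>set ((if j = m then [(0, 0, 0)] else []) @ brun_near j m). brun_pre_ok c i (q, j) l (p, m) e"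
  by code_simp

text \<open>This inverts the relation of \<open>brun_pre_ok\<close>: a bad face at offset
  \<open>d\<close> has descendants at offset \<open>d + p - q\<close>, transformed by the inverse
  incidence matrix, from the chosen descendant.\<close>

fun brun_step_ok :: "int \<Rightarrow> (int \<times> int \<times> int) \<times> int \<Rightarrow> (int \<times> int \<times> int \<times> int) list
    \<Rightarrow> (int \<times> int \<times> int \<times> int) list \<Rightarrow> bool"
  where "brun_step_ok c ((q1, q2, q3), j) B B' \<longleftrightarrow>
    (\<forall>(d1, d2, d3, k)\<in>set B. \<forall>((p1, p2, p3), m)\<in>set (brun_lifts c k).
      (case brun_inv c (d1 + p1 - q1, d2 + p2 - q2, d3 + p3 - q3) of (e1, e2, e3) \<Rightarrow>
        (e1, e2, e3) \<in> set (brun_near j m) \<longrightarrow> (e1, e2, e3, m) \<in> set B'))"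

text \<open>The bound \<open>r\<close> must drop at a letter 3 and may stay constant at 1 and 2. So
  the strategy may run in cycles on the letters 1 and 2, and a finite table covers arbitrarily long
  runs of them.\<close>

fun brun_row_ok :: "int \<times> int \<times> nat \<times> nat \<times> nat list \<Rightarrow> bool"
  where "brun_row_ok (i, c, r, b, ts) \<longleftrightarrow>
    (if r = 0 then brun_bad ! b = []
     else list_all2 (\<lambda>c' t. t < length brun_table \<and> (case brun_table ! t of (i', c'', r', b', _) \<Rightarrow>
        c'' = c' \<and> (if c = 3 then r' < r else r' \<le> r) \<and>
        (\<exists>(q, j)\<in>set (brun_lifts c i). j = i' \<and> brun_step_ok c (q, j) (brun_bad ! b) (brun_bad ! b'))))
        [1, 2, 3] ts)"

lemma brun_table_ok: "\<forall>row\<in>set brun_table. brun_row_ok row"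
  by code_simp

section \<open>Brun lifts in coordinates and stability of nearness\<close>

lemma brun_nth:
  "brun 1 1 = [1]" "brun 1 2 = [2]" "brun 1 3 = [3, 2]"
  "brun 2 1 = [1]" "brun 2 2 = [3]" "brun 2 3 = [2, 3]"
  "brun 3 1 = [2]" "brun 3 2 = [3]" "brun 3 3 = [1, 3]"
  by (simp_all add: brun_def mk_subst_def)

lemma lift_brun_iff:
  "(y, j) \<in> lift (brun k) F \<longleftrightarrow>
    (\<exists>x i q1 q2 q3. (x, i) \<in> F \<and> ((q1, q2, q3), code j) \<in> set (brun_lifts (code k) (code i)) \<and>
      brun_mat (code k) (y $ 1, y $ 2, y $ 3) = (x $ 1 + q1, x $ 2 + q2, x $ 3 + q3))"
proof -
  have "k = 1 \<or> k = 2 \<or> k = 3" "j = 1 \<or> j = 2 \<or> j = 3" by (rule exhaust_3)+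
  then show ?thesis
    by (elim disjE)
      (simp_all add: lift_iff brun_nth append_Cons_eq forall_3 ex_3 brun_lifts_def
        conj_disj_distribL conj_disj_distribR ex_disj_distrib algebra_simps)
qed

definition brun_ok :: "int^3 \<Rightarrow> 3 \<Rightarrow> bool"
  where "brun_ok v k \<longleftrightarrow> 0 < v $ 1 \<and> v $ 1 \<le> v $ 2 \<and> v $ 2 \<le> v $ 3"

text \<open>Abel summation: the form equals
  \<open>(a + b + c) * u + (b + c) * (v - u) + c * (w - v)\<close>.\<close>

lemma cone_nonpos:
  fixes a :: int
  assumes "c \<le> 0" "b + c \<le> 0" "a + b + c \<le> 0" "0 \<le> u" "u \<le> v" "v \<le> w"
  shows "a * u + b * v + c * w \<le> 0"
proof -
  have "(a + b + c) * u \<le> 0" "(b + c) * (v - u) \<le> 0" "c * (w - v) \<le> 0"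
    using assms by (auto intro: mult_nonpos_nonneg)
  then show ?thesis by (simp add: algebra_simps)
qed

lemma not_brun_infeasible:
  assumes "brun_ok v k" "(x, i) \<in> plane v c" "(w, l) \<in> plane v c"
  shows "\<not> brun_infeasible (code i) (code l) (w $ 1 - x $ 1, w $ 2 - x $ 2, w $ 3 - x $ 3)"
proof
  let ?d = "\<lambda>r. w $ r - x $ r"
  let ?a = "\<lambda>r. if code i = r then 1 else 0 :: int" and ?b = "\<lambda>r. if code l = r then 1 else 0 :: int"
  assume "brun_infeasible (code i) (code l) (?d 1, ?d 2, ?d 3)"
  moreover have cone: "0 \<le> v $ 1" "v $ 1 \<le> v $ 2" "v $ 2 \<le> v $ 3"
    using assms(1) by (simp_all add: brun_ok_def)
  ultimately consider "?d 3 + ?a 3 \<le> 0" "?d 2 + ?a 2 + ?d 3 + ?a 3 \<le> 0" "?d 1 + ?a 1 + ?d 2 + ?a 2 + ?d 3 + ?a 3 \<le> 0"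
    | "?b 3 - ?d 3 \<le> 0" "?b 2 - ?d 2 + ?b 3 - ?d 3 \<le> 0" "?b 1 - ?d 1 + ?b 2 - ?d 2 + ?b 3 - ?d 3 \<le> 0"
    unfolding brun_infeasible.simps Let_def by blast
  then show False
  proof cases
    case 1
    have "(?d 1 + ?a 1) * v $ 1 + (?d 2 + ?a 2) * v $ 2 + (?d 3 + ?a 3) * v $ 3 \<le> 0"
      by (rule cone_nonpos) (use 1 cone in linarith)+
    moreover have "v $ i = ?a 1 * v $ 1 + ?a 2 * v $ 2 + ?a 3 * v $ 3"
      using exhaust_3[of i] by auto
    ultimately show False
      using assms(2,3) by (simp add: plane_def dot_def algebra_simps)
  next
    case 2
    have "(?b 1 - ?d 1) * v $ 1 + (?b 2 - ?d 2) * v $ 2 + (?b 3 - ?d 3) * v $ 3 \<le> 0"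
      by (rule cone_nonpos) (use 2 cone in linarith)+
    moreover have "v $ l = ?b 1 * v $ 1 + ?b 2 * v $ 2 + ?b 3 * v $ 3"
      using exhaust_3[of l] by auto
    ultimately show False
      using assms(2,3) by (simp add: plane_def dot_def algebra_simps)
  qed
qed

lemma brun_mat_diff:
  assumes "brun_mat c (y1, y2, y3) = (x1, x2, x3)" "brun_mat c (u1, u2, u3) = (w1, w2, w3)"
  shows "brun_mat c (u1 - y1, u2 - y2, u3 - y3) = (w1 - x1, w2 - x2, w3 - x3)"
  using assms by (auto split: if_splits)

lemma brun_inv_mat: "brun_inv c (brun_mat c e) = e"
  by (cases e) simp

lemma brun_near_lift:
  assumes ok: "brun_ok v k" and f: "f \<in> plane v c" and g: "g \<in> plane v c"
    and f': "f' \<in> lift (brun k) {f}" and g': "g' \<in> lift (brun k) {g}" and near: "list_near brun_near f' g'"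
  shows "list_near brun_near f g"
proof -
  obtain x i w l y j u m where eq: "f = (x, i)" "g = (w, l)" "f' = (y, j)" "g' = (u, m)"
    by (metis surj_pair)
  obtain q1 q2 q3 where q: "((q1, q2, q3), code j) \<in> set (brun_lifts (code k) (code i))"
    "brun_mat (code k) (y $ 1, y $ 2, y $ 3) = (x $ 1 + q1, x $ 2 + q2, x $ 3 + q3)"
    using f' unfolding eq lift_brun_iff by blast
  obtain p1 p2 p3 where p: "((p1, p2, p3), code m) \<in> set (brun_lifts (code k) (code l))"
    "brun_mat (code k) (u $ 1, u $ 2, u $ 3) = (w $ 1 + p1, w $ 2 + p2, w $ 3 + p3)"
    using g' unfolding eq lift_brun_iff by blast
  let ?e = "(u $ 1 - y $ 1, u $ 2 - y $ 2, u $ 3 - y $ 3)"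
  let ?d = "(w $ 1 - x $ 1, w $ 2 - x $ 2, w $ 3 - x $ 3)"
  have "?e \<in> set ((if code j = code m then [(0, 0, 0)] else []) @ brun_near (code j) (code m))"
    using near by (auto simp: list_near_def eq)
  then have "brun_pre_ok (code k) (code i) ((q1, q2, q3), code j) (code l) ((p1, p2, p3), code m) ?e"
    using brun_near_closed[rule_format, OF code_in[of k] code_in[of i] code_in[of l] q(1)] p(1) by fast
  moreover have "brun_mat (code k) ?e = (w $ 1 + p1 - (x $ 1 + q1), w $ 2 + p2 - (x $ 2 + q2), w $ 3 + p3 - (x $ 3 + q3))"
    by (rule brun_mat_diff[OF q(2) p(2)])
  ultimately have "?d \<in> set (brun_near (code i) (code l)) \<or> ?d = (0, 0, 0) \<and> i = l
    \<or> brun_infeasible (code i) (code l) ?d"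
    by (simp add: Let_def algebra_simps del: brun_infeasible.simps)
  then show ?thesis
    using not_brun_infeasible[OF ok] f g by (auto simp: list_near_def eq vec_eq_iff forall_3 simp del: brun_infeasible.simps)
qed

interpretation brun: dual_system brun brun_ok "list_near brun_near" "\<lambda>k. k = 3"
proof
  fix v k i
  assume "brun_ok v k"
  then show "0 \<le> v $ i" using exhaust_3[of i] by (auto simp: brun_ok_def)
qed (rule brun_near_lift)

section \<open>The Brun strategy removes all bad faces\<close>

lemma brun_lift_intro:
  assumes "((q1, q2, q3), code j) \<in> set (brun_lifts (code k) (code i))" "(x, i) \<in> F"
  obtains y where "(y, j) \<in> lift (brun k) F"
    "(y $ 1, y $ 2, y $ 3) = brun_inv (code k) (x $ 1 + q1, x $ 2 + q2, x $ 3 + q3)"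
proof -
  obtain a b d where abd: "brun_inv (code k) (x $ 1 + q1, x $ 2 + q2, x $ 3 + q3) = (a, b, d)"
    using prod_cases3 by blast
  then have "brun_mat (code k) (a, b, d) = (x $ 1 + q1, x $ 2 + q2, x $ 3 + q3)"
    by (auto split: if_splits)
  then have "(vector [a, b, d], j) \<in> lift (brun k) F"
    unfolding lift_brun_iff using assms by force
  then show thesis using abd that by simp
qed

lemma brun_lift_ex: "\<exists>f'. f' \<in> lift (brun k) {f}"
proof -
  obtain x i where f: "f = (x, i)" by (cases f)
  have "\<exists>j q1 q2 q3. ((q1, q2, q3), code j) \<in> set (brun_lifts (code k) (code i))"
    unfolding brun_lifts_def ex_3 by simp
  then show ?thesis using brun_lift_intro[of _ _ _ _ k i x "{f}"] f by blast
qed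

lemma brun_bad_in_step:
  assumes ok: "brun_ok v k" and bad: "brun.bad_in v c f Q B"
    and q: "(q, code j) \<in> set (brun_lifts (code k) (code (snd f)))" and step: "brun_step_ok (code k) (q, code j) B B'"
  shows "\<exists>f'\<in>lift (brun k) {f}. snd f' = j \<and> brun.bad_in (push (brun k) v) c f' (lift (brun k) Q) B'"
proof -
  obtain x i where f: "f = (x, i)" by (cases f)
  obtain q1 q2 q3 where q': "q = (q1, q2, q3)" by (rule prod_cases3)
  obtain y where y: "(y, j) \<in> lift (brun k) {f}"
    "(y $ 1, y $ 2, y $ 3) = brun_inv (code k) (x $ 1 + q1, x $ 2 + q2, x $ 3 + q3)"
    using brun_lift_intro[of q1 q2 q3 j k i x "{f}"] q unfolding f q' by auto
  have ymat: "brun_mat (code k) (y $ 1, y $ 2, y $ 3) = (x $ 1 + q1, x $ 2 + q2, x $ 3 + q3)"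
    unfolding y(2) by (auto split: if_splits)
  have "brun.bad_in (push (brun k) v) c (y, j) (lift (brun k) Q) B'"
  proof (rule brun.bad_in_lift[OF ok bad y(1)])
    fix g g' assume g: "offset f g \<in> set B" and g': "g' \<in> lift (brun k) {g}" "list_near brun_near (y, j) g'" "g' \<noteq> (y, j)"
    obtain w l u m where eq: "g = (w, l)" "g' = (u, m)" by (metis surj_pair)
    obtain p1 p2 p3 where p: "((p1, p2, p3), code m) \<in> set (brun_lifts (code k) (code l))"
      "brun_mat (code k) (u $ 1, u $ 2, u $ 3) = (w $ 1 + p1, w $ 2 + p2, w $ 3 + p3)"
      using g'(1) unfolding eq lift_brun_iff by blast
    let ?e = "(u $ 1 - y $ 1, u $ 2 - y $ 2, u $ 3 - y $ 3)"
    have "brun_mat (code k) ?e = (w $ 1 - x $ 1 + p1 - q1, w $ 2 - x $ 2 + p2 - q2, w $ 3 - x $ 3 + p3 - q3)"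
      using brun_mat_diff[OF ymat p(2)] by (simp add: algebra_simps)
    then have e: "brun_inv (code k) (w $ 1 - x $ 1 + p1 - q1, w $ 2 - x $ 2 + p2 - q2, w $ 3 - x $ 3 + p3 - q3) = ?e"
      using brun_inv_mat by metis
    have mem: "(w $ 1 - x $ 1, w $ 2 - x $ 2, w $ 3 - x $ 3, code l) \<in> set B"
      using g by (simp add: offset_def f eq)
    have near: "?e \<in> set (brun_near (code j) (code m))"
      using g'(2,3) by (auto simp: list_near_def eq)
    have "case brun_inv (code k) (w $ 1 - x $ 1 + p1 - q1, w $ 2 - x $ 2 + p2 - q2, w $ 3 - x $ 3 + p3 - q3) of
      (e1, e2, e3) \<Rightarrow> (e1, e2, e3) \<in> set (brun_near (code j) (code m)) \<longrightarrow> (e1, e2, e3, code m) \<in> set B'"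
    proof -
      have "\<forall>((p1, p2, p3), m)\<in>set (brun_lifts (code k) (code l)).
        (case brun_inv (code k) (w $ 1 - x $ 1 + p1 - q1, w $ 2 - x $ 2 + p2 - q2, w $ 3 - x $ 3 + p3 - q3) of
          (e1, e2, e3) \<Rightarrow> (e1, e2, e3) \<in> set (brun_near (code j) m) \<longrightarrow> (e1, e2, e3, m) \<in> set B')"
        using bspec[OF step[unfolded q' brun_step_ok.simps] mem] unfolding prod.case .
      from bspec[OF this p(1)] show ?thesis unfolding prod.case .
    qed
    then show "offset (y, j) g' \<in> set B'"
      unfolding e using near by (simp add: offset_def eq)
  qed
  then show ?thesis using y(1) by (intro bexI[of _ "(y, j)"]) simp_all
qed

lemma brun_bad_in_start:
  assumes "f \<in> plane v c" "snd f = 3"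
  shows "brun.bad_in v c f {f} (brun_bad ! 0)"
proof -
  have "\<forall>k\<in>set [1, 2, 3]. \<forall>(e1, e2, e3)\<in>set (brun_near 3 k). (e1, e2, e3, k) \<in> set (brun_bad ! 0)"
    by code_simp
  then have *: "(e1, e2, e3, code i) \<in> set (brun_bad ! 0)" if "(e1, e2, e3) \<in> set (brun_near 3 (code i))" for i e1 e2 e3
    using code_in[of i] that by fast
  show ?thesis
    unfolding brun.bad_in_def using assms by (auto simp: list_near_def offset_def intro: *)
qed

lemma list_all2_exists: "list_all2 P xs ys \<Longrightarrow> x \<in> set xs \<Longrightarrow> \<exists>y. P x y"
  by (metis in_set_conv_nth list_all2_conv_all_nth)

text \<open>The letter \<open>k\<close> is the pending one, applied first. The letter before it in
  the word is the lookahead that selects the next row, so induction removes \<open>k\<close> from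
  the right end. A row with \<open>r = 0\<close> has no bad faces left.\<close>

lemma brun_play:
  assumes "t < length brun_table" "brun_table ! t = (i, c0, r, b, ts)" "r < brun.weight (ks @ [k])"
    and "code k = c0" "code (snd f) = i" "brun.bad_in v c f Q (brun_bad ! b)" "brun.run v (ks @ [k])"
  shows "\<exists>f'\<in>brun.lifts (ks @ [k]) {f}.
    brun.bad_in (brun.pushes (ks @ [k]) v) c f' (brun.lifts (ks @ [k]) Q) []"
  using assms
proof (induction ks arbitrary: t i c0 r b ts k f v Q rule: rev_induct)
  case Nil
  show ?case
  proof (cases "r = 0")
    case True
    then have "brun_bad ! b = []"
      using brun_table_ok[rule_format, OF nth_mem[OF Nil.prems(1)]] Nil.prems(2) by simp
    then show ?thesis using brun.bad_in_lifts_Nil[OF brun_lift_ex] Nil.prems(6,7) by metis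
  next
    \<comment> \<open>A single letter has weight at most 1, which leaves no room for a positive
      \<open>r\<close>.\<close>
    case False
    then show ?thesis using Nil.prems(3) by (simp add: brun.weight_def split: if_splits)
  qed
next
  case (snoc k' ks)
  have row: "brun_row_ok (i, c0, r, b, ts)"
    using brun_table_ok[rule_format, OF nth_mem[OF snoc.prems(1)]] snoc.prems(2) by simp
  show ?case
  proof (cases "r = 0")
    case True
    then have "brun_bad ! b = []" using row by simp
    then show ?thesis using brun.bad_in_lifts_Nil[OF brun_lift_ex] snoc.prems(6,7) by metis
  next
    case False
    then have all: "list_all2 (\<lambda>c' t. t < length brun_table \<and> (case brun_table ! t of (i', c'', r', b', _) \<Rightarrow>
        c'' = c' \<and> (if c0 = 3 then r' < r else r' \<le> r) \<and>
        (\<exists>(q, j)\<in>set (brun_lifts c0 i). j = i' \<and> brun_step_ok c0 (q, j) (brun_bad ! b) (brun_bad ! b'))))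
        [1, 2, 3] ts"
      using row by simp
    from list_all2_exists[OF this code_in[of k']]
    obtain t' where T: "t' < length brun_table \<and> (case brun_table ! t' of (i', c'', r', b', _) \<Rightarrow>
        c'' = code k' \<and> (if c0 = 3 then r' < r else r' \<le> r) \<and>
        (\<exists>(q, j)\<in>set (brun_lifts c0 i). j = i' \<and> brun_step_ok c0 (q, j) (brun_bad ! b) (brun_bad ! b')))"
      by (elim exE)
    obtain i' c'' r' b' ts' where t': "brun_table ! t' = (i', c'', r', b', ts')"
      by (rule prod_cases5)
    note T' = T[unfolded t' prod.case]
    note t'_len = T'[THEN conjunct1] and c'' = T'[THEN conjunct2, THEN conjunct1]
      and r' = T'[THEN conjunct2, THEN conjunct2, THEN conjunct1]
    from T'[THEN conjunct2, THEN conjunct2, THEN conjunct2]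
    obtain q where q: "(q, i') \<in> set (brun_lifts c0 i)" "brun_step_ok c0 (q, i') (brun_bad ! b) (brun_bad ! b')"
      by (elim bexE) (simp del: brun_step_ok.simps split: prod.splits)
    have "i' = 1 \<or> i' = 2 \<or> i' = 3"
      using q(1) by (auto simp: brun_lifts_def split: if_splits)
    then obtain j where j: "i' = code j"
      using code_simps by metis
    have ok: "brun_ok v k" and run': "brun.run (push (brun k) v) (ks @ [k'])"
      using snoc.prems(7) unfolding brun.snoc_simps(3)[of v "ks @ [k']" k] by blast+
    obtain h where h: "h \<in> lift (brun k) {f}" "snd h = j"
      "brun.bad_in (push (brun k) v) c h (lift (brun k) Q) (brun_bad ! b')"
      using brun_bad_in_step[OF ok snoc.prems(6), of q j "brun_bad ! b'"] q snoc.prems(4,5) j by auto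
    have "r' < brun.weight (ks @ [k'])"
      using r' snoc.prems(3,4) unfolding brun.snoc_simps(4)[of "ks @ [k']" k]
      by (auto simp: code_eq_iff split: if_splits)
    then obtain f' where f': "f' \<in> brun.lifts (ks @ [k']) {h}"
      "brun.bad_in (brun.pushes (ks @ [k']) (push (brun k) v)) c f'
        (brun.lifts (ks @ [k']) (lift (brun k) Q)) []"
      using snoc.IH[OF t'_len t' _ _ _ h(3) run'] c'' h(2) j by blast
    moreover have "f' \<in> brun.lifts (ks @ [k']) (lift (brun k) {f})"
      using f'(1) h(1) brun.lifts_mono[of "{h}" "lift (brun k) {f}"] by blast
    ultimately show ?thesis
      unfolding brun.snoc_simps(1,2)[of "ks @ [k']" k] by blast
  qed
qed

lemma brun_wins_3:
  assumes "brun.run v ks" "f \<in> plane v c" "snd f = 3" "11 \<le> brun.weight ks"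
  shows "brun.wins v c ks f"
proof -
  obtain ks' k where ks: "ks = ks' @ [k]"
    using assms(4) by (cases ks rule: rev_cases) (auto simp: brun.weight_def)
  \<comment> \<open>Rows 0, 1 and 2 are the starting rows, one for each pending letter. Their bound
    \<open>r\<close> is at most 10, whence the 11 letters 3.\<close>
  have "\<forall>c\<in>set [1, 2, 3]. \<exists>t\<in>set [0, 1, 2]. t < length brun_table \<and>
      (case brun_table ! t of (i, c', r, b, _) \<Rightarrow> i = 3 \<and> c' = c \<and> r < 11 \<and> b = 0)"
    by code_simp
  from bspec[OF this code_in[of k]] obtain t where
    T: "t < length brun_table \<and> (case brun_table ! t of (i, c', r, b, _) \<Rightarrow> i = 3 \<and> c' = code k \<and> r < 11 \<and> b = 0)"
    by (elim bexE)
  obtain i c' r b ts where t: "brun_table ! t = (i, c', r, b, ts)"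
    by (rule prod_cases5)
  note T' = T[unfolded t prod.case]
  then have "r < brun.weight (ks' @ [k])" "code k = c'" "code (snd f) = i"
    using assms(3,4) ks by auto
  moreover have "brun.bad_in v c f {f} (brun_bad ! b)"
    using brun_bad_in_start[OF assms(2,3)] T' by simp
  ultimately have "\<exists>f'\<in>brun.lifts ks {f}. brun.bad_in (brun.pushes ks v) c f' (brun.lifts ks {f}) []"
    using brun_play[OF T'[THEN conjunct1] t] assms(1) unfolding ks by blast
  then show ?thesis using brun.wins_bad_in by blast
qed

lemma brun_lift_type:
  assumes "(q, code j) \<in> set (brun_lifts (code k) (code (snd f)))"
  obtains y where "(y, j) \<in> lift (brun k) {f}"
proof -
  obtain x i where f: "f = (x, i)" by (cases f)
  obtain q1 q2 q3 where q: "q = (q1, q2, q3)" by (rule prod_cases3)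
  show thesis
    using brun_lift_intro[of q1 q2 q3 j k i x "{f}"] assms that unfolding f q by auto
qed

lemma brun_wins_snoc:
  assumes "(q, code j) \<in> set (brun_lifts (code k) (code (snd f)))" "f \<in> plane v c" "brun_ok v k"
    and "\<And>f1. \<lbrakk>f1 \<in> plane (push (brun k) v) c; snd f1 = j\<rbrakk> \<Longrightarrow> brun.wins (push (brun k) v) c ks f1"
  shows "brun.wins v c (ks @ [k]) f"
proof -
  obtain y where y: "(y, j) \<in> lift (brun k) {f}" using brun_lift_type[OF assms(1)] .
  then have "(y, j) \<in> plane (push (brun k) v) c"
    using lift_plane[OF assms(2)] brun.ok_nonneg[OF assms(3)] by blast
  then show ?thesis using brun.wins_snoc[OF y] assms(4) by simp
qed

text \<open>The letters 1 and 2 keep the type 1; the next letter 3 turns it into type 3. This costs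
  one letter 3 beyond the 11 of \<open>brun_wins_3\<close>.\<close>

lemma brun_wins_1:
  assumes "brun.run v ks" "f \<in> plane v c" "snd f = 1" "12 \<le> brun.weight ks"
  shows "brun.wins v c ks f"
  using assms
proof (induction ks arbitrary: v f rule: rev_induct)
  case Nil
  then show ?case by (simp add: brun.weight_def)
next
  case (snoc k ks)
  consider "k = 3" | "k \<noteq> 3" "k = 1 \<or> k = 2" using exhaust_3[of k] by auto
  then show ?case
  proof cases
    case 1
    then show ?thesis
      using snoc.prems brun_wins_snoc[of "(0, 0, 1)" 3 k f v c ks] brun_wins_3
      by (simp add: brun_lifts_def brun.snoc_simps)
  next
    case 2
    then show ?thesis
      using snoc brun_wins_snoc[of "(0, 0, 0)" 1 k f v c ks]
      by (auto simp: brun_lifts_def brun.snoc_simps)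
  qed
qed

text \<open>A face of type 2 has a descendant of type 3 under the letters 1 and 2, and one of type 1
  under 3; the latter costs one letter 3 more than \<open>brun_wins_1\<close>.\<close>

lemma brun_wins:
  assumes "brun.run v ks" "13 \<le> brun.weight ks" "f \<in> plane v c"
  shows "brun.wins v c ks f"
proof -
  consider "snd f = 1" | "snd f = 2" | "snd f = 3" using exhaust_3 by blast
  then show ?thesis
  proof cases
    case 2
    obtain ks' k where ks: "ks = ks' @ [k]"
      using assms(2) by (cases ks rule: rev_cases) (auto simp: brun.weight_def)
    consider "k = 1" | "k = 2" | "k = 3" using exhaust_3 by blast
    then show ?thesis
    proof cases
      case 1
      then show ?thesis
        using 2 assms brun_wins_snoc[of "(0, 0, 0)" 3 k f v c ks'] brun_wins_3 unfolding ks
        by (simp add: brun_lifts_def brun.snoc_simps)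
    next
      case 2
      then show ?thesis
        using \<open>snd f = 2\<close> assms brun_wins_snoc[of "(0, 0, 1)" 3 k f v c ks'] brun_wins_3 unfolding ks
        by (simp add: brun_lifts_def brun.snoc_simps)
    next
      case 3
      then show ?thesis
        using \<open>snd f = 2\<close> assms brun_wins_snoc[of "(0, 0, 0)" 1 k f v c ks'] brun_wins_1 unfolding ks
        by (simp add: brun_lifts_def brun.snoc_simps)
    qed
  qed (use assms brun_wins_1 brun_wins_3 in auto)
qed

section \<open>Producing a translate of \<open>U\<close> under Brun products\<close>

lemma brun_same_base:
  "\<exists>y. \<forall>i j. (x, i) \<in> F \<longrightarrow> ((0, 0, 0), code j) \<in> set (brun_lifts (code k) (code i)) \<longrightarrow> (y, j) \<in> lift (brun k) F"
proof -
  obtain a b d where abd: "brun_inv (code k) (x $ 1, x $ 2, x $ 3) = (a, b, d)"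
    using prod_cases3 by blast
  then have "brun_mat (code k) (a, b, d) = (x $ 1, x $ 2, x $ 3)"
    by (auto split: if_splits)
  then have "(vector [a, b, d], j) \<in> lift (brun k) F"
    if "(x, i) \<in> F" "((0, 0, 0), code j) \<in> set (brun_lifts (code k) (code i))" for i j
    unfolding lift_brun_iff using that by force
  then show ?thesis by blast
qed

text \<open>Every image word has a last letter, whose suffix is empty. So each type \<open>j\<close>
  arises at the same new base point from some type present at \<open>x\<close>.\<close>

lemma brun_vertex_123:
  assumes "\<forall>i. (x, i) \<in> F"
  shows "\<exists>z. \<forall>i. (z, i) \<in> brun.lifts ks F"
  using assms
proof (induction ks arbitrary: x F rule: rev_induct)
  case Nil
  then show ?case by (auto simp: brun.lifts_def)
next
  case (snoc k ks)
  from brun_same_base[of x F k] obtain y where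
    "\<forall>i j. (x, i) \<in> F \<longrightarrow> ((0, 0, 0), code j) \<in> set (brun_lifts (code k) (code i)) \<longrightarrow> (y, j) \<in> lift (brun k) F"
    by (elim exE)
  note y = this[rule_format]
  have "(y, j) \<in> lift (brun k) F" for j
  proof -
    have "\<exists>i. ((0, 0, 0), code j) \<in> set (brun_lifts (code k) (code i))"
      using exhaust_3[of j] exhaust_3[of k] unfolding ex_3 by (auto simp: brun_lifts_def)
    then show ?thesis using y snoc.prems by blast
  qed
  then show ?case using snoc.IH by (auto simp: brun.snoc_simps)
qed

text \<open>Every letter reproduces the types 2 and 3 at a common vertex, and the letter 3 adds type
  1 from type 2.\<close>

lemma brun_vertex_23:
  assumes "(x, 2) \<in> F" "(x, 3) \<in> F" "1 \<le> brun.weight ks"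
  shows "\<exists>z. \<forall>i. (z, i) \<in> brun.lifts ks F"
  using assms
proof (induction ks arbitrary: x F rule: rev_induct)
  case Nil
  then show ?case by (simp add: brun.weight_def)
next
  case (snoc k ks)
  from brun_same_base[of x F k] obtain y where
    "\<forall>i j. (x, i) \<in> F \<longrightarrow> ((0, 0, 0), code j) \<in> set (brun_lifts (code k) (code i)) \<longrightarrow> (y, j) \<in> lift (brun k) F"
    by (elim exE)
  note y = this[rule_format]
  have 23: "(y, 2) \<in> lift (brun k) F" "(y, 3) \<in> lift (brun k) F"
    using y[OF snoc.prems(1), of 2] y[OF snoc.prems(2), of 2] y[OF snoc.prems(1), of 3] y[OF snoc.prems(2), of 3]
      exhaust_3[of k] by (auto simp: brun_lifts_def)
  show ?case
  proof (cases "k = 3")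
    case True
    then have "(y, 1) \<in> lift (brun k) F" using y[OF snoc.prems(1), of 1] by (simp add: brun_lifts_def)
    then have "\<forall>i. (y, i) \<in> lift (brun k) F" using 23 exhaust_3 by metis
    then show ?thesis using brun_vertex_123 by (auto simp: brun.snoc_simps)
  next
    case False
    then show ?thesis using snoc.IH[OF 23] snoc.prems(3) by (simp add: brun.snoc_simps)
  qed
qed

text \<open>The letter 1 retains a face of type 3; the first other letter creates the types 2 and 3
  at a common vertex. If that letter is a 3, one further letter 3 remains for
  \<open>brun_vertex_23\<close>.\<close>

lemma brun_vertex_3:
  assumes "(x, 3) \<in> F" "2 \<le> brun.weight ks"
  shows "\<exists>z. \<forall>i. (z, i) \<in> brun.lifts ks F"
  using assms
proof (induction ks arbitrary: x F rule: rev_induct)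
  case Nil
  then show ?case by (simp add: brun.weight_def)
next
  case (snoc k ks)
  from brun_same_base[of x F k] obtain y where
    "\<forall>i j. (x, i) \<in> F \<longrightarrow> ((0, 0, 0), code j) \<in> set (brun_lifts (code k) (code i)) \<longrightarrow> (y, j) \<in> lift (brun k) F"
    by (elim exE)
  note y = this[rule_format]
  show ?case
  proof (cases "k = 1")
    case True
    then obtain u where "(u, 3) \<in> lift (brun k) F"
      using brun_lift_intro[of 0 1 0 3 k 3 x F] snoc.prems(1) by (auto simp: brun_lifts_def)
    then show ?thesis using snoc True by (simp add: brun.snoc_simps)
  next
    case False
    then have "(y, 2) \<in> lift (brun k) F" "(y, 3) \<in> lift (brun k) F"
      using y[OF snoc.prems(1)] exhaust_3[of k] by (auto simp: brun_lifts_def)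
    then show ?thesis using brun_vertex_23 snoc.prems(2) by (simp add: brun.snoc_simps split: if_splits)
  qed
qed

text \<open>Reaching type 3 takes at most two letters 3 (from type 2 through type 1), and
  \<open>brun_vertex_3\<close> takes two more.\<close>

lemma brun_vertex:
  assumes "f \<in> F" "4 \<le> brun.weight ks"
  shows "\<exists>z. \<forall>i. (z, i) \<in> brun.lifts ks F"
proof -
  have 1: "\<exists>z. \<forall>i. (z, i) \<in> brun.lifts ks F" if "(x, 1) \<in> F" "3 \<le> brun.weight ks" for x F ks
    using that
  proof (induction ks arbitrary: x F rule: rev_induct)
    case Nil
    then show ?case by (simp add: brun.weight_def)
  next
    case (snoc k ks)
    obtain j q where j: "(q, code j) \<in> set (brun_lifts (code k) 1)" "k = 3 \<and> j = 3 \<or> k \<noteq> 3 \<and> j = 1"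
      using exhaust_3[of k] that by (auto simp: brun_lifts_def)
    obtain y where "(y, j) \<in> lift (brun k) {(x, 1)}"
      using brun_lift_type[of q j k "(x, 1)"] j(1) by auto
    then have y: "(y, j) \<in> lift (brun k) F"
      using lift_mono[of "{(x, 1)}" F] snoc.prems(1) by blast
    from j(2) show ?case
      using y snoc.IH brun_vertex_3 snoc.prems(2) by (auto simp: brun.snoc_simps)
  qed
  obtain x i where f: "f = (x, i)" by (cases f)
  consider "i = 1" | "i = 2" | "i = 3" using exhaust_3 by blast
  then show ?thesis
  proof cases
    case 2
    obtain ks' k where ks: "ks = ks' @ [k]"
      using assms(2) by (cases ks rule: rev_cases) (auto simp: brun.weight_def)
    obtain j q where j: "(q, code j) \<in> set (brun_lifts (code k) 2)" "k = 3 \<and> j = 1 \<or> k \<noteq> 3 \<and> j = 3"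
    proof -
      have "k = 1 \<or> k = 2 \<or> k = 3" by (rule exhaust_3)
      then show thesis
        using that[of "(0, 0, 0)" 3] that[of "(0, 0, 1)" 3] that[of "(0, 0, 0)" 1] by (auto simp: brun_lifts_def)
    qed
    obtain y where "(y, j) \<in> lift (brun k) {(x, 2)}"
      using brun_lift_type[of q j k "(x, 2)"] j(1) by auto
    then have y: "(y, j) \<in> lift (brun k) F"
      using lift_mono[of "{(x, 2)}" F] assms(1) f 2 by blast
    from j(2) show ?thesis
      using y 1 brun_vertex_3 assms(2) unfolding ks by (auto simp: brun.snoc_simps)
  qed (use assms 1 brun_vertex_3 f in auto)
qed

section \<open>Conclusion for Brun products\<close>

lemma brun_adj_near:
  assumes ok: "brun_ok v k" and adj: "(f, g) \<in> adj (plane v c)"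
  shows "list_near brun_near f g"
proof -
  obtain x i w l where eq: "f = (x, i)" "g = (w, l)" by (metis surj_pair)
  obtain z m where z: "edge z m \<subseteq> face x i" "edge z m \<subseteq> face w l"
    using adj unfolding adj_def eq by auto
  obtain a b where a: "a \<noteq> i" "a \<noteq> m" "m \<noteq> i" "x = z \<or> x = z - axis a 1"
    and b: "b \<noteq> l" "b \<noteq> m" "m \<noteq> l" "w = z \<or> w = z - axis b 1"
    using face_through_edge[OF z(1)] face_through_edge[OF z(2)] by metis
  have inf: "\<not> brun_infeasible (code i) (code l) (w $ 1 - x $ 1, w $ 2 - x $ 2, w $ 3 - x $ 3)"
    using not_brun_infeasible[OF ok] adj unfolding adj_def eq by blast
  have "i = 1 \<or> i = 2 \<or> i = 3" "l = 1 \<or> l = 2 \<or> l = 3" "a = 1 \<or> a = 2 \<or> a = 3" "b = 1 \<or> b = 2 \<or> b = 3"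
    "m = 1 \<or> m = 2 \<or> m = 3"
    by (rule exhaust_3)+
  then show ?thesis
    using a b inf by (elim disjE) (simp_all add: list_near_def eq brun_near_def axis_def)
qed

lemma invertible_brun: "invertible (incidence (brun k))"
proof -
  consider "k = 1" | "k = 2" | "k = 3" using exhaust_3 by blast
  then show ?thesis
  proof cases
    case 1
    let ?N = "vector [vector [1, 0, 0], vector [0, 1, -1], vector [0, 0, 1]] :: int^3^3"
    have "incidence (brun k) ** ?N = mat 1" "?N ** incidence (brun k) = mat 1"
      unfolding 1 by (simp_all add: vec_eq_iff forall_3 matrix_matrix_mult_def sum_3 incidence_def
          abelianization_def brun_nth mat_def)
    then show ?thesis unfolding invertible_def by blast
  next
    case 2
    let ?N = "vector [vector [1, 0, 0], vector [0, -1, 1], vector [0, 1, 0]] :: int^3^3"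
    have "incidence (brun k) ** ?N = mat 1" "?N ** incidence (brun k) = mat 1"
      unfolding 2 by (simp_all add: vec_eq_iff forall_3 matrix_matrix_mult_def sum_3 incidence_def
          abelianization_def brun_nth mat_def)
    then show ?thesis unfolding invertible_def by blast
  next
    case 3
    let ?N = "vector [vector [0, 1, 0], vector [-1, 0, 1], vector [1, 0, 0]] :: int^3^3"
    have "incidence (brun k) ** ?N = mat 1" "?N ** incidence (brun k) = mat 1"
      unfolding 3 by (simp_all add: vec_eq_iff forall_3 matrix_matrix_mult_def sum_3 incidence_def
          abelianization_def brun_nth mat_def)
    then show ?thesis unfolding invertible_def by blast
  qed
qed

text \<open>The images of \<open>(v1, v2, v3)\<close> are \<open>(v1, v2, v2 + v3)\<close>,
  \<open>(v1, v3, v2 + v3)\<close> and \<open>(v2, v3, v1 + v3)\<close>, all increasing.\<close>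

lemma brun_ok_push: "brun_ok v k \<Longrightarrow> brun_ok (push (brun j) v) k"
  using exhaust_3[of j]
  by (auto simp: brun_ok_def push_def dot_def abelianization_def brun_nth)

lemma brun_run: "brun_ok v k \<Longrightarrow> brun.run v ks \<and> brun_ok (brun.pushes ks v) k"
proof (induction ks)
  case (Cons j ks)
  then have "brun_ok (brun.pushes ks v) j" by (simp add: brun_ok_def)
  then show ?case using Cons brun_ok_push[of "brun.pushes ks v" k j] by (simp add: brun.pushes_def)
qed (simp add: brun.pushes_def)

lemma brun_deep:
  assumes "Suc R * 13 + 4 \<le> count_list ks 3"
  shows "\<exists>P t. is_pattern P \<and> U \<subseteq> P \<and> translate t P \<subseteq> foldr Sigma_Br ks U \<and> R \<le> rad P"
proof -
  \<comment> \<open>The plane of \<open>(1, 1, 1)\<close> with offset 0 contains \<open>U\<close>.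
    One face of \<open>U\<close> is enough as a seed, since lifting is monotone.\<close>
  let ?v = "vector [1, 1, 1] :: int^3" and ?f = "(0, 1) :: cell"
  have run: "brun.run ?v ks" "brun_ok (brun.pushes ks ?v) 1"
    using brun_run[of ?v 1 ks] by (simp_all add: brun_ok_def)
  have "brun.weight ks = count_list ks 3"
    by (induction ks) (simp_all add: brun.weight_def)
  then have "\<exists>P t. is_pattern P \<and> U \<subseteq> P \<and> translate t P \<subseteq> body (brun.lifts ks {?f}) \<and> R \<le> rad P"
  proof (intro brun.rad_unbounded[of 13 4 ?v ks R ?f 0])
    show "brun.wins v c ks f" if "brun.run v ks" "13 \<le> brun.weight ks" "f \<in> plane v c" for v ks c f
      using brun_wins that by blast
    show "\<exists>z. \<forall>i. (z, i) \<in> brun.lifts ks {f}" if "brun.run v ks" "4 \<le> brun.weight ks" for v ks f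
      using brun_vertex[of f "{f}" ks] that by simp
    show "0 < brun.pushes ks ?v $ i" for i
      using run(2) exhaust_3[of i] by (auto simp: brun_ok_def)
    show "list_near brun_near f g" if "(f, g) \<in> adj (plane (brun.pushes ks ?v) 0)" for f g
      using brun_adj_near[OF run(2) that] .
  qed (use assms run(1) in \<open>simp_all add: list_near_def plane_def dot_def\<close>)
  moreover have "body (brun.lifts ks {?f}) \<subseteq> foldr Sigma_Br ks U"
    unfolding U_eq_body foldr_dual_subst[of brun, OF invertible_brun] brun.lifts_def[symmetric]
    by (intro body_mono brun.lifts_mono) auto
  ultimately show ?thesis by (meson order_trans)
qed

section \<open>Jacobi-Perron substitutions\<close>

text \<open>The analogue of \<open>brun_near\<close>, with a single table serving all pairs
  \<open>(a, b)\<close> permitted by \<open>jp_ok\<close>.\<close>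

definition jp_near :: "int \<Rightarrow> int \<Rightarrow> (int \<times> int \<times> int) list"
  where "jp_near i k =
   (if i = 1 then
     (if k = 1 then [(0, -1, 0), (0, 1, 0)]
      else if k = 2 then [(-1, 1, 0), (0, 0, 0), (0, 1, -1)]
      else [(-1, 0, 1), (-1, 1, 0), (-1, 1, 1), (0, -1, 0), (0, -1, 1), (0, 0, 0), (0, 1, 0)])
    else if i = 2 then
     (if k = 1 then [(0, -1, 1), (0, 0, 0), (1, -1, 0)]
      else if k = 2 then [(-1, 0, 0), (-1, 0, 1), (1, 0, -1), (1, 0, 0)]
      else [(-1, -1, 1), (-1, 0, 0), (-1, 0, 1), (0, -1, 1), (0, 0, 0), (1, -1, 0), (1, -1, 1),
         (1, 0, 0)])
    else
     (if k = 1 then [(0, -1, 0), (0, 0, 0), (0, 1, -1), (0, 1, 0), (1, -1, -1), (1, -1, 0), (1, 0, -1)]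
      else if k = 2 then [(-1, 0, 0), (-1, 1, -1), (-1, 1, 0), (0, 0, 0), (0, 1, -1), (1, 0, -1), (1, 0, 0),
         (1, 1, -1)]
      else [(-1, -1, 0), (-1, 0, 0), (-1, 0, 1), (-1, 1, -1), (-1, 1, 0), (-1, 1, 1), (0, -1, 0),
         (0, 1, 0), (1, -1, -1), (1, -1, 0), (1, -1, 1), (1, 0, -1), (1, 0, 0), (1, 1, 0)]))"

text \<open>
  The bad faces in the 17 situations of the strategy, which needs no lookahead and distinguishes
  only \<open>a = 0\<close> and \<open>a > 0\<close>.
\<close>

definition jp_bad :: "(int \<times> int \<times> int \<times> int) list list"
  where "jp_bad = [
    [(-1, -1, 0, 3), (-1, 0, 0, 2), (-1, 0, 0, 3), (-1, 0, 1, 3), (-1, 1, -1, 2), (-1, 1, -1, 3),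
     (-1, 1, 0, 2), (-1, 1, 0, 3), (-1, 1, 1, 3), (0, -1, 0, 1), (0, -1, 0, 3), (0, 0, 0, 1),
     (0, 0, 0, 2), (0, 1, -1, 1), (0, 1, -1, 2), (0, 1, 0, 1), (0, 1, 0, 3), (1, -1, -1, 1),
     (1, -1, -1, 3), (1, -1, 0, 1), (1, -1, 0, 3), (1, -1, 1, 3), (1, 0, -1, 1), (1, 0, -1, 2),
     (1, 0, -1, 3), (1, 0, 0, 2), (1, 0, 0, 3), (1, 1, -1, 2), (1, 1, 0, 3)],
    [(-1, 0, 1, 3), (-1, 1, 0, 2), (-1, 1, 0, 3), (-1, 1, 1, 3), (0, -1, 0, 1), (0, -1, 0, 3),
     (0, 0, 0, 2), (0, 1, -1, 1), (0, 1, -1, 2), (0, 1, 0, 1), (0, 1, 0, 3), (1, -1, -1, 1),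
     (1, -1, -1, 3), (1, -1, 0, 1), (1, -1, 0, 3), (1, 0, -1, 1), (1, 0, -1, 2), (1, 0, -1, 3),
     (1, 0, 0, 3), (1, 1, -1, 2), (1, 1, 0, 3)],
    [(-1, 0, 1, 3), (-1, 1, 0, 2), (-1, 1, 0, 3), (-1, 1, 1, 3), (0, 1, -1, 1), (0, 1, -1, 2),
     (0, 1, 0, 1), (0, 1, 0, 3), (1, -1, 0, 1), (1, -1, 0, 3), (1, 0, -1, 1), (1, 0, -1, 2),
     (1, 0, -1, 3), (1, 0, 0, 3), (1, 1, -1, 2), (1, 1, 0, 3)],
    [(-1, 0, 1, 3), (-1, 1, -1, 2), (-1, 1, -1, 3), (-1, 1, 0, 2), (-1, 1, 0, 3), (0, 1, -1, 1),
     (0, 1, -1, 2), (0, 1, 0, 3), (1, -1, 0, 1), (1, -1, 0, 3), (1, -1, 1, 3), (1, 0, -1, 1),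
     (1, 0, -1, 2), (1, 0, -1, 3), (1, 0, 0, 2), (1, 0, 0, 3), (1, 1, -1, 2), (1, 1, 0, 3)],
    [(-1, 0, 1, 3), (-1, 1, 0, 2), (-1, 1, 0, 3), (-1, 1, 1, 3), (0, 1, 0, 1), (0, 1, 0, 3),
     (1, -1, 0, 1), (1, -1, 0, 3), (1, 1, -1, 2), (1, 1, 0, 3)],
    [(-1, 0, 1, 3), (-1, 1, 0, 2), (-1, 1, 0, 3), (0, 1, -1, 1), (0, 1, -1, 2), (0, 1, 0, 3),
     (1, -1, 1, 3), (1, 1, -1, 2), (1, 1, 0, 3)],
    [(-1, 0, 1, 3), (-1, 1, 1, 3), (0, -1, 1, 3)],
    [(-1, -1, 1, 3), (0, -1, 1, 1), (0, -1, 1, 3), (1, -1, 0, 1), (1, -1, 0, 3), (1, 0, -1, 2)],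
    [(-1, -1, 1, 3), (0, -1, 1, 1), (0, -1, 1, 3), (1, -1, 0, 1), (1, -1, 0, 3)],
    [(-1, 1, 0, 3), (0, 1, -1, 1), (0, 1, -1, 2), (1, -1, -1, 1), (1, -1, -1, 3), (1, 0, -1, 1),
     (1, 0, -1, 2), (1, 0, -1, 3)],
    [(-1, 1, -1, 2), (-1, 1, -1, 3), (0, 1, -1, 2), (1, 0, -1, 1), (1, 0, -1, 2), (1, 0, -1, 3)],
    [(-1, 0, 1, 3), (-1, 1, 0, 2), (-1, 1, 0, 3), (0, 1, -1, 1), (0, 1, -1, 2), (0, 1, 0, 3)],
    [(-1, 0, 1, 3), (-1, 1, -1, 2), (-1, 1, -1, 3), (-1, 1, 0, 2), (-1, 1, 0, 3), (0, 1, -1, 2)],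
    [(-1, 0, 1, 3), (1, -1, 0, 1), (1, -1, 0, 3)],
    [(-1, 0, 1, 3), (1, -1, 1, 3)],
    [],
    []]"

text \<open>
  The letter \<open>i\<close> occurs in the image of \<open>j\<close> followed by \<open>t\<close> letters, all of them equal to 3.
\<close>

definition jp_opt :: "int \<Rightarrow> int \<Rightarrow> int \<Rightarrow> int \<Rightarrow> int \<Rightarrow> bool"
  where "jp_opt a b i t j \<longleftrightarrow>
    i = 1 \<and> j = 2 \<and> t = a \<or> i = 2 \<and> j = 3 \<and> t = b \<or>
    i = 3 \<and> (j = 1 \<and> t = 0 \<or> j = 2 \<and> 0 \<le> t \<and> t < a \<or> j = 3 \<and> 0 \<le> t \<and> t < b)"

text \<open>The inverse incidence matrix sends \<open>(x1, x2, x3)\<close> to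
  \<open>(x3 - a * x1 - b * x2, x1, x2)\<close>. The triple tested is its value at
  \<open>(d1, d2, d3 + u - t)\<close>, the offset between the descendants.\<close>

definition jp_step_ok :: "int \<Rightarrow> int \<Rightarrow> int \<Rightarrow> int \<Rightarrow> (int \<times> int \<times> int \<times> int) list
    \<Rightarrow> (int \<times> int \<times> int \<times> int) list \<Rightarrow> bool"
  where "jp_step_ok a b t j B B' \<longleftrightarrow>
    (\<forall>(d1, d2, d3, k)\<in>set B. \<forall>u m. jp_opt a b k u m \<longrightarrow>
      (d3 + u - t - a * d1 - b * d2, d1, d2) \<in> set (jp_near j m) \<longrightarrow>
      (d3 + u - t - a * d1 - b * d2, d1, d2, m) \<in> set B')"

definition jp_type :: "nat \<Rightarrow> int"
  where "jp_type n = (if n = 6 \<or> n = 15 then 1 else if n = 7 \<or> n = 8 \<or> n = 16 then 2 else 3)"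

text \<open>
  In situation \<open>n\<close>: the suffix length \<open>t\<close> and the type of the chosen descendant, and the situation
  reached.
\<close>

definition jp_next :: "nat \<Rightarrow> int \<Rightarrow> int \<Rightarrow> int \<times> int \<times> nat"
  where "jp_next n a b =
   (if n < 4 then (0, 3, (if a = 0 then [1, 2, 4, 4] else [3, 3, 5, 5]) ! n)
    else if n = 4 \<and> a \<noteq> 0 then (0, 3, 5)
    else if n \<le> 5 then (0, 1, 6)
    else if n = 6 then (a, 2, if a = 0 then 8 else 7)
    else if n \<le> 8 then (b, 3, if a = 0 then 9 else 10)
    else if n \<le> 10 then (b - 1, 3, if a = 0 then 11 else 12)
    else if n \<le> 12 then (0, 3, if a = 0 then 13 else 14)
    else if a = 0 then (0, 1, 15) else (0, 2, 16))"

section \<open>Checking the strategy for all \<open>a\<close> and \<open>b\<close> at once\<close>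

lemma jp_step_ok_iff:
  "jp_step_ok a b t j B B' \<longleftrightarrow>
    list_all (\<lambda>(d1, d2, d3, k).
      let e = d3 - t - a * d1 - b * d2;
        P = (\<lambda>x m. (x, d1, d2) \<in> set (jp_near j m) \<longrightarrow> (x, d1, d2, m) \<in> set B')
      in (k = 1 \<longrightarrow> P (e + a) 2) \<and> (k = 2 \<longrightarrow> P (e + b) 3) \<and>
        (k = 3 \<longrightarrow> P e 1 \<and> (\<forall>u. 0 \<le> u \<and> u < a \<longrightarrow> P (e + u) 2) \<and> (\<forall>u. 0 \<le> u \<and> u < b \<longrightarrow> P (e + u) 3))) B"
  unfolding jp_step_ok_def list_all_iff
proof (intro ball_cong refl)
  fix x :: "int \<times> int \<times> int \<times> int"
  obtain d1 d2 d3 k where "x = (d1, d2, d3, k)" by (rule prod_cases4)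
  then show "(case x of (d1, d2, d3, k) \<Rightarrow> \<forall>u m. jp_opt a b k u m \<longrightarrow>
      (d3 + u - t - a * d1 - b * d2, d1, d2) \<in> set (jp_near j m) \<longrightarrow>
      (d3 + u - t - a * d1 - b * d2, d1, d2, m) \<in> set B') \<longleftrightarrow>
    (case x of (d1, d2, d3, k) \<Rightarrow>
      let e = d3 - t - a * d1 - b * d2;
        P = (\<lambda>x m. (x, d1, d2) \<in> set (jp_near j m) \<longrightarrow> (x, d1, d2, m) \<in> set B')
      in (k = 1 \<longrightarrow> P (e + a) 2) \<and> (k = 2 \<longrightarrow> P (e + b) 3) \<and>
        (k = 3 \<longrightarrow> P e 1 \<and> (\<forall>u. 0 \<le> u \<and> u < a \<longrightarrow> P (e + u) 2) \<and> (\<forall>u. 0 \<le> u \<and> u < b \<longrightarrow> P (e + u) 3)))"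
    by (clarsimp simp: jp_opt_def Let_def algebra_simps) (auto simp: algebra_simps)
qed

text \<open>In every table entry \<open>d1\<close> and \<open>d2\<close> are numerals, so the
  offsets are affine in the parameters and the conditions are linear.\<close>

lemma jp_steps_zero:
  assumes "1 \<le> b" 
  shows
    "jp_step_ok 0 b 0 3 (jp_bad ! 0) (jp_bad ! 1)"
    "jp_step_ok 0 b 0 3 (jp_bad ! 1) (jp_bad ! 2)"
    "jp_step_ok 0 b 0 3 (jp_bad ! 2) (jp_bad ! 4)"
    "jp_step_ok 0 b 0 3 (jp_bad ! 3) (jp_bad ! 4)"
    "jp_step_ok 0 b 0 1 (jp_bad ! 4) (jp_bad ! 6)"
    "jp_step_ok 0 b 0 1 (jp_bad ! 5) (jp_bad ! 6)"
    "jp_step_ok 0 b 0 2 (jp_bad ! 6) (jp_bad ! 8)"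
    "jp_step_ok 0 b b 3 (jp_bad ! 7) (jp_bad ! 9)"
    "jp_step_ok 0 b b 3 (jp_bad ! 8) (jp_bad ! 9)"
    "jp_step_ok 0 b (b - 1) 3 (jp_bad ! 9) (jp_bad ! 11)"
    "jp_step_ok 0 b (b - 1) 3 (jp_bad ! 10) (jp_bad ! 11)"
    "jp_step_ok 0 b 0 3 (jp_bad ! 11) (jp_bad ! 13)"
    "jp_step_ok 0 b 0 3 (jp_bad ! 12) (jp_bad ! 13)"
    "jp_step_ok 0 b 0 1 (jp_bad ! 13) (jp_bad ! 15)"
    "jp_step_ok 0 b 0 1 (jp_bad ! 14) (jp_bad ! 15)"
  using assms by (simp_all add: jp_step_ok_iff jp_bad_def jp_near_def)

lemma jp_steps_pos:
  assumes "1 \<le> a" "a \<le> b"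
  shows
    "jp_step_ok a b 0 3 (jp_bad ! 0) (jp_bad ! 3)"
    "jp_step_ok a b 0 3 (jp_bad ! 1) (jp_bad ! 3)"
    "jp_step_ok a b 0 3 (jp_bad ! 2) (jp_bad ! 5)"
    "jp_step_ok a b 0 3 (jp_bad ! 3) (jp_bad ! 5)"
    "jp_step_ok a b 0 3 (jp_bad ! 4) (jp_bad ! 5)"
    "jp_step_ok a b 0 1 (jp_bad ! 5) (jp_bad ! 6)"
    "jp_step_ok a b a 2 (jp_bad ! 6) (jp_bad ! 7)"
    "jp_step_ok a b b 3 (jp_bad ! 7) (jp_bad ! 10)"
    "jp_step_ok a b b 3 (jp_bad ! 8) (jp_bad ! 10)"
    "jp_step_ok a b (b - 1) 3 (jp_bad ! 9) (jp_bad ! 12)"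
    "jp_step_ok a b (b - 1) 3 (jp_bad ! 10) (jp_bad ! 12)"
    "jp_step_ok a b 0 3 (jp_bad ! 11) (jp_bad ! 14)"
    "jp_step_ok a b 0 3 (jp_bad ! 12) (jp_bad ! 14)"
    "jp_step_ok a b 0 2 (jp_bad ! 13) (jp_bad ! 16)"
    "jp_step_ok a b 0 2 (jp_bad ! 14) (jp_bad ! 16)"
  using assms by (simp_all add: jp_step_ok_iff jp_bad_def jp_near_def)

text \<open>The number of the situation strictly increases, and from 15 on there are no bad faces;
  thus 15 letters suffice from situation 0.\<close>

lemma jp_next_ok:
  assumes "n < 15" "0 \<le> a" "a \<le> b" "b \<noteq> 0"
  shows "case jp_next n a b of (t, j, n') \<Rightarrow> n < n' \<and> n' \<le> 16 \<and> j = jp_type n' \<and>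
    jp_opt a b (jp_type n) t j \<and> jp_step_ok a b t j (jp_bad ! n) (jp_bad ! n')"
proof -
  have n: "n = 0 \<or> n = 1 \<or> n = 2 \<or> n = 3 \<or> n = 4 \<or> n = 5 \<or> n = 6 \<or> n = 7 \<or> n = 8 \<or> n = 9 \<or> n = 10
    \<or> n = 11 \<or> n = 12 \<or> n = 13 \<or> n = 14"
    using assms(1) by presburger
  show ?thesis
  proof (cases "a = 0")
    case True
    then have "1 \<le> b" using assms by linarith
    then show ?thesis
      using n jp_steps_zero[of b] True
      by (elim disjE) (simp_all add: jp_next_def jp_type_def jp_opt_def)
  next
    case False
    then have "1 \<le> a" using assms by linarith
    then show ?thesis
      using n jp_steps_pos[of a b] assms(3)
      by (elim disjE) (simp_all add: jp_next_def jp_type_def jp_opt_def)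
  qed
qed

section \<open>Jacobi-Perron lifts in coordinates\<close>

lemma append_Cons_eq_replicate:
  "c # replicate n d = p @ i # s \<longleftrightarrow>
    p = [] \<and> i = c \<and> s = replicate n d \<or> (\<exists>t<n. p = c # replicate (n - Suc t) d \<and> i = d \<and> s = replicate t d)"
proof (induction n arbitrary: c p)
  case 0
  then show ?case by (auto simp: Cons_eq_append_conv)
next
  case (Suc n)
  show ?case
  proof (cases p)
    case Nil
    then show ?thesis by auto
  next
    case (Cons x p')
    have "c # replicate (Suc n) d = p @ i # s \<longleftrightarrow> x = c \<and> d # replicate n d = p' @ i # s"
      using Cons by auto
    also have "\<dots> \<longleftrightarrow> x = c \<and> (p' = [] \<and> i = d \<and> s = replicate n d \<or>
        (\<exists>t<n. p' = d # replicate (n - Suc t) d \<and> i = d \<and> s = replicate t d))"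
      unfolding Suc.IH ..
    also have "\<dots> \<longleftrightarrow> x = c \<and> (\<exists>t<Suc n. p' = replicate (n - t) d \<and> i = d \<and> s = replicate t d)"
    proof -
      have "d # replicate (n - Suc t) d = replicate (n - t) d" if "t < n" for t
        using that by (simp flip: replicate_Suc add: Suc_diff_Suc)
      then show ?thesis by (auto simp: less_Suc_eq)
    qed
    finally show ?thesis using Cons by auto
  qed
qed

lemma count_list_replicate_eq: "count_list (replicate n x) y = (if x = y then n else 0)"
  by (induction n) auto

lemma jp_nth:
  "jacobi_perron (a, b) 1 = [3]" "jacobi_perron (a, b) 2 = 1 # replicate a 3"
  "jacobi_perron (a, b) 3 = 2 # replicate b 3"
  by (simp_all add: jacobi_perron_def mk_subst_def)

text \<open>All suffixes concerned are powers of the letter 3, so the length \<open>t\<close>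
  replaces the word \<open>s\<close>.\<close>

lemma jp_split:
  "(\<exists>p. jacobi_perron (a, b) j = p @ i # s) \<longleftrightarrow>
    (\<exists>t. jp_opt (int a) (int b) (code i) t (code j) \<and> s = replicate (nat t) 3)"
proof -
  have *: "(\<exists>t. 0 \<le> t \<and> t < int n \<and> s = replicate (nat t) 3) \<longleftrightarrow> (\<exists>t<n. s = replicate t 3)" for n
  proof
    assume "\<exists>t<n. s = replicate t 3"
    then obtain t where "t < n" "s = replicate t 3" by blast
    then show "\<exists>t. 0 \<le> t \<and> t < int n \<and> s = replicate (nat t) 3"
      by (intro exI[of _ "int t"]) simp
  qed (auto simp: nat_less_iff)
  have **: "(\<exists>p. c # replicate n 3 = p @ i # s) \<longleftrightarrow> i = c \<and> s = replicate n 3 \<or> i = 3 \<and> (\<exists>t<n. s = replicate t 3)"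
    for c n
    unfolding append_Cons_eq_replicate by blast
  have "j = 1 \<or> j = 2 \<or> j = 3" by (rule exhaust_3)
  then show ?thesis
  proof (elim disjE)
    assume "j = 1"
    then show ?thesis by (auto simp: jp_nth append_Cons_eq jp_opt_def code_eq_iff)
  next
    assume j: "j = 2"
    show ?thesis
      unfolding j jp_nth ** *[symmetric] jp_opt_def by (auto simp: code_eq_iff)
  next
    assume j: "j = 3"
    show ?thesis
      unfolding j jp_nth ** *[symmetric] jp_opt_def by (auto simp: code_eq_iff)
  qed
qed

lemma lift_jp_iff:
  "(y, j) \<in> lift (jacobi_perron (a, b)) F \<longleftrightarrow>
    (\<exists>x i t. (x, i) \<in> F \<and> jp_opt (int a) (int b) (code i) t (code j) \<and>
      y $ 2 = x $ 1 \<and> y $ 3 = x $ 2 \<and> y $ 1 + int a * y $ 2 + int b * y $ 3 = x $ 3 + t)"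
proof -
  let ?E = "\<lambda>x s. \<forall>r. int (count_list (jacobi_perron (a, b) 1) r) * y $ 1
    + int (count_list (jacobi_perron (a, b) 2) r) * y $ 2 + int (count_list (jacobi_perron (a, b) 3) r) * y $ 3
    = x $ r + int (count_list s r)"
  have "(y, j) \<in> lift (jacobi_perron (a, b)) F \<longleftrightarrow>
    (\<exists>x i s. (\<exists>p. jacobi_perron (a, b) j = p @ i # s) \<and> (x, i) \<in> F \<and> ?E x s)"
    unfolding lift_iff by blast
  also have "\<dots> \<longleftrightarrow> (\<exists>x i t. (x, i) \<in> F \<and> jp_opt (int a) (int b) (code i) t (code j) \<and> ?E x (replicate (nat t) 3))"
    unfolding jp_split by blast
  also have "\<dots> \<longleftrightarrow> (\<exists>x i t. (x, i) \<in> F \<and> jp_opt (int a) (int b) (code i) t (code j) \<and>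
      y $ 2 = x $ 1 \<and> y $ 3 = x $ 2 \<and> y $ 1 + int a * y $ 2 + int b * y $ 3 = x $ 3 + t)"
  proof -
    have "?E x (replicate (nat t) 3) \<longleftrightarrow>
      y $ 2 = x $ 1 \<and> y $ 3 = x $ 2 \<and> y $ 1 + int a * y $ 2 + int b * y $ 3 = x $ 3 + t"
      if "jp_opt (int a) (int b) i t j" for x i t j
    proof -
      have "0 \<le> t" using that by (auto simp: jp_opt_def)
      then show ?thesis
        by (simp add: forall_3 jp_nth count_list_replicate_eq) 
    qed
    then show ?thesis by blast
  qed
  finally show ?thesis .
qed

section \<open>The Jacobi-Perron cone and stability of nearness\<close>

definition jp_ok :: "int^3 \<Rightarrow> nat \<times> nat \<Rightarrow> bool"
  where "jp_ok v = (\<lambda>(a, b). 0 < v $ 1 \<and> 0 < v $ 2 \<and> v $ 1 \<le> v $ 3 \<and> v $ 2 \<le> v $ 3 \<and>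
    a \<le> b \<and> b \<noteq> 0 \<and> (a = b \<longrightarrow> v $ 1 \<le> v $ 2))"

text \<open>The cone consists of two chambers according to the order of \<open>v1\<close> and
  \<open>v2\<close>. A form that is positive somewhere in a chamber is positive at one of its
  generators: \<open>(0, 0, 1)\<close>, \<open>(1, 1, 1)\<close>, and \<open>(0, 1, 1)\<close> or
  \<open>(1, 0, 1)\<close>.\<close>

lemma jp_cone_pos:
  fixes a b c :: int
  assumes "0 < a * v1 + b * v2 + c * v3" "0 < v1" "0 < v2" "v1 \<le> v3" "v2 \<le> v3"
  shows "0 < c \<or> 0 < a + b + c \<or> 0 < b + c \<and> v1 \<le> v2 \<or> 0 < a + c \<and> v2 < v1"
proof (rule ccontr)
  assume neg: "\<not> ?thesis"
  show False
  proof (cases "v1 \<le> v2")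
    case True
    then show False using cone_nonpos[of c b a v1 v2 v3] neg assms by simp
  next
    case False
    then show False using cone_nonpos[of c a b v2 v1 v3] neg assms by (simp add: algebra_simps)
  qed
qed

text \<open>Values at the generators. The flag \<open>e\<close> stands for \<open>a = b\<close>,
  when the chamber with generator \<open>(1, 0, 1)\<close> is excluded.\<close>

definition jp_pos :: "bool \<Rightarrow> int \<Rightarrow> int \<Rightarrow> int \<Rightarrow> bool"
  where "jp_pos e D1 D2 D3 \<longleftrightarrow> 0 < D3 \<or> 0 < D1 + D2 + D3 \<or> 0 < D2 + D3 \<or> \<not> e \<and> 0 < D1 + D3"

text \<open>The normal vector is eliminated here: with \<open>jp_pos\<close> in place of the height
  bounds and numerals for \<open>e2\<close> and \<open>e3\<close>, every case is linear in
  \<open>a\<close>, \<open>b\<close>, \<open>t\<close> and \<open>u\<close>.\<close>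

lemma jp_near_closed_aux:
  fixes a b :: int
  assumes "(e1, e2, e3) \<in> set (jp_near j m) \<or> (e1, e2, e3) = (0, 0, 0) \<and> j = m"
    and "i = 1 \<and> j = 2 \<and> t = a \<or> i = 2 \<and> j = 3 \<and> t = b \<or> i = 3 \<and> j = 1 \<and> t = 0 \<or>
      i = 3 \<and> j = 2 \<and> 0 \<le> t \<and> t < a \<or> i = 3 \<and> j = 3 \<and> 0 \<le> t \<and> t < b"
    and "l = 1 \<and> m = 2 \<and> u = a \<or> l = 2 \<and> m = 3 \<and> u = b \<or> l = 3 \<and> m = 1 \<and> u = 0 \<or>
      l = 3 \<and> m = 2 \<and> 0 \<le> u \<and> u < a \<or> l = 3 \<and> m = 3 \<and> 0 \<le> u \<and> u < b"
    and "0 \<le> a" "a \<le> b" "b \<noteq> 0"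
    and "d3 = e1 + a * e2 + b * e3 + t - u"
    and "jp_pos (a = b) (e2 + (if i = 1 then 1 else 0)) (e3 + (if i = 2 then 1 else 0)) (d3 + (if i = 3 then 1 else 0))"
    and "jp_pos (a = b) ((if l = 1 then 1 else 0) - e2) ((if l = 2 then 1 else 0) - e3) ((if l = 3 then 1 else 0) - d3)"
  shows "(e2, e3, d3) \<in> set (jp_near i l) \<or> (e2, e3, d3) = (0, 0, 0) \<and> i = l"
  using assms
  apply (elim disjE conjE)
  apply (simp_all add: jp_near_def)
  apply ((elim disjE conjE)?; (simp add: jp_pos_def)?; (elim disjE conjE)?; linarith?)+
  done

lemma jp_near_closed:
  fixes a b v1 v2 v3 :: int
  assumes v: "0 < v1" "0 < v2" "v1 \<le> v3" "v2 \<le> v3" "a = b \<longrightarrow> v1 \<le> v2"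
    and ab: "0 \<le> a" "a \<le> b" "b \<noteq> 0"
    and opt: "jp_opt a b i t j" "jp_opt a b l u m"
    and near: "(e1, e2, e3) \<in> set (jp_near j m) \<or> (e1, e2, e3) = (0, 0, 0) \<and> j = m"
    and d3: "d3 = e1 + a * e2 + b * e3 + t - u"
    and lo: "- (if i = 1 then v1 else if i = 2 then v2 else v3) < e2 * v1 + e3 * v2 + d3 * v3"
    and hi: "e2 * v1 + e3 * v2 + d3 * v3 < (if l = 1 then v1 else if l = 2 then v2 else v3)"
  shows "(e2, e3, d3) \<in> set (jp_near i l) \<or> (e2, e3, d3) = (0, 0, 0) \<and> i = l"
proof -
  define I where "I = (\<lambda>i r :: int. if i = r then 1 else 0 :: int)"
  have opt': "i = 1 \<and> j = 2 \<and> t = a \<or> i = 2 \<and> j = 3 \<and> t = b \<or> i = 3 \<and> j = 1 \<and> t = 0 \<or>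
      i = 3 \<and> j = 2 \<and> 0 \<le> t \<and> t < a \<or> i = 3 \<and> j = 3 \<and> 0 \<le> t \<and> t < b"
    "l = 1 \<and> m = 2 \<and> u = a \<or> l = 2 \<and> m = 3 \<and> u = b \<or> l = 3 \<and> m = 1 \<and> u = 0 \<or>
      l = 3 \<and> m = 2 \<and> 0 \<le> u \<and> u < a \<or> l = 3 \<and> m = 3 \<and> 0 \<le> u \<and> u < b"
    using opt unfolding jp_opt_def by blast+
  have "i = 1 \<or> i = 2 \<or> i = 3" "l = 1 \<or> l = 2 \<or> l = 3" using opt' by blast+
  then have "0 < (e2 + I i 1) * v1 + (e3 + I i 2) * v2 + (d3 + I i 3) * v3"
    "0 < (I l 1 - e2) * v1 + (I l 2 - e3) * v2 + (I l 3 - d3) * v3"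
    using lo hi by (auto simp: I_def algebra_simps)
  then have "jp_pos (a = b) (e2 + I i 1) (e3 + I i 2) (d3 + I i 3)" "jp_pos (a = b) (I l 1 - e2) (I l 2 - e3) (I l 3 - d3)"
    using jp_cone_pos[OF _ v(1-4)] v(5) unfolding jp_pos_def by fastforce+
  then show ?thesis
    using jp_near_closed_aux[OF near opt' ab d3] unfolding I_def by blast
qed

lemma jp_near_lift:
  assumes ok: "jp_ok v k" and f: "f \<in> plane v c" and g: "g \<in> plane v c"
    and f': "f' \<in> lift (jacobi_perron k) {f}" and g': "g' \<in> lift (jacobi_perron k) {g}"
    and near: "list_near jp_near f' g'"
  shows "list_near jp_near f g"
proof -
  obtain a b where k: "k = (a, b)" by (cases k)
  obtain x i w l y j z m where eq: "f = (x, i)" "g = (w, l)" "f' = (y, j)" "g' = (z, m)"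
    by (metis surj_pair)
  obtain t where t: "jp_opt (int a) (int b) (code i) t (code j)" "y $ 2 = x $ 1" "y $ 3 = x $ 2"
    "y $ 1 + int a * y $ 2 + int b * y $ 3 = x $ 3 + t"
    using f' unfolding k eq lift_jp_iff by blast
  obtain u where u: "jp_opt (int a) (int b) (code l) u (code m)" "z $ 2 = w $ 1" "z $ 3 = w $ 2"
    "z $ 1 + int a * z $ 2 + int b * z $ 3 = w $ 3 + u"
    using g' unfolding k eq lift_jp_iff by blast
  have sel: "v $ i = (if code i = 1 then v $ 1 else if code i = 2 then v $ 2 else v $ 3)" for i
    using exhaust_3[of i] by auto
  have "dot v w - dot v x = (z $ 2 - y $ 2) * v $ 1 + (z $ 3 - y $ 3) * v $ 2 + (w $ 3 - x $ 3) * v $ 3"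
    using t u by (simp add: dot_def algebra_simps)
  then have "- (v $ i) < (z $ 2 - y $ 2) * v $ 1 + (z $ 3 - y $ 3) * v $ 2 + (w $ 3 - x $ 3) * v $ 3"
    "(z $ 2 - y $ 2) * v $ 1 + (z $ 3 - y $ 3) * v $ 2 + (w $ 3 - x $ 3) * v $ 3 < v $ l"
    using f g by (auto simp: eq plane_def)
  moreover have "w $ 3 - x $ 3 = (z $ 1 - y $ 1) + int a * (z $ 2 - y $ 2) + int b * (z $ 3 - y $ 3) + t - u"
    using t(4) u(4) by (simp add: algebra_simps)
  moreover have "(z $ 1 - y $ 1, z $ 2 - y $ 2, z $ 3 - y $ 3) \<in> set (jp_near (code j) (code m)) \<or>
      (z $ 1 - y $ 1, z $ 2 - y $ 2, z $ 3 - y $ 3) = (0, 0, 0) \<and> code j = code m"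
    using near by (auto simp: list_near_def eq)
  ultimately have "(z $ 2 - y $ 2, z $ 3 - y $ 3, w $ 3 - x $ 3) \<in> set (jp_near (code i) (code l)) \<or>
      (z $ 2 - y $ 2, z $ 3 - y $ 3, w $ 3 - x $ 3) = (0, 0, 0) \<and> code i = code l"
    using ok t(1) u(1)
    by (intro jp_near_closed[of "v $ 1" "v $ 2" "v $ 3" "int a" "int b" "code i" t "code j" "code l" u "code m" "z $ 1 - y $ 1"])
      (simp_all only: sel[symmetric], auto simp: jp_ok_def k)
  then show ?thesis
    using t(2,3) u(2,3) by (auto simp: list_near_def eq vec_eq_iff forall_3)
qed

interpretation jp: dual_system jacobi_perron jp_ok "list_near jp_near" "\<lambda>_. True"
proof
  fix v k i
  assume "jp_ok v k"
  then show "0 \<le> v $ i" using exhaust_3[of i] by (auto simp: jp_ok_def)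
qed (rule jp_near_lift)

section \<open>The Jacobi-Perron strategy removes all bad faces\<close>

lemma jp_lift_intro:
  assumes "jp_opt (int a) (int b) (code i) t (code j)" "(x, i) \<in> F"
  shows "(vector [x $ 3 + t - int a * x $ 1 - int b * x $ 2, x $ 1, x $ 2], j) \<in> lift (jacobi_perron (a, b)) F"
  unfolding lift_jp_iff
  by (intro exI[of _ x] exI[of _ i] exI[of _ t]) (use assms in simp)

lemma jp_lift_ex: "\<exists>f'. f' \<in> lift (jacobi_perron k) {f}"
proof -
  obtain a b x i where eq: "k = (a, b)" "f = (x, i)" by (metis surj_pair)
  have "\<exists>j t. jp_opt (int a) (int b) (code i) t (code j)"
    using exhaust_3[of i] unfolding ex_3 by (auto simp: jp_opt_def)
  then show ?thesis unfolding eq using jp_lift_intro by blast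
qed

lemma jp_bad_in_start:
  assumes "f \<in> plane v c" "snd f = 3"
  shows "jp.bad_in v c f {f} (jp_bad ! 0)"
proof -
  have "\<forall>k\<in>set [1, 2, 3]. \<forall>(e1, e2, e3)\<in>set (jp_near 3 k). (e1, e2, e3, k) \<in> set (jp_bad ! 0)"
    by code_simp
  then have *: "(e1, e2, e3, code i) \<in> set (jp_bad ! 0)" if "(e1, e2, e3) \<in> set (jp_near 3 (code i))" for i e1 e2 e3
    using code_in[of i] that by fast
  show ?thesis
    unfolding jp.bad_in_def using assms by (auto simp: list_near_def offset_def intro: *)
qed

lemma jp_bad_in_step:
  assumes ok: "jp_ok v (a, b)" and bad: "jp.bad_in v c f Q B"
    and opt: "jp_opt (int a) (int b) (code (snd f)) t (code j)" and step: "jp_step_ok (int a) (int b) t (code j) B B'"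
  shows "\<exists>f'\<in>lift (jacobi_perron (a, b)) {f}. snd f' = j \<and>
    jp.bad_in (push (jacobi_perron (a, b)) v) c f' (lift (jacobi_perron (a, b)) Q) B'"
proof -
  obtain x i where f: "f = (x, i)" by (cases f)
  obtain y where y: "(y, j) \<in> lift (jacobi_perron (a, b)) {f}"
    "y $ 1 = x $ 3 + t - int a * x $ 1 - int b * x $ 2" "y $ 2 = x $ 1" "y $ 3 = x $ 2"
    using jp_lift_intro[of a b i t j x "{f}"] opt by (auto simp: f)
  have "jp.bad_in (push (jacobi_perron (a, b)) v) c (y, j) (lift (jacobi_perron (a, b)) Q) B'"
  proof (rule jp.bad_in_lift[OF ok bad y(1)])
    fix g g' assume g: "offset f g \<in> set B"
      and g': "g' \<in> lift (jacobi_perron (a, b)) {g}" "list_near jp_near (y, j) g'" "g' \<noteq> (y, j)"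
    obtain w l z m where eq: "g = (w, l)" "g' = (z, m)" by (metis surj_pair)
    obtain u where u: "jp_opt (int a) (int b) (code l) u (code m)" "z $ 2 = w $ 1" "z $ 3 = w $ 2"
      "z $ 1 + int a * z $ 2 + int b * z $ 3 = w $ 3 + u"
      using g'(1) unfolding eq lift_jp_iff by blast
    let ?d1 = "w $ 1 - x $ 1" and ?d2 = "w $ 2 - x $ 2" and ?d3 = "w $ 3 - x $ 3"
    have e: "z $ 1 - y $ 1 = ?d3 + u - t - int a * ?d1 - int b * ?d2" "z $ 2 - y $ 2 = ?d1" "z $ 3 - y $ 3 = ?d2"
      using u y by (simp_all add: algebra_simps)
    have "(z $ 1 - y $ 1, z $ 2 - y $ 2, z $ 3 - y $ 3) \<in> set (jp_near (code j) (code m))"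
      using g'(2,3) by (auto simp: list_near_def eq)
    moreover have "(?d1, ?d2, ?d3, code l) \<in> set B"
      using g by (simp add: offset_def f eq)
    then have "(?d3 + u - t - int a * ?d1 - int b * ?d2, ?d1, ?d2) \<in> set (jp_near (code j) (code m)) \<longrightarrow>
      (?d3 + u - t - int a * ?d1 - int b * ?d2, ?d1, ?d2, code m) \<in> set B'"
      using bspec[OF step[unfolded jp_step_ok_def]] u(1) by fast
    ultimately have "(z $ 1 - y $ 1, z $ 2 - y $ 2, z $ 3 - y $ 3, code m) \<in> set B'"
      unfolding e by blast
    then show "offset (y, j) g' \<in> set B'" by (simp add: offset_def eq)
  qed
  then show ?thesis using y(1) by (intro bexI[of _ "(y, j)"]) simp_all
qed

lemma jp_play:
  assumes "n \<le> 16" "15 \<le> n + length ks" "code (snd f) = jp_type n" "jp.bad_in v c f Q (jp_bad ! n)" "jp.run v ks"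
  shows "\<exists>f'\<in>jp.lifts ks {f}. jp.bad_in (jp.pushes ks v) c f' (jp.lifts ks Q) []"
proof -
  have finished: "\<exists>f'\<in>jp.lifts ks {f}. jp.bad_in (jp.pushes ks v) c f' (jp.lifts ks Q) []"
    if "15 \<le> n" "n \<le> 16" "jp.bad_in v c f Q (jp_bad ! n)" "jp.run v ks" for n ks f v Q
  proof -
    have "n = 15 \<or> n = 16" using that by linarith
    then have "jp_bad ! n = []" by (auto simp: jp_bad_def)
    then show ?thesis using jp.bad_in_lifts_Nil[OF jp_lift_ex] that(3,4) by metis
  qed
  from assms show ?thesis
  proof (induction ks arbitrary: n f v Q rule: rev_induct)
    case Nil
    then show ?case using finished[of n v f Q "[]"] by simp
  next
    case (snoc k ks)
    show ?case
    proof (cases "15 \<le> n")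
      case True
      then show ?thesis using finished snoc.prems by blast
    next
      case False
      obtain a b where k: "k = (a, b)" by (cases k)
      have run: "jp_ok v (a, b)" "jp.run (push (jacobi_perron (a, b)) v) ks"
        using snoc.prems(5) unfolding jp.snoc_simps k by blast+
      obtain t j' n' where n': "jp_next n (int a) (int b) = (t, j', n')" by (rule prod_cases3)
      have "n < 15" "0 \<le> int a" "int a \<le> int b" "int b \<noteq> 0"
        using False run(1) by (auto simp: jp_ok_def)
      note n'' = jp_next_ok[OF this, unfolded n' prod.case]
      have "jp_type n' = 1 \<or> jp_type n' = 2 \<or> jp_type n' = 3" by (simp add: jp_type_def)
      then obtain j where j: "jp_type n' = code j" using code_simps by metis
      obtain h where h: "h \<in> lift (jacobi_perron k) {f}" "snd h = j"
        "jp.bad_in (push (jacobi_perron k) v) c h (lift (jacobi_perron k) Q) (jp_bad ! n')"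
        using jp_bad_in_step[OF run(1) snoc.prems(4), of t j "jp_bad ! n'"] n'' j snoc.prems(3) unfolding k by auto
      have "n' \<le> 16" "15 \<le> n' + length ks" using n'' snoc.prems(2) by auto
      then obtain f' where "f' \<in> jp.lifts ks {h}"
        "jp.bad_in (jp.pushes ks (push (jacobi_perron k) v)) c f' (jp.lifts ks (lift (jacobi_perron k) Q)) []"
        using snoc.IH[OF _ _ _ h(3)] run(2) h(2) j k by auto
      moreover have "jp.lifts ks {h} \<subseteq> jp.lifts ks (lift (jacobi_perron k) {f})"
        using h(1) by (intro jp.lifts_mono) simp
      ultimately show ?thesis unfolding jp.snoc_simps(1,2) by blast
    qed
  qed
qed

lemma jp_wins_3:
  assumes "jp.run v ks" "f \<in> plane v c" "snd f = 3" "15 \<le> length ks"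
  shows "jp.wins v c ks f"
proof -
  have "\<exists>f'\<in>jp.lifts ks {f}. jp.bad_in (jp.pushes ks v) c f' (jp.lifts ks {f}) []"
    using jp_play[OF _ _ _ jp_bad_in_start[OF assms(2,3)] assms(1)] assms(3,4) by (simp add: jp_type_def)
  then show ?thesis using jp.wins_bad_in by blast
qed

lemma jp_wins_snoc:
  assumes "jp_opt (int a) (int b) (code (snd f)) t (code j)" "f \<in> plane v c" "jp_ok v (a, b)"
    and "\<And>f1. \<lbrakk>f1 \<in> plane (push (jacobi_perron (a, b)) v) c; snd f1 = j\<rbrakk>
      \<Longrightarrow> jp.wins (push (jacobi_perron (a, b)) v) c ks f1"
  shows "jp.wins v c (ks @ [(a, b)]) f"
proof -
  obtain y where y: "(y, j) \<in> lift (jacobi_perron (a, b)) {f}"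
    using jp_lift_intro[OF assms(1), of "fst f" "{f}"] by auto
  then have "(y, j) \<in> plane (push (jacobi_perron (a, b)) v) c"
    using lift_plane[OF assms(2)] jp.ok_nonneg[OF assms(3)] by blast
  then show ?thesis using jp.wins_snoc[OF y] assms(4) by simp
qed

lemma jp_wins_2:
  assumes "jp.run v ks" "f \<in> plane v c" "snd f = 2" "16 \<le> length ks"
  shows "jp.wins v c ks f"
proof -
  obtain ks' a b where ks: "ks = ks' @ [(a, b)]"
    using assms(4) by (cases ks rule: rev_cases) auto
  show ?thesis
    using assms jp_wins_snoc[of a b f "int b" 3 v c ks'] jp_wins_3 unfolding ks
    by (simp add: jp_opt_def jp.snoc_simps)
qed

text \<open>The types follow the path 1, 2, 3, one letter for each step, so at most two letters are
  added to the 15 needed from type 3.\<close>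

lemma jp_wins:
  assumes "jp.run v ks" "17 \<le> length ks" "f \<in> plane v c"
  shows "jp.wins v c ks f"
proof -
  consider "snd f = 1" | "snd f = 2" | "snd f = 3" using exhaust_3 by blast
  then show ?thesis
  proof cases
    case 1
    obtain ks' a b where ks: "ks = ks' @ [(a, b)]"
      using assms(2) by (cases ks rule: rev_cases) auto
    show ?thesis
      using assms 1 jp_wins_snoc[of a b f "int a" 2 v c ks'] jp_wins_2 unfolding ks
      by (simp add: jp_opt_def jp.snoc_simps)
  qed (use assms jp_wins_2 jp_wins_3 in auto)
qed

section \<open>Producing a translate of \<open>U\<close> under Jacobi-Perron products\<close>

lemma jp_vertex_123:
  assumes "(x, 1) \<in> F \<and> (x, 3) \<in> F" "jp.run v ks" "ks \<noteq> []"
  shows "\<exists>z. \<forall>i. (z, i) \<in> jp.lifts ks F"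
  using assms
proof (induction ks arbitrary: x F v rule: rev_induct)
  case (snoc k ks)
  obtain a b where k: "k = (a, b)" by (cases k)
  have b: "b \<noteq> 0" and run: "jp.run (push (jacobi_perron k) v) ks"
    using snoc.prems(2) unfolding jp.snoc_simps by (auto simp: jp_ok_def k)
  \<comment> \<open>With empty suffix, type 3 yields the types 1 and 3 (as \<open>b > 0\<close>).
    Type 2 comes from type 3 if \<open>a > 0\<close> and from type 1 if \<open>a = 0\<close>, which
    is why both 1 and 3 are required at \<open>x\<close>.\<close>
  have "\<exists>i. (x, i) \<in> F \<and> jp_opt (int a) (int b) (code i) 0 (code j)" for j
    using exhaust_3[of j] snoc.prems(1) b unfolding ex_3 by (cases "a = 0") (auto simp: jp_opt_def)
  then have *: "\<exists>y. \<forall>j. (y, j) \<in> lift (jacobi_perron k) F"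
    unfolding k using jp_lift_intro[of a b _ 0 _ x F] by meson
  show ?case
  proof (cases "ks = []")
    case True
    then show ?thesis using * by (simp add: jp.lifts_def)
  next
    case False
    then show ?thesis using * snoc.IH run unfolding jp.snoc_simps by blast
  qed
qed simp

text \<open>One letter turns type 3 into the types 1 and 3 at a common vertex, a second one
  completes \<open>U\<close>. Types 2 and 1 need one and two letters to reach type 3, giving
  4.\<close>

lemma jp_vertex:
  assumes "f \<in> F" "jp.run v ks" "4 \<le> length ks"
  shows "\<exists>z. \<forall>i. (z, i) \<in> jp.lifts ks F"
proof -
  have 3: "\<exists>z. \<forall>i. (z, i) \<in> jp.lifts ks F"
    if asm: "(x, 3) \<in> F" "jp.run v ks" "2 \<le> length ks" for x F v ks
  proof -
    obtain ks' a b where ks: "ks = ks' @ [(a, b)]"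
      using asm(3) by (cases ks rule: rev_cases) auto
    have b: "b \<noteq> 0" and run: "jp.run (push (jacobi_perron (a, b)) v) ks'"
      using asm(2) unfolding ks jp.snoc_simps by (auto simp: jp_ok_def)
    have "\<exists>y. (y, 1) \<in> lift (jacobi_perron (a, b)) F \<and> (y, 3) \<in> lift (jacobi_perron (a, b)) F"
      using jp_lift_intro[of a b 3 0 1 x F] jp_lift_intro[of a b 3 0 3 x F] b asm(1)
      by (intro exI conjI) (simp_all add: jp_opt_def)
    moreover have "ks' \<noteq> []" using asm(3) ks by auto
    ultimately show ?thesis using jp_vertex_123[OF _ run] unfolding ks jp.snoc_simps by blast
  qed
  have 2: "\<exists>z. \<forall>i. (z, i) \<in> jp.lifts ks F"
    if asm: "(x, 2) \<in> F" "jp.run v ks" "3 \<le> length ks" for x F v ks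
  proof -
    obtain ks' a b where ks: "ks = ks' @ [(a, b)]"
      using asm(3) by (cases ks rule: rev_cases) auto
    then show ?thesis
      using 3[of _ _ "push (jacobi_perron (a, b)) v" ks'] jp_lift_intro[of a b 2 "int b" 3 x F] asm
      by (simp add: jp.snoc_simps jp_opt_def)
  qed
  obtain x i where f: "f = (x, i)" by (cases f)
  consider "i = 1" | "i = 2" | "i = 3" using exhaust_3 by blast
  then show ?thesis
  proof cases
    case 1
    obtain ks' a b where ks: "ks = ks' @ [(a, b)]"
      using assms(3) by (cases ks rule: rev_cases) auto
    then show ?thesis
      using 2[of _ _ "push (jacobi_perron (a, b)) v" ks'] jp_lift_intro[of a b 1 "int a" 2 x F] assms f 1
      by (simp add: jp.snoc_simps jp_opt_def)
  qed (use assms 2 3 f in auto)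
qed

section \<open>Conclusion for Jacobi-Perron products\<close>

lemma jp_adj_near:
  assumes ok: "0 < v $ 1" "0 < v $ 2" "v $ 1 \<le> v $ 3" "v $ 2 \<le> v $ 3" and adj: "(f, g) \<in> adj (plane v c)"
  shows "list_near jp_near f g"
proof -
  obtain x i w l where eq: "f = (x, i)" "g = (w, l)" by (metis surj_pair)
  obtain z m where z: "edge z m \<subseteq> face x i" "edge z m \<subseteq> face w l"
    using adj unfolding adj_def eq by auto
  obtain a b where a: "a \<noteq> i" "a \<noteq> m" "m \<noteq> i" "x = z \<or> x = z - axis a 1"
    and b: "b \<noteq> l" "b \<noteq> m" "m \<noteq> l" "w = z \<or> w = z - axis b 1"
    using face_through_edge[OF z(1)] face_through_edge[OF z(2)] by metis
  define I where "I = (\<lambda>i r :: 3. if i = r then 1 else 0 :: int)"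
  have h: "0 \<le> c + dot v x" "c + dot v x < v $ i" "0 \<le> c + dot v w" "c + dot v w < v $ l"
    using adj by (auto simp: adj_def eq plane_def)
  have sel: "v $ i = I i 1 * v $ 1 + I i 2 * v $ 2 + I i 3 * v $ 3" for i
    using exhaust_3[of i] by (auto simp: I_def)
  have "0 < (w $ 1 - x $ 1 + I i 1) * v $ 1 + (w $ 2 - x $ 2 + I i 2) * v $ 2 + (w $ 3 - x $ 3 + I i 3) * v $ 3"
    "0 < (x $ 1 - w $ 1 + I l 1) * v $ 1 + (x $ 2 - w $ 2 + I l 2) * v $ 2 + (x $ 3 - w $ 3 + I l 3) * v $ 3"
    using h sel[of i] sel[of l] by (simp_all add: dot_def algebra_simps)
  then have pos: "jp_pos False (w $ 1 - x $ 1 + I i 1) (w $ 2 - x $ 2 + I i 2) (w $ 3 - x $ 3 + I i 3)"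
    "jp_pos False (x $ 1 - w $ 1 + I l 1) (x $ 2 - w $ 2 + I l 2) (x $ 3 - w $ 3 + I l 3)"
    using jp_cone_pos[OF _ ok] unfolding jp_pos_def by blast+
  have "i = 1 \<or> i = 2 \<or> i = 3" "l = 1 \<or> l = 2 \<or> l = 3" "a = 1 \<or> a = 2 \<or> a = 3" "b = 1 \<or> b = 2 \<or> b = 3"
    "m = 1 \<or> m = 2 \<or> m = 3"
    by (rule exhaust_3)+
  then show ?thesis
    using a b pos by (elim disjE) (simp_all add: list_near_def eq jp_near_def axis_def jp_pos_def I_def)
qed

lemma invertible_jp: "invertible (incidence (jacobi_perron k))"
proof -
  obtain a b where k: "k = (a, b)" by (cases k)
  let ?N = "vector [vector [- int a, - int b, 1], vector [1, 0, 0], vector [0, 1, 0]] :: int^3^3"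
  have "incidence (jacobi_perron k) ** ?N = mat 1" "?N ** incidence (jacobi_perron k) = mat 1"
    unfolding k by (simp_all add: vec_eq_iff forall_3 matrix_matrix_mult_def sum_3 incidence_def
        abelianization_def jp_nth count_list_replicate_eq mat_def)
  then show ?thesis unfolding invertible_def by blast
qed

lemma push_jp:
  "push (jacobi_perron (a, b)) v $ 1 = v $ 3"
  "push (jacobi_perron (a, b)) v $ 2 = v $ 1 + int a * v $ 3"
  "push (jacobi_perron (a, b)) v $ 3 = v $ 2 + int b * v $ 3"
  by (simp_all add: push_def dot_def abelianization_def jp_nth count_list_replicate_eq)

definition jp_cone :: "int^3 \<Rightarrow> bool"
  where "jp_cone v \<longleftrightarrow> 0 < v $ 1 \<and> 0 < v $ 2 \<and> v $ 1 \<le> v $ 3 \<and> v $ 2 \<le> v $ 3"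

text \<open>The image vector is \<open>(v3, v1 + a * v3, v2 + b * v3)\<close>. Its last entry
  dominates the second by \<open>v1 \<le> v3\<close> if \<open>a < b\<close>, but for
  \<open>a = b\<close> this needs \<open>v1 \<le> v2\<close>; and \<open>a > 0\<close> ensures that
  order for the next letter.\<close>

lemma jp_cone_push:
  assumes "jp_ok v (a, b)"
  shows "jp_cone (push (jacobi_perron (a, b)) v)" "a \<noteq> 0 \<Longrightarrow> push (jacobi_perron (a, b)) v $ 1 \<le> push (jacobi_perron (a, b)) v $ 2"
proof -
  have v: "0 < v $ 1" "0 < v $ 2" "v $ 1 \<le> v $ 3" "v $ 2 \<le> v $ 3" "a \<le> b" "b \<noteq> 0" "a = b \<longrightarrow> v $ 1 \<le> v $ 2"
    using assms by (auto simp: jp_ok_def)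
  have "1 * v $ 3 \<le> int b * v $ 3" using v by (intro mult_right_mono) auto
  then have b: "v $ 3 \<le> v $ 2 + int b * v $ 3" using v(2) by linarith
  have "v $ 1 + int a * v $ 3 \<le> v $ 2 + int b * v $ 3"
  proof (cases "a = b")
    case False
    then have "(int a + 1) * v $ 3 \<le> int b * v $ 3" using v by (intro mult_right_mono) auto
    then show ?thesis using v by (simp add: algebra_simps)
  qed (use v in simp)
  then show "jp_cone (push (jacobi_perron (a, b)) v)"
    using v b by (simp add: jp_cone_def push_jp add_pos_nonneg)
  assume "a \<noteq> 0"
  then have "1 * v $ 3 \<le> int a * v $ 3" using v by (intro mult_right_mono) auto
  then show "push (jacobi_perron (a, b)) v $ 1 \<le> push (jacobi_perron (a, b)) v $ 2"
    unfolding push_jp using v(1) by linarith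
qed

text \<open>The leftmost pair acts last, on the vector produced by the pairs to its right. So the
  admissibility condition on a pair and its right neighbour is exactly the order of the first two
  entries needed when \<open>a = b\<close>.\<close>

lemma jp_run:
  assumes "jp_cone v" "v $ 1 \<le> v $ 2" "admissible_JP ps"
  shows "jp.run v ps \<and> jp_cone (jp.pushes ps v) \<and>
    ((ps = [] \<or> fst (hd ps) \<noteq> 0) \<longrightarrow> jp.pushes ps v $ 1 \<le> jp.pushes ps v $ 2)"
  using assms(3)
proof (induction ps)
  case Nil
  then show ?case using assms by (simp add: jp.pushes_def)
next
  case (Cons p ps)
  obtain a b where p: "p = (a, b)" by (cases p)
  have adm: "admissible_JP ps" and ab: "a \<le> b" "b \<noteq> 0" and tl: "a = b \<longrightarrow> ps = [] \<or> fst (hd ps) \<noteq> 0"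
    using Cons.prems by (cases ps; auto simp: admissible_JP_def p)+
  have ok: "jp_ok (jp.pushes ps v) (a, b)"
    using Cons.IH[OF adm] ab tl by (auto simp: jp_ok_def jp_cone_def)
  then show ?case
    using Cons.IH[OF adm] jp_cone_push[OF ok] by (auto simp: p jp.pushes_def)
qed

lemma jp_deep:
  assumes "admissible_JP ps" "Suc R * 17 + 4 \<le> length ps"
  shows "\<exists>P t. is_pattern P \<and> U \<subseteq> P \<and> translate t P \<subseteq> foldr Sigma_JP ps U \<and> R \<le> rad P"
proof -
  let ?v = "vector [1, 1, 1] :: int^3" and ?f = "(0, 1) :: cell"
  have run: "jp.run ?v ps" "jp_cone (jp.pushes ps ?v)"
    using jp_run[of ?v ps] assms(1) by (simp_all add: jp_cone_def)
  have weight: "jp.weight ks = length ks" for ks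
    by (simp add: jp.weight_def)
  have "\<exists>P t. is_pattern P \<and> U \<subseteq> P \<and> translate t P \<subseteq> body (jp.lifts ps {?f}) \<and> R \<le> rad P"
  proof (intro jp.rad_unbounded[of 17 4 ?v ps R ?f 0])
    show "jp.wins v c ks f" if "jp.run v ks" "17 \<le> jp.weight ks" "f \<in> plane v c" for v ks c f
      using jp_wins that by (simp add: weight)
    show "\<exists>z. \<forall>i. (z, i) \<in> jp.lifts ks {f}" if "jp.run v ks" "4 \<le> jp.weight ks" for v ks f
      using jp_vertex[of f "{f}" v ks] that by (simp add: weight)
    show "0 < jp.pushes ps ?v $ i" for i
      using run(2) exhaust_3[of i] by (auto simp: jp_cone_def)
    show "list_near jp_near f g" if "(f, g) \<in> adj (plane (jp.pushes ps ?v) 0)" for f g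
      using jp_adj_near[OF _ _ _ _ that] run(2) by (simp add: jp_cone_def)
  qed (use assms run(1) in \<open>simp_all add: weight list_near_def plane_def dot_def\<close>)
  moreover have "body (jp.lifts ps {?f}) \<subseteq> foldr Sigma_JP ps U"
    unfolding U_eq_body foldr_dual_subst[of jacobi_perron, OF invertible_jp] jp.lifts_def[symmetric]
    by (intro body_mono jp.lifts_mono) auto
  ultimately show ?thesis by (meson order_trans)
qed

theorem theorem5p4:
  shows "\<forall>R::nat. \<exists>N::nat.
    (\<forall>ks::3 list. count_list ks 3 > N \<longrightarrow>
       (\<exists>P t. is_pattern P \<and> U \<subseteq> P \<and> translate t P \<subseteq> foldr Sigma_Br ks U \<and> rad P \<ge> R)) \<and>
    (\<forall>ps::(nat \<times> nat) list. admissible_JP ps \<and> length ps \<ge> N \<longrightarrow>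
       (\<exists>P t. is_pattern P \<and> U \<subseteq> P \<and> translate t P \<subseteq> foldr Sigma_JP ps U \<and> rad P \<ge> R))"
proof
  fix R :: nat
  show "\<exists>N::nat.
    (\<forall>ks::3 list. count_list ks 3 > N \<longrightarrow>
       (\<exists>P t. is_pattern P \<and> U \<subseteq> P \<and> translate t P \<subseteq> foldr Sigma_Br ks U \<and> rad P \<ge> R)) \<and>
    (\<forall>ps::(nat \<times> nat) list. admissible_JP ps \<and> length ps \<ge> N \<longrightarrow>
       (\<exists>P t. is_pattern P \<and> U \<subseteq> P \<and> translate t P \<subseteq> foldr Sigma_JP ps U \<and> rad P \<ge> R))"
    \<comment> \<open>The larger of the two constants 13 and 17 per unit of depth serves both
      families.\<close>
    by (intro exI[of _ "Suc R * 17 + 4"] conjI allI impI brun_deep jp_deep) auto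
qed

end
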